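(* Suppose that Assumptions A1 and A2 hold and that $L(m)=c_2(m)\log m$ with $\lim_{m\to\infty}c_2(m)=\infty$. Define, for $t\ge0$, $$\mathcal K_n^{(3)}(t):=\frac{1}{\Phi(n)\sqrt{\log n}}\Big\{\mathcal K_n(t)-\int_{(\log n-t)_+}^{\log n}\Phi(e^v)\,dv\Big\},$$ and, for $u\in\mathbb R$ and $t\ge0$, $$G_n[u](t):=\sigma u-\frac{1}{\Phi(n)\sqrt{\log n}}\int_{(\log n-t)_+}^{(\log n-t+\sigma u\sqrt{\log n})_+}\Phi(e^v)\,dv .$$ Let $Y_n^{(3)}:=G_n[U]$, where $U$ is a standard normal random variable. Then $$d_{BW}^0\big(\mathcal L(\mathcal K_n^{(3)}),\mathcal L(Y_n^{(3)})\big)\to0\quad\text{as } n\to\infty,$$ where $\mathcal L(\cdot)$ denotes the law of a process.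
   Context: Setting. $S=(S_t)_{t\ge0}$ is a subordinator (increasing càdlàg Lévy process, $S_0=0$) with zero drift, no killing and Lévy measure $\nu_0$ on $(0,\infty)$, normalised so that $\mathbb E S_t=t$, and with $\mathrm{Var}\,S_t=\sigma^2t$, $\sigma^2<\infty$, $\sigma=\sqrt{\sigma^2}$. Put $N_0(x)=\nu_0[x,\infty)$ and $\Phi(s)=\int_0^\infty\big(1-e^{-s(1-e^{-x})}\big)\nu_0(dx)$ for $s\ge0$. For real $n>0$, $\Pi_n$ is a Poisson point process on $(0,\infty)$ with intensity $ne^{-x}dx$, independent of $S$. $\mathcal K_n(T)$ is the number of $t\in[0,T]$ with $\Pi_n\cap(S_{t-},S_t)\ne\emptyset$. Assumption A1: $y\mapsto N_0(1/y)$ is unbounded and slowly varying as $y\to\infty$. $L(s):=\Phi(s)/(s\Phi'(s))$ for $s>0$. Assumption A2: there exist $s_0\ge1$ and $k>0$ such that $|sL'(s)/L(s)|<k/\log s$ for all $s\ge s_0$. Notation: $x_+=\max(x,0)$. Bounded Wasserstein distance: for probability measures $Q,Q'$ on a metric space $(\mathcal X,\rho)$, $d_{BW}(Q,Q')=\sup_f|\int f\,dQ-\int f\,dQ'|$, the supremum over all $f:\mathcal X\to\mathbb R$ with $\sup|f|\le1$ and $|f(x)-f(x')|\le\rho(x,x')$ for all $x,x'$. $d_{BW}^0$ is this distance for $\mathcal X=D_0[0,\infty)$, the space of càdlàg functions $x:[0,\infty)\to\mathbb R$ having a finite limit at $\infty$, with $\rho_0(x,y)=\sup_{t\ge0}|x(t)-y(t)|$.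 *)

theory Defs
  imports "HOL-Probability.Probability"
begin

section \<open>Paths on the half-line\<close>

definition cadlag :: "(real \<Rightarrow> real) \<Rightarrow> bool" where
  "cadlag x \<longleftrightarrow>
     (\<forall>t\<ge>0. (x \<longlongrightarrow> x t) (at_right t)) \<and>
     (\<forall>t>0. \<exists>l. (x \<longlongrightarrow> l) (at_left t))"

text \<open>The convention at the origin is \<open>x(0-) = x(0)\<close>, so that no path jumps at time 0.\<close>

definition left_lim :: "(real \<Rightarrow> real) \<Rightarrow> real \<Rightarrow> real" where
  "left_lim x t = (if t \<le> 0 then x 0 else Lim (at_left t) x)"

text \<open>Functions on \<open>[0,\<infinity>)\<close> are encoded as functions on the reals that take the value
  \<open>undefined\<close> off \<open>{0..}\<close>.\<close>

definition D0 :: "(real \<Rightarrow> real) set" where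
  "D0 = {x \<in> extensional {0..}. cadlag x \<and> (\<exists>l. (x \<longlongrightarrow> l) at_top)}"

definition rho0 :: "(real \<Rightarrow> real) \<Rightarrow> (real \<Rightarrow> real) \<Rightarrow> real" where
  "rho0 x y = (SUP t\<in>{0..}. \<bar>x t - y t\<bar>)"

text \<open>Laws of processes live on the \<open>\<sigma>\<close>-algebra of \<open>D0\<close> generated by the coordinate
  projections. The Borel \<open>\<sigma>\<close>-algebra of the non-separable metric \<open>rho0\<close> is too large:
  jump processes are in general not measurable with respect to it.\<close>

definition D0_space :: "(real \<Rightarrow> real) measure" where
  "D0_space = restrict_space (\<Pi>\<^sub>M t\<in>{0..}. borel) D0"

definition process_law :: "'a measure \<Rightarrow> (real \<Rightarrow> 'a \<Rightarrow> real) \<Rightarrow> (real \<Rightarrow> real) measure" where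
  "process_law M X = distr M D0_space (\<lambda>\<omega>. \<lambda>t\<in>{0..}. X t \<omega>)"

section \<open>Bounded Wasserstein distance\<close>

text \<open>The test functions are those whose integrals against \<open>Q\<close> and \<open>Q'\<close> make sense, i.e. the
  measurable ones. Measurability follows from the Lipschitz condition when the measures are
  defined on the Borel \<open>\<sigma>\<close>-algebra of the metric, but not on \<open>D0_space\<close>.\<close>

definition bw_dist :: "('a \<Rightarrow> 'a \<Rightarrow> real) \<Rightarrow> 'a measure \<Rightarrow> 'a measure \<Rightarrow> real" where
  "bw_dist \<rho> Q Q' =
     Sup {\<bar>(\<integral>x. f x \<partial>Q) - (\<integral>x. f x \<partial>Q')\<bar> | f.
            f \<in> borel_measurable Q \<and> f \<in> borel_measurable Q' \<and>
            (\<forall>x \<in> space Q. \<bar>f x\<bar> \<le> 1) \<and>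
            (\<forall>x \<in> space Q. \<forall>x' \<in> space Q. \<bar>f x - f x'\<bar> \<le> \<rho> x x')}"

abbreviation bw_dist0 :: "(real \<Rightarrow> real) measure \<Rightarrow> (real \<Rightarrow> real) measure \<Rightarrow> real" where
  "bw_dist0 \<equiv> bw_dist rho0"

section \<open>Subordinators and Poisson point processes\<close>

text \<open>Real-valuedness of \<open>S\<close> expresses that there is no killing.\<close>

definition subordinator :: "'a measure \<Rightarrow> (real \<Rightarrow> 'a \<Rightarrow> real) \<Rightarrow> bool" where
  "subordinator M S \<longleftrightarrow>
     prob_space M \<and>
     (\<forall>t\<ge>0. S t \<in> borel_measurable M) \<and>
     (\<forall>\<omega>\<in>space M. S 0 \<omega> = 0) \<and>
     (\<forall>\<omega>\<in>space M. mono_on {0..} (\<lambda>t. S t \<omega>) \<and> cadlag (\<lambda>t. S t \<omega>)) \<and>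
     (\<forall>s\<ge>0. \<forall>t\<ge>0. distr M borel (\<lambda>\<omega>. S (s + t) \<omega> - S s \<omega>) = distr M borel (S t)) \<and>
     (\<forall>(k::nat) \<tau>. 0 \<le> \<tau> 0 \<longrightarrow> (\<forall>i<k. \<tau> i \<le> \<tau> (Suc i)) \<longrightarrow>
        prob_space.indep_vars M (\<lambda>_. borel) (\<lambda>i \<omega>. S (\<tau> (Suc i)) \<omega> - S (\<tau> i) \<omega>) {..<k})"

definition subordinator_levy_measure :: "real measure \<Rightarrow> bool" where
  "subordinator_levy_measure \<nu> \<longleftrightarrow>
     sets \<nu> = sets borel \<and> emeasure \<nu> {..0} = 0 \<and>
     (\<integral>\<^sup>+x. ennreal (min 1 x) \<partial>\<nu>) < \<infinity>"

text \<open>The drift \<open>d\<close> and the Levy measure \<open>\<nu>\<close> are the characteristics in the Levy--Khintchine formula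
  \<open>E (exp (- s S\<^sub>t)) = exp (- t (d s + \<integral>(1 - exp (- s x)) \<nu>(dx)))\<close>.\<close>

definition has_drift_levy_measure ::
  "'a measure \<Rightarrow> (real \<Rightarrow> 'a \<Rightarrow> real) \<Rightarrow> real \<Rightarrow> real measure \<Rightarrow> bool" where
  "has_drift_levy_measure M S d \<nu> \<longleftrightarrow>
     subordinator_levy_measure \<nu> \<and>
     (\<forall>t\<ge>0. \<forall>s\<ge>0. (\<integral>\<omega>. exp (- s * S t \<omega>) \<partial>M) =
        exp (- t * (d * s + (LINT x:{0<..}|\<nu>. 1 - exp (- s * x)))))"

text \<open>Only atomless intensities \<open>\<mu>\<close> of finite total mass are needed; the point process is then
  almost surely finite and simple, and is represented by its random set of points.\<close>

definition poisson_point_process ::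
  "'a measure \<Rightarrow> ('a \<Rightarrow> real set) \<Rightarrow> real measure \<Rightarrow> bool" where
  "poisson_point_process M \<xi> \<mu> \<longleftrightarrow>
     (\<forall>\<omega>\<in>space M. finite (\<xi> \<omega>)) \<and>
     (\<forall>A\<in>sets \<mu>. (\<lambda>\<omega>. card (\<xi> \<omega> \<inter> A)) \<in> measurable M (count_space UNIV) \<and>
        (\<forall>j::nat. measure M {\<omega> \<in> space M. card (\<xi> \<omega> \<inter> A) = j} =
           exp (- measure \<mu> A) * measure \<mu> A ^ j / fact j)) \<and>
     (\<forall>(k::nat) A. A ` {..<k} \<subseteq> sets \<mu> \<longrightarrow> disjoint_family_on A {..<k} \<longrightarrow>
        prob_space.indep_vars M (\<lambda>_. count_space UNIV) (\<lambda>i \<omega>. card (\<xi> \<omega> \<inter> A i)) {..<k})"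

definition exp_intensity :: "real \<Rightarrow> real measure" where
  "exp_intensity n = density lborel (\<lambda>x. ennreal (n * exp (- x)) * indicator {0<..} x)"

definition indep_of_process ::
  "'a measure \<Rightarrow> ('a \<Rightarrow> real set) \<Rightarrow> (real \<Rightarrow> 'a \<Rightarrow> real) \<Rightarrow> bool" where
  "indep_of_process M \<xi> S \<longleftrightarrow>
     prob_space.indep_set M
       (sets (vimage_algebra (space M) (\<lambda>\<omega>. \<lambda>A\<in>sets borel. card (\<xi> \<omega> \<inter> A))
                (\<Pi>\<^sub>M A\<in>sets borel. count_space UNIV)))
       (sets (vimage_algebra (space M) (\<lambda>\<omega>. \<lambda>t\<in>{0..}. S t \<omega>) (\<Pi>\<^sub>M t\<in>{0..}. borel)))"

section \<open>The counting process and its approximation\<close>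

definition K_count :: "(real \<Rightarrow> 'a \<Rightarrow> real) \<Rightarrow> ('a \<Rightarrow> real set) \<Rightarrow> real \<Rightarrow> 'a \<Rightarrow> nat" where
  "K_count S \<xi> T \<omega> =
     card {t \<in> {0..T}. \<xi> \<omega> \<inter> {left_lim (\<lambda>s. S s \<omega>) t <..< S t \<omega>} \<noteq> {}}"

definition N0 :: "real measure \<Rightarrow> real \<Rightarrow> real" where
  "N0 \<nu> x = measure \<nu> {x..}"

definition Phi :: "real measure \<Rightarrow> real \<Rightarrow> real" where
  "Phi \<nu> s = (LINT x:{0<..}|\<nu>. 1 - exp (- s * (1 - exp (- x))))"

definition L_fun :: "real measure \<Rightarrow> real \<Rightarrow> real" where
  "L_fun \<nu> s = Phi \<nu> s / (s * deriv (Phi \<nu>) s)"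

definition slowly_varying :: "(real \<Rightarrow> real) \<Rightarrow> bool" where
  "slowly_varying f \<longleftrightarrow>
     (\<exists>a>0. (\<forall>y\<ge>a. f y > 0) \<and> f \<in> borel_measurable (restrict_space borel {a..})) \<and>
     (\<forall>c>0. ((\<lambda>y. f (c * y) / f y) \<longlongrightarrow> 1) at_top)"

definition assumption_A1 :: "real measure \<Rightarrow> bool" where
  "assumption_A1 \<nu> \<longleftrightarrow>
     \<not> bdd_above ((\<lambda>y. N0 \<nu> (1 / y)) ` {0<..}) \<and> slowly_varying (\<lambda>y. N0 \<nu> (1 / y))"

definition assumption_A2 :: "real measure \<Rightarrow> bool" where
  "assumption_A2 \<nu> \<longleftrightarrow>
     (\<exists>s0\<ge>1. \<exists>k>0. \<forall>s\<ge>s0. \<bar>s * deriv (L_fun \<nu>) s / L_fun \<nu> s\<bar> < k / ln s)"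

definition pos_part :: "real \<Rightarrow> real" where
  "pos_part x = max x 0"

definition K3 ::
  "real measure \<Rightarrow> (real \<Rightarrow> 'a \<Rightarrow> real) \<Rightarrow> ('a \<Rightarrow> real set) \<Rightarrow> real \<Rightarrow> real \<Rightarrow> 'a \<Rightarrow> real" where
  "K3 \<nu> S \<xi> n t \<omega> =
     1 / (Phi \<nu> n * sqrt (ln n)) *
       (real (K_count S \<xi> t \<omega>)
        - (LBINT v=ereal (pos_part (ln n - t))..ereal (ln n). Phi \<nu> (exp v)))"

definition G :: "real measure \<Rightarrow> real \<Rightarrow> real \<Rightarrow> real \<Rightarrow> real \<Rightarrow> real" where
  "G \<nu> \<sigma> n u t =
     \<sigma> * u - 1 / (Phi \<nu> n * sqrt (ln n)) *
       (LBINT v=ereal (pos_part (ln n - t))..ereal (pos_part (ln n - t + \<sigma> * u * sqrt (ln n))).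
          Phi \<nu> (exp v))"

end

theory Submission
  imports Defs "HOL-Real_Asymp.Real_Asymp"
begin

text \<open>The compensator of \<open>K_count\<close> is \<open>A t = \<integral> Phi (n exp (- S u)) du\<close> over \<open>[0, t]\<close>, and a maximal
  inequality bounds \<open>K_count - A\<close> by \<open>o (Phi n sqrt (ln n))\<close> uniformly in time, because
  \<open>E (A T) \<le> T Phi n\<close> and \<open>Phi n \<rightarrow> \<infinity>\<close>. To avoid jump measures, the process is sampled on a
  dyadic time mesh: given \<open>S\<close>, the cells are hit independently, and the conditional hitting
  probabilities are compensated along \<open>S\<close>; with zero drift the sampled count coincides with
  \<open>K_count\<close> for fine meshes.

  Since \<open>c2 \<rightarrow> \<infinity>\<close>, the function \<open>g v = Phi (exp v)\<close> is slowly varying and satisfies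
  \<open>g' v = o (g v / v)\<close>. With \<open>a = ln n\<close>, the path \<open>a - S u\<close> in \<open>A t = \<integral> g (a - S u) du\<close> may
  therefore be replaced by \<open>a - u + y\<close> with a random constant \<open>y\<close>: far from time \<open>a\<close> the slope of
  \<open>g\<close> is small, and near time \<open>a\<close> the increments of \<open>S u - u\<close> are \<open>o (sqrt a)\<close>. Here \<open>y / sqrt a\<close>
  is asymptotically \<open>\<sigma> U\<close> by the central limit theorem, and the deterministic integral that
  remains is \<open>G\<close> evaluated at \<open>U\<close>.\<close>

section \<open>Laplace exponents\<close>

text \<open>The normalisation retains one source of randomness only. Up to time
  \<open>2 * ln n\<close> the fluctuations of \<open>K_count\<close> about its compensator have
  order \<open>sqrt (ln n * Phi n)\<close>, which is negligible against
  \<open>Phi n * sqrt (ln n)\<close>. The compensator itself fluctuates on exactly this scale: its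
  integrand, of size \<open>Phi n\<close>, is shifted by a distance of order
  \<open>sqrt (ln n)\<close>. The shift is a single number, so the central limit theorem is applied
  at one integer time, and no functional limit theorem enters. A weak limit on the line controls a
  distance between processes because \<open>G\<close> is Lipschitz in its Gaussian argument on
  bounded sets, uniformly in time: a test function on paths composed with \<open>G\<close> is a test
  function on the line. The obstacle to sampling is that \<open>K_count\<close> asks for a point
  strictly inside a jump interval, whereas a mesh only sees whether a point lies between two
  successive positions of \<open>S\<close>. The counts may differ when a point falls on the closed
  range of \<open>S\<close>. The Laplace exponent is the available information on that range, and
  its sublinearity excludes such points.\<close>

definition psi :: "real measure \<Rightarrow> real \<Rightarrow> real" where
  "psi \<nu> s = (LINT x:{0<..}|\<nu>. 1 - exp (- s * x))"

lemma one_minus_exp_le: "1 - exp (- x) \<le> (x::real)"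
  using exp_ge_add_one_self[of "- x"] by linarith

lemma one_minus_exp_ge: "0 \<le> x \<Longrightarrow> x - x\<^sup>2 / 2 \<le> 1 - exp (- (x::real))"
proof -
  assume x: "0 \<le> x"
  have "1 - exp (- x) - (x - x\<^sup>2 / 2) \<ge> 1 - exp (- 0) - (0 - 0\<^sup>2 / 2)"
  proof (rule DERIV_nonneg_imp_nondecreasing[OF x])
    fix y :: real assume "0 \<le> y"
    have "((\<lambda>x. 1 - exp (- x) - (x - x\<^sup>2 / 2)) has_real_derivative (exp (- y) - (1 - y))) (at y)"
      by (auto intro!: derivative_eq_intros)
    moreover have "exp (- y) - (1 - y) \<ge> 0" using one_minus_exp_le[of y] by simp
    ultimately show "\<exists>z. ((\<lambda>x. 1 - exp (- x) - (x - x\<^sup>2 / 2)) has_real_derivative z) (at y) \<and> 0 \<le> z" by blast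
  qed
  then show ?thesis by simp
qed

text \<open>Bernoulli's inequality. It dominates every Laplace integrand by a multiple of
  \<open>1 - exp (- x)\<close>, whose integrability comes directly from the condition on the Levy
  measure.\<close>

lemma one_minus_exp_mult_le:
  fixes x :: real assumes "0 \<le> x" shows "1 - exp (- (real k * x)) \<le> real k * (1 - exp (- x))"
proof -
  have "exp (- (real k * x)) = (1 + (exp (- x) - 1)) ^ k"
    by (simp add: exp_of_nat_mult[symmetric])
  also have "\<dots> \<ge> 1 + real k * (exp (- x) - 1)"
    by (rule Bernoulli_inequality) simp
  finally show ?thesis by (simp add: algebra_simps)
qed

locale levy =
  fixes \<nu> :: "real measure"
  assumes lm: "subordinator_levy_measure \<nu>"
begin

lemma sets_nu [measurable_cong, simp]: "sets \<nu> = sets borel"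
  using lm by (simp add: subordinator_levy_measure_def)

lemma space_nu [simp]: "space \<nu> = UNIV"
  using sets_eq_imp_space_eq[OF sets_nu] by simp

lemma integrable_base: "set_integrable \<nu> {0<..} (\<lambda>x. 1 - exp (- x))"
  unfolding set_integrable_def
proof (rule integrableI_bounded)
  have "(\<integral>\<^sup>+ x. ennreal (norm (indicat_real {0<..} x *\<^sub>R (1 - exp (- x)))) \<partial>\<nu>)
      \<le> (\<integral>\<^sup>+x. ennreal (min 1 x) \<partial>\<nu>)"
  proof (intro nn_integral_mono)
    fix x :: real
    show "ennreal (norm (indicat_real {0<..} x *\<^sub>R (1 - exp (- x)))) \<le> ennreal (min 1 x)"
      using one_minus_exp_le[of x] by (cases "0 < x") (auto intro!: ennreal_leI)
  qed
  also have "\<dots> < \<infinity>" using lm by (simp add: subordinator_levy_measure_def)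
  finally show "(\<integral>\<^sup>+ x. ennreal (norm (indicat_real {0<..} x *\<^sub>R (1 - exp (- x)))) \<partial>\<nu>) < \<infinity>" .
qed measurable

lemma set_integrable_levy:
  assumes [measurable]: "f \<in> borel_measurable borel"
    and b: "\<And>x. 0 < x \<Longrightarrow> \<bar>f x\<bar> \<le> C * (1 - exp (- x))"
  shows "set_integrable \<nu> {0<..} f"
proof -
  have "integrable \<nu> (\<lambda>x. C * (indicat_real {0<..} x *\<^sub>R (1 - exp (- x))))"
    using integrable_base unfolding set_integrable_def by simp
  then show ?thesis unfolding set_integrable_def
  proof (rule Bochner_Integration.integrable_bound)
    show "AE x in \<nu>. norm (indicat_real {0<..} x *\<^sub>R f x)
        \<le> norm (C * (indicat_real {0<..} x *\<^sub>R (1 - exp (- x))))"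
      using b by (auto simp: indicator_def intro!: AE_I2 order_trans[OF b abs_ge_self])
  qed measurable
qed

lemma set_integral_mono_levy:
  fixes f g :: "real \<Rightarrow> real"
  assumes "set_integrable \<nu> {0<..} f" "set_integrable \<nu> {0<..} g" "\<And>x. 0 < x \<Longrightarrow> f x \<le> g x"
  shows "(LINT x:{0<..}|\<nu>. f x) \<le> (LINT x:{0<..}|\<nu>. g x)"
  unfolding set_lebesgue_integral_def
  using assms by (intro integral_mono) (auto simp: set_integrable_def indicator_def)

lemma integrable_psi: "0 \<le> s \<Longrightarrow> set_integrable \<nu> {0<..} (\<lambda>x. 1 - exp (- s * x))"
proof (rule set_integrable_levy[where C = "real (nat \<lceil>s\<rceil>)"])
  fix x :: real assume s: "0 \<le> s" and x: "0 < x"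
  have "s * x \<le> real (nat \<lceil>s\<rceil>) * x" using s x by (intro mult_right_mono) auto
  then have "1 - exp (- s * x) \<le> 1 - exp (- (real (nat \<lceil>s\<rceil>) * x))" by simp
  also have "\<dots> \<le> real (nat \<lceil>s\<rceil>) * (1 - exp (- x))" using x by (intro one_minus_exp_mult_le) simp
  finally show "\<bar>1 - exp (- s * x)\<bar> \<le> real (nat \<lceil>s\<rceil>) * (1 - exp (- x))" using s x by simp
qed measurable

lemma psi_nonneg: "0 \<le> s \<Longrightarrow> 0 \<le> psi \<nu> s"
  unfolding psi_def set_lebesgue_integral_def
  by (intro integral_nonneg_AE AE_I2) (auto simp: indicator_def)

text \<open>Linear growth along the integers is what the Poisson expansions below ask of
  \<open>psi\<close>: it makes the series converge and bounds their second-order terms.\<close>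

lemma psi_le: "psi \<nu> (real k) \<le> real k * psi \<nu> 1"
proof -
  have "psi \<nu> (real k) \<le> (LINT x:{0<..}|\<nu>. real k * (1 - exp (- 1 * x)))"
    unfolding psi_def
    by (intro set_integral_mono_levy integrable_psi set_integrable_mult_right)
      (auto intro!: integrable_psi one_minus_exp_mult_le[simplified] simp: one_minus_exp_mult_le)
  then show ?thesis by (simp add: psi_def)
qed

text \<open>With a positive drift the Laplace exponent would grow linearly. Sublinearity makes the range of
  the subordinator negligible, so that the point process almost surely misses it.\<close>

lemma psi_sublinear: "(\<lambda>i. psi \<nu> (real (Suc i)) / real (Suc i)) \<longlonglongrightarrow> 0"
proof -
  have "(\<lambda>i. LINT x|\<nu>. indicat_real {0<..} x * ((1 - exp (- real (Suc i) * x)) / real (Suc i)))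
      \<longlonglongrightarrow> (LINT x|\<nu>. 0)"
  proof (rule integral_dominated_convergence)
    show "integrable \<nu> (\<lambda>x. indicat_real {0<..} x *\<^sub>R (1 - exp (- x)))"
      using integrable_base by (simp add: set_integrable_def)
    show "AE x in \<nu>. (\<lambda>i. indicat_real {0<..} x * ((1 - exp (- real (Suc i) * x)) / real (Suc i))) \<longlonglongrightarrow> 0"
    proof (intro AE_I2)
      fix x :: real
      show "(\<lambda>i. indicat_real {0<..} x * ((1 - exp (- real (Suc i) * x)) / real (Suc i))) \<longlonglongrightarrow> 0"
      proof (rule Lim_null_comparison)
        show "(\<lambda>i. 1 / real (Suc i)) \<longlonglongrightarrow> 0" by (rule lim_1_over_n[THEN LIMSEQ_Suc])
        show "\<forall>\<^sub>F i in sequentially. norm (indicat_real {0<..} x * ((1 - exp (- real (Suc i) * x)) / real (Suc i))) \<le> 1 / real (Suc i)"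
        proof (intro always_eventually allI)
          fix i
          have "\<bar>1 - exp (- (real (Suc i) * x))\<bar> \<le> 1" if "0 < x" using that by (simp del: of_nat_Suc)
          then show "norm (indicat_real {0<..} x * ((1 - exp (- real (Suc i) * x)) / real (Suc i))) \<le> 1 / real (Suc i)"
            by (auto simp: indicator_def divide_right_mono simp del: of_nat_Suc)
        qed
      qed
    qed
    \<comment> \<open>The quotients are bounded by their value at 1, which is integrable although
      \<open>\<nu>\<close> may have infinite mass.\<close>
    show "AE x in \<nu>. norm (indicat_real {0<..} x * ((1 - exp (- real (Suc i) * x)) / real (Suc i)))
        \<le> indicat_real {0<..} x *\<^sub>R (1 - exp (- x))" for i
    proof (intro AE_I2)
      fix x :: real
      have "\<bar>1 - exp (- real (Suc i) * x)\<bar> \<le> (1 - exp (- x)) * real (Suc i)" if "0 < x"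
        using one_minus_exp_mult_le[of x "Suc i"] that by (simp del: of_nat_Suc add: mult.commute)
      then show "norm (indicat_real {0<..} x * ((1 - exp (- real (Suc i) * x)) / real (Suc i)))
          \<le> indicat_real {0<..} x *\<^sub>R (1 - exp (- x))"
        by (auto simp: indicator_def pos_divide_le_eq simp del: of_nat_Suc)
    qed
  qed measurable
  moreover have "(LINT x|\<nu>. indicat_real {0<..} x * ((1 - exp (- real (Suc i) * x)) / real (Suc i)))
      = psi \<nu> (real (Suc i)) / real (Suc i)" for i
    unfolding psi_def set_lebesgue_integral_def
    by (subst integral_divide_zero[symmetric]) (simp add: mult.commute)
  ultimately show ?thesis by simp
qed

lemma integrable_Phi: "0 \<le> s \<Longrightarrow> set_integrable \<nu> {0<..} (\<lambda>x. 1 - exp (- s * (1 - exp (- x))))"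
proof (rule set_integrable_levy[where C = s])
  fix x :: real assume s: "0 \<le> s" and x: "0 < x"
  show "\<bar>1 - exp (- s * (1 - exp (- x)))\<bar> \<le> s * (1 - exp (- x))"
    using s x one_minus_exp_le[of "s * (1 - exp (- x))"] by auto
qed measurable

lemma Phi_nonneg: "0 \<le> s \<Longrightarrow> 0 \<le> Phi \<nu> s"
  unfolding Phi_def set_lebesgue_integral_def
  by (intro integral_nonneg_AE AE_I2) (auto simp: indicator_def)

lemma Phi_le: "0 \<le> s \<Longrightarrow> Phi \<nu> s \<le> s * psi \<nu> 1"
proof -
  assume s: "0 \<le> s"
  have "Phi \<nu> s \<le> (LINT x:{0<..}|\<nu>. s * (1 - exp (- 1 * x)))"
    unfolding Phi_def
    using s one_minus_exp_le
    by (intro set_integral_mono_levy integrable_Phi set_integrable_mult_right)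
      (auto intro!: integrable_psi integrable_psi[of 1, simplified] simp: minus_mult_left[symmetric])
  then show ?thesis by (simp add: psi_def)
qed

lemma Phi_mono: "0 \<le> s \<Longrightarrow> s \<le> t \<Longrightarrow> Phi \<nu> s \<le> Phi \<nu> t"
  unfolding Phi_def
  by (intro set_integral_mono_levy integrable_Phi) (auto intro!: mult_right_mono)

text \<open>A quadratic remainder estimate replaces differentiation under the integral sign. As
  \<open>w x = 1 - exp (- x)\<close> lies between 0 and 1, the square of \<open>r * w x\<close> is
  at most \<open>r\<^sup>2 * w x\<close>, and \<open>w\<close> is integrable with integral
  \<open>psi \<nu> 1\<close>.\<close>

lemma Phi_differentiable:
  assumes s: "0 < s"
  shows "(Phi \<nu> has_real_derivative
    (LINT x:{0<..}|\<nu>. (1 - exp (- x)) * exp (- s * (1 - exp (- x))))) (at s)"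
proof -
  define w where "w x = 1 - exp (- x)" for x :: real
  have w: "0 \<le> w x" "w x \<le> 1" if "0 < x" for x using that by (auto simp: w_def)
  have [measurable]: "w \<in> borel_measurable borel" unfolding w_def by measurable
  define D where "D = (LINT x:{0<..}|\<nu>. w x * exp (- s * w x))"
  have iw: "set_integrable \<nu> {0<..} w" using integrable_base by (simp add: w_def[abs_def])
  have iD: "set_integrable \<nu> {0<..} (\<lambda>x. w x * exp (- s * w x))"
  proof (rule set_integrable_levy[where C = 1])
    fix x :: real assume x: "0 < x"
    have "w x * exp (- s * w x) \<le> w x * 1" using w[OF x] s by (intro mult_left_mono) auto
    then show "\<bar>w x * exp (- s * w x)\<bar> \<le> 1 * (1 - exp (- x))" using w[OF x] by (simp add: w_def)
  qed measurable
  \<comment> \<open>The constant 1 instead of 1/2 is crude, but valid for both signs of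
    \<open>y\<close>.\<close>
  have quad: "\<bar>exp (- y) - 1 + y\<bar> \<le> y\<^sup>2" if "\<bar>y\<bar> \<le> 1" for y :: real
  proof (cases "0 \<le> y")
    case True
    then show ?thesis using one_minus_exp_ge[of y] one_minus_exp_le[of y] zero_le_power2[of y] by linarith
  next
    case False
    then show ?thesis using exp_bound[of "- y"] that one_minus_exp_le[of y] by simp
  qed
  have abs_square_div: "c * r\<^sup>2 / \<bar>r\<bar> = c * \<bar>r\<bar>" for c r :: real
  proof -
    have "c * r\<^sup>2 / \<bar>r\<bar> = c * (\<bar>r\<bar> * \<bar>r\<bar>) / \<bar>r\<bar>" by (simp add: power2_eq_square)
    then show ?thesis by (simp only: times_divide_eq_right[symmetric]) simp
  qed
  \<comment> \<open>The condition \<open>\<bar>r\<bar> \<le> s\<close> keeps \<open>s + r\<close>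
    nonnegative, so that \<open>integrable_Phi\<close> applies to it.\<close>
  have est: "\<bar>Phi \<nu> (s + r) - Phi \<nu> s - r * D\<bar> \<le> psi \<nu> 1 * r\<^sup>2" if r: "\<bar>r\<bar> \<le> 1" "\<bar>r\<bar> \<le> s" for r
  proof -
    have 1: "set_integrable \<nu> {0<..} (\<lambda>x. 1 - exp (- (s + r) * w x))"
      using integrable_Phi[of "s + r"] r by (simp add: w_def)
    have 2: "set_integrable \<nu> {0<..} (\<lambda>x. 1 - exp (- s * w x))"
      using integrable_Phi[of "s"] s by (simp add: w_def)
    have "Phi \<nu> (s + r) - Phi \<nu> s - r * D =
      (LINT x:{0<..}|\<nu>. ((1 - exp (- (s + r) * w x)) - (1 - exp (- s * w x))) - r * (w x * exp (- s * w x)))"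
    proof -
      have "(LINT x:{0<..}|\<nu>. ((1 - exp (- (s + r) * w x)) - (1 - exp (- s * w x))) - r * (w x * exp (- s * w x)))
        = ((LINT x:{0<..}|\<nu>. 1 - exp (- (s + r) * w x)) - (LINT x:{0<..}|\<nu>. 1 - exp (- s * w x)))
          - (LINT x:{0<..}|\<nu>. r * (w x * exp (- s * w x)))"
        using set_integral_diff[OF 1 2] set_integral_diff(2)[OF set_integral_diff(1)[OF 1 2] set_integrable_mult_right[of r, OF iD]]
        by simp
      then show ?thesis by (simp add: Phi_def D_def w_def)
    qed
    also have "\<bar>\<dots>\<bar> \<le> (LINT x:{0<..}|\<nu>. r\<^sup>2 * w x)"
      unfolding set_lebesgue_integral_def
    proof (rule order_trans[OF integral_abs_bound integral_mono])
      show "integrable \<nu> (\<lambda>x. \<bar>indicat_real {0<..} x *\<^sub>R (1 - exp (- (s + r) * w x) - (1 - exp (- s * w x)) - r * (w x * exp (- s * w x)))\<bar>)"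
        using set_integral_diff(1)[OF set_integral_diff(1)[OF 1 2] set_integrable_mult_right[of r, OF iD]]
        unfolding set_integrable_def by (intro integrable_abs) simp
      show "integrable \<nu> (\<lambda>x. indicat_real {0<..} x *\<^sub>R (r\<^sup>2 * w x))"
        using set_integrable_mult_right[of "r\<^sup>2", OF iw] by (simp add: set_integrable_def)
      fix x :: real
      show "\<bar>indicat_real {0<..} x *\<^sub>R (1 - exp (- (s + r) * w x) - (1 - exp (- s * w x)) - r * (w x * exp (- s * w x)))\<bar>
        \<le> indicat_real {0<..} x *\<^sub>R (r\<^sup>2 * w x)"
      proof (cases "0 < x")
        case True
        have "(1 - exp (- (s + r) * w x) - (1 - exp (- s * w x)) - r * (w x * exp (- s * w x)))
          = - (exp (- s * w x) * (exp (- (r * w x)) - 1 + r * w x))"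
          by (simp add: algebra_simps exp_add exp_diff exp_minus divide_inverse)
        then have "\<bar>1 - exp (- (s + r) * w x) - (1 - exp (- s * w x)) - r * (w x * exp (- s * w x))\<bar>
          = exp (- s * w x) * \<bar>exp (- (r * w x)) - 1 + r * w x\<bar>" by (simp add: abs_mult)
        also have "\<dots> \<le> 1 * ((r * w x)\<^sup>2)"
        proof (intro mult_mono quad)
          show "\<bar>r * w x\<bar> \<le> 1" using w[OF True] r(1) by (simp add: abs_mult mult_le_one)
        qed (use w[OF True] s in auto)
        also have "\<dots> = r\<^sup>2 * (w x * w x)" by (simp add: power2_eq_square)
        also have "\<dots> \<le> r\<^sup>2 * w x" using w[OF True] by (intro mult_left_mono) (auto simp: mult_left_le)
        finally show ?thesis using True by simp
      qed simp
    qed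
    also have "\<dots> = psi \<nu> 1 * r\<^sup>2" by (simp add: psi_def w_def)
    finally show ?thesis .
  qed
  have "(\<lambda>r. (Phi \<nu> (s + r) - Phi \<nu> s) / r) \<midarrow>0\<rightarrow> D"
  proof (rule LIM_zero_cancel)
    show "((\<lambda>r. (Phi \<nu> (s + r) - Phi \<nu> s) / r - D) \<longlongrightarrow> 0) (at 0)"
    proof (rule Lim_null_comparison)
      have "((\<lambda>r::real. psi \<nu> 1 * \<bar>r\<bar>) \<longlongrightarrow> psi \<nu> 1 * \<bar>0\<bar>) (at 0)"
        by (intro tendsto_intros)
      then show "((\<lambda>r::real. psi \<nu> 1 * \<bar>r\<bar>) \<longlongrightarrow> 0) (at 0)" by simp
      have "\<forall>\<^sub>F r in at (0::real). \<bar>r\<bar> < min 1 s \<and> r \<noteq> 0"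
        using s by (auto simp: eventually_at intro!: exI[of _ "min 1 s"])
      then show "\<forall>\<^sub>F r in at 0. norm ((Phi \<nu> (s + r) - Phi \<nu> s) / r - D) \<le> psi \<nu> 1 * \<bar>r\<bar>"
      proof eventually_elim
        case (elim r)
        have "(Phi \<nu> (s + r) - Phi \<nu> s) / r - D = (Phi \<nu> (s + r) - Phi \<nu> s - r * D) / r"
          using elim by (simp add: field_simps)
        then have "norm ((Phi \<nu> (s + r) - Phi \<nu> s) / r - D) = \<bar>Phi \<nu> (s + r) - Phi \<nu> s - r * D\<bar> / \<bar>r\<bar>"
          by simp
        also have "\<dots> \<le> psi \<nu> 1 * r\<^sup>2 / \<bar>r\<bar>" using est[of r] elim by (intro divide_right_mono) auto
        also have "\<dots> = psi \<nu> 1 * \<bar>r\<bar>" using elim by (simp add: abs_square_div)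
        finally show ?case .
      qed
    qed
  qed
  then show ?thesis unfolding DERIV_def D_def w_def .
qed

text \<open>For large \<open>s\<close> the jumps of size at least \<open>1 / y\<close> alone
  contribute half of their mass \<open>N0 \<nu> (1 / y)\<close>, and this mass is unbounded in
  \<open>y\<close>.\<close>

lemma Phi_tendsto_at_top:
  assumes "\<not> bdd_above ((\<lambda>y. N0 \<nu> (1 / y)) ` {0<..})"
  shows "filterlim (Phi \<nu>) at_top at_top"
  unfolding filterlim_at_top
proof
  fix Z :: real
  obtain y where y: "0 < y" and N: "N0 \<nu> (1 / y) > 2 * \<bar>Z\<bar>"
    using assms unfolding bdd_above_def by (auto simp: not_le)
  define A where "A = {1 / y ..}"
  define c where "c = 1 - exp (- (1 / y))"
  have c: "0 < c" using y by (simp add: c_def)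
  have mA: "measure \<nu> A > 2 * \<bar>Z\<bar>" using N by (simp add: N0_def A_def)
  \<comment> \<open>\<open>measure\<close> takes the value 0 on sets of infinite measure, so the
    strict lower bound on \<open>measure \<nu> A\<close> also yields finiteness.\<close>
  have fin: "emeasure \<nu> A < \<infinity>"
  proof (rule ccontr)
    assume "\<not> emeasure \<nu> A < \<infinity>"
    then have "emeasure \<nu> A = \<top>" by (simp add: less_top[symmetric])
    then have "measure \<nu> A = 0" by (simp add: measure_def)
    then show False using mA by simp
  qed
  have iA: "integrable \<nu> (indicat_real A)" using fin by (auto simp: A_def)
  have low: "measure \<nu> A * (1 - exp (- s * c)) \<le> Phi \<nu> s" if s: "0 \<le> s" for s
  proof -
    have "measure \<nu> A * (1 - exp (- s * c)) = (LINT x|\<nu>. indicat_real A x * (1 - exp (- s * c)))"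
      using iA by simp
    also have "\<dots> \<le> Phi \<nu> s" unfolding Phi_def set_lebesgue_integral_def
    proof (rule integral_mono)
      show "integrable \<nu> (\<lambda>x. indicat_real A x * (1 - exp (- s * c)))" using iA by simp
      show "integrable \<nu> (\<lambda>x. indicat_real {0<..} x *\<^sub>R (1 - exp (- s * (1 - exp (- x)))))"
        using integrable_Phi[OF s] by (simp add: set_integrable_def)
      fix x
      have "x \<in> A \<Longrightarrow> 0 < x" using y less_le_trans[of 0 "1/y" x] by (simp add: A_def)
      moreover have "s * c \<le> s * (1 - exp (- x))" if "x \<in> A" using that s by (intro mult_left_mono) (auto simp: c_def A_def)
      ultimately show "indicat_real A x * (1 - exp (- s * c)) \<le> indicat_real {0<..} x *\<^sub>R (1 - exp (- s * (1 - exp (- x))))"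
        using s by (auto simp: indicator_def)
    qed
    finally show ?thesis .
  qed
  \<comment> \<open>At \<open>ln 2 / c\<close> the exponential has dropped to 1/2, which is why
    \<open>N0\<close> was taken beyond twice \<open>\<bar>Z\<bar>\<close>.\<close>
  have "\<forall>\<^sub>F s in at_top. ln 2 / c \<le> s" by (rule eventually_ge_at_top)
  then show "\<forall>\<^sub>F s in at_top. Z \<le> Phi \<nu> s"
  proof eventually_elim
    case (elim s)
    have sc: "ln 2 \<le> s * c" using elim c by (simp add: pos_divide_le_eq)
    have s0: "0 \<le> s" using elim c by (meson divide_nonneg_pos ln_ge_zero one_le_numeral order_trans)
    have "exp (- s * c) \<le> exp (- ln 2)" using sc by simp
    then have "exp (- s * c) \<le> 1 / 2" by (simp add: exp_minus)
    then have "measure \<nu> A * (1/2) \<le> measure \<nu> A * (1 - exp (- s * c))" by (intro mult_left_mono) auto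
    then show ?case using low[OF s0] mA by linarith
  qed
qed

end

section \<open>Poisson expansions of \<open>Phi\<close> and of hitting probabilities\<close>

lemma poisson_gf_sums:
  fixes m z :: real shows "(\<lambda>k. exp (- m) * m ^ k / fact k * z ^ k) sums exp (- (m * (1 - z)))"
proof -
  have "(\<lambda>k. exp (- m) * ((m * z) ^ k /\<^sub>R fact k)) sums (exp (- m) * exp (m * z))"
    by (intro sums_mult exp_converges)
  moreover have "exp (- m) * ((m * z) ^ k /\<^sub>R fact k) = exp (- m) * m ^ k / fact k * z ^ k" for k
    by (simp add: power_mult_distrib divide_inverse mult_ac)
  moreover have "exp (- m) * exp (m * z) = exp (- (m * (1 - z)))"
    by (simp add: exp_add[symmetric] algebra_simps)
  ultimately show ?thesis by simp
qed

text \<open>Trades a linear factor for a geometric one, so that the majorants of the series are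
  again values of the Poisson generating function.\<close>

lemma of_nat_le_two_power: "real k \<le> 2 ^ k"
  using of_nat_less_two_power[of k, where 'a=real] by simp

context levy begin

text \<open>Expanding \<open>exp (m * exp (- x))\<close> in powers of \<open>exp (- x)\<close>
  writes the integrand of \<open>Phi\<close> as a Poisson mixture of integrands of
  \<open>psi\<close>. In probabilistic terms, \<open>psi \<nu> (real k)\<close> is the rate at which
  \<open>S\<close> passes at least one of \<open>k\<close> independent standard exponential levels,
  and \<open>Phi\<close> is this rate for a Poisson number of levels.\<close>

lemma Phi_poisson_sums:
  assumes m: "0 \<le> m"
  shows "(\<lambda>k. exp (- m) * m ^ k / fact k * psi \<nu> (real k)) sums Phi \<nu> m"
proof -
  define c where "c k = exp (- m) * m ^ k / fact k" for k
  have c: "0 \<le> c k" for k using m by (simp add: c_def)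
  define f where "f k x = indicat_real {0<..} x *\<^sub>R (c k * (1 - exp (- real k * x)))" for k x
  have int: "integrable \<nu> (f k)" for k
    using set_integrable_mult_right[of "c k", OF integrable_psi[of "real k"]]
    by (simp add: f_def[abs_def] set_integrable_def)
  have If: "(LINT x|\<nu>. f k x) = c k * psi \<nu> (real k)" for k
    unfolding f_def psi_def set_lebesgue_integral_def
    by (subst integral_mult_right_zero[symmetric]) (simp add: mult_ac)
  have nn: "norm (f k x) = f k x" for k x using c[of k] by (auto simp: f_def indicator_def)
  have sums: "(\<lambda>k. f k x) sums (indicat_real {0<..} x *\<^sub>R (1 - exp (- m * (1 - exp (- x)))))" for x
  proof -
    have "(\<lambda>k. c k * 1 ^ k - c k * exp (- x) ^ k) sums (exp (- (m * (1 - 1))) - exp (- (m * (1 - exp (- x)))))"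
      unfolding c_def by (intro sums_diff poisson_gf_sums)
    then have "(\<lambda>k. indicat_real {0<..} x *\<^sub>R (c k * 1 ^ k - c k * exp (- x) ^ k)) sums
        (indicat_real {0<..} x *\<^sub>R (exp (- (m * (1 - 1))) - exp (- (m * (1 - exp (- x))))))"
      by (rule sums_scaleR_right)
    then show ?thesis by (simp add: f_def exp_of_nat_mult[symmetric] right_diff_distrib)
  qed
  have "(\<lambda>k. LINT x|\<nu>. f k x) sums (LINT x|\<nu>. (\<Sum>k. f k x))"
  proof (rule sums_integral)
    show "AE x in \<nu>. summable (\<lambda>k. norm (f k x))" unfolding nn using sums by (auto simp: sums_iff)
    \<comment> \<open>This majorant of the integrals comes from \<open>psi_le\<close>; its sum is a
      generating function at 2.\<close>
    have "summable (\<lambda>k. c k * 2 ^ k * psi \<nu> 1)"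
      using poisson_gf_sums[of m 2] by (intro summable_mult2) (auto simp: c_def sums_iff)
    then show "summable (\<lambda>k. LINT x|\<nu>. norm (f k x))"
    proof (rule summable_comparison_test_ev[rotated])
      show "\<forall>\<^sub>F k in sequentially. norm (LINT x|\<nu>. norm (f k x)) \<le> c k * 2 ^ k * psi \<nu> 1"
      proof (intro always_eventually allI)
        fix k
        have "psi \<nu> (real k) \<le> 2 ^ k * psi \<nu> 1"
          using psi_le[of k] mult_right_mono[OF of_nat_le_two_power psi_nonneg[of 1], of k] by simp
        then have "c k * psi \<nu> (real k) \<le> c k * (2 ^ k * psi \<nu> 1)" using c by (intro mult_left_mono)
        then show "norm (LINT x|\<nu>. norm (f k x)) \<le> c k * 2 ^ k * psi \<nu> 1"
          unfolding nn If using c[of k] psi_nonneg[of "real k"] by (simp add: mult.assoc)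
      qed
    qed
  qed (rule int)
  moreover have "(\<Sum>k. f k x) = indicat_real {0<..} x *\<^sub>R (1 - exp (- m * (1 - exp (- x))))" for x
    using sums[of x] by (rule sums_unique[symmetric])
  ultimately show ?thesis by (simp add: If Phi_def set_lebesgue_integral_def c_def)
qed

end

locale zero_drift_subordinator = levy \<nu> + prob_space M
  for M :: "'a measure" and S :: "real \<Rightarrow> 'a \<Rightarrow> real" and \<nu> :: "real measure" +
  assumes sub: "subordinator M S" and dl: "has_drift_levy_measure M S 0 \<nu>"
begin

lemma S_measurable [measurable]: "0 \<le> t \<Longrightarrow> S t \<in> borel_measurable M"
  using sub by (simp add: subordinator_def)

lemma S_zero: "\<omega> \<in> space M \<Longrightarrow> S 0 \<omega> = 0"
  using sub by (simp add: subordinator_def)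

lemma S_mono: "\<omega> \<in> space M \<Longrightarrow> 0 \<le> s \<Longrightarrow> s \<le> t \<Longrightarrow> S s \<omega> \<le> S t \<omega>"
  using sub by (auto simp: subordinator_def mono_on_def)

lemma S_nonneg: "\<omega> \<in> space M \<Longrightarrow> 0 \<le> t \<Longrightarrow> 0 \<le> S t \<omega>"
  using S_mono[of \<omega> 0 t] S_zero[of \<omega>] by simp

lemma increment_distr:
  "0 \<le> s \<Longrightarrow> 0 \<le> t \<Longrightarrow> distr M borel (\<lambda>\<omega>. S (s + t) \<omega> - S s \<omega>) = distr M borel (S t)"
  using sub by (simp add: subordinator_def)

lemma increments_indep:
  "0 \<le> \<tau> 0 \<Longrightarrow> (\<And>i. i < k \<Longrightarrow> \<tau> i \<le> \<tau> (Suc i)) \<Longrightarrow>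
    indep_vars (\<lambda>_. borel) (\<lambda>i \<omega>. S (\<tau> (Suc i)) \<omega> - S (\<tau> i) \<omega>) {..<(k::nat)}"
  using sub by (simp add: subordinator_def)

lemma laplace: "0 \<le> t \<Longrightarrow> 0 \<le> s \<Longrightarrow> expectation (\<lambda>\<omega>. exp (- s * S t \<omega>)) = exp (- t * psi \<nu> s)"
  using dl by (simp add: has_drift_levy_measure_def psi_def)

text \<open>Only the Laplace transform of \<open>S h\<close> is given; expanding \<open>exp (- m (1 - z))\<close> with Poisson weights
  reduces \<open>hit_prob\<close> to it.\<close>

definition hit_prob :: "real \<Rightarrow> real \<Rightarrow> real" where
  "hit_prob h m = 1 - expectation (\<lambda>\<omega>. exp (- m * (1 - exp (- S h \<omega>))))"

lemma hit_prob_sums: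
  assumes h: "0 \<le> h" and m: "0 \<le> m"
  shows "(\<lambda>k. exp (- m) * m ^ k / fact k * (1 - exp (- h * psi \<nu> (real k)))) sums hit_prob h m"
proof -
  define c where "c k = exp (- m) * m ^ k / fact k" for k
  have c: "0 \<le> c k" for k using m by (simp add: c_def)
  have [measurable]: "S h \<in> borel_measurable M" using h by measurable
  define f where "f k \<omega> = c k * exp (- real k * S h \<omega>)" for k \<omega>
  have e1: "exp (- real k * S h \<omega>) \<le> 1" if "\<omega> \<in> space M" for k \<omega>
    using S_nonneg[OF that h] by simp
  have inte: "integrable M (\<lambda>\<omega>. exp (- real k * S h \<omega>))" for k
    by (rule integrable_const_bound[where B=1]) (auto intro!: AE_I2 e1[simplified])
  have int: "integrable M (f k)" for k
    unfolding f_def by (intro integrable_mult_right inte)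
  have If: "(LINT x|M. f k x) = c k * exp (- h * psi \<nu> (real k))" for k
    unfolding f_def using laplace[OF h, of "real k"] by simp
  have nn: "norm (f k x) = f k x" for k x using c[of k] by (auto simp: f_def)
  have sums: "(\<lambda>k. f k x) sums exp (- m * (1 - exp (- S h x)))" for x
    using poisson_gf_sums[of m "exp (- S h x)"] by (simp add: f_def c_def exp_of_nat_mult[symmetric])
  have sc: "c sums 1" using poisson_gf_sums[of m 1] by (simp add: c_def[abs_def])
  have psi0: "0 \<le> h * psi \<nu> (real k)" for k using h psi_nonneg[of "real k"] by simp
  have "(\<lambda>k. LINT x|M. f k x) sums (LINT x|M. (\<Sum>k. f k x))"
  proof (rule sums_integral)
    show "AE x in M. summable (\<lambda>k. norm (f k x))" unfolding nn using sums by (auto simp: sums_iff)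
    show "summable (\<lambda>k. LINT x|M. norm (f k x))"
    proof (rule summable_comparison_test_ev)
      show "summable c" using sc by (simp add: sums_iff)
      show "\<forall>\<^sub>F k in sequentially. norm (LINT x|M. norm (f k x)) \<le> c k"
        unfolding nn If using c psi0 by (intro always_eventually allI) (simp add: mult_left_le)
    qed
  qed (rule int)
  moreover have "(\<Sum>k. f k x) = exp (- m * (1 - exp (- S h x)))" for x
    using sums[of x] by (rule sums_unique[symmetric])
  ultimately have "(\<lambda>k. c k * exp (- h * psi \<nu> (real k))) sums expectation (\<lambda>x. exp (- m * (1 - exp (- S h x))))"
    by (simp add: If)
  from sums_diff[OF sc this] show ?thesis
    by (simp add: hit_prob_def c_def right_diff_distrib)
qed

lemma hit_prob_le: assumes h: "0 \<le> h" and m: "0 \<le> m" shows "hit_prob h m \<le> h * Phi \<nu> m"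
proof (rule sums_le[OF _ hit_prob_sums[OF h m] sums_mult[OF Phi_poisson_sums[OF m]]])
  fix k
  have "1 - exp (- (h * psi \<nu> (real k))) \<le> h * psi \<nu> (real k)" by (rule one_minus_exp_le)
  then have "exp (- m) * m ^ k / fact k * (1 - exp (- h * psi \<nu> (real k))) \<le> exp (- m) * m ^ k / fact k * (h * psi \<nu> (real k))"
    using m by (intro mult_left_mono) auto
  then show "exp (- m) * m ^ k / fact k * (1 - exp (- h * psi \<nu> (real k)))
      \<le> h * (exp (- m) * m ^ k / fact k * psi \<nu> (real k))" by (simp add: mult_ac)
qed

text \<open>The termwise comparison behind \<open>hit_prob_le\<close>, taken to second order. The
  squares of \<open>psi\<close> are bounded by multiples of \<open>4 ^ k\<close>, and the Poisson
  generating function at 4 is \<open>exp (3 * m)\<close>. The error is quadratic in \<open>h\<close>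
  per cell, so its sum over a mesh of a fixed interval vanishes with the mesh.\<close>

lemma hit_prob_ge:
  assumes h: "0 \<le> h" and m: "0 \<le> m"
  shows "h * Phi \<nu> m - h\<^sup>2 * (psi \<nu> 1)\<^sup>2 * exp (3 * m) \<le> hit_prob h m"
proof -
  define c where "c k = exp (- m) * m ^ k / fact k" for k
  have c: "0 \<le> c k" for k using m by (simp add: c_def)
  have p0: "0 \<le> psi \<nu> (real k)" for k by (rule psi_nonneg) simp
  have "(\<lambda>k. h * (c k * psi \<nu> (real k)) - h\<^sup>2 * (psi \<nu> 1)\<^sup>2 * (c k * 4 ^ k)) sums
      (h * Phi \<nu> m - h\<^sup>2 * (psi \<nu> 1)\<^sup>2 * exp (- (m * (1 - 4))))"
    unfolding c_def by (intro sums_diff sums_mult Phi_poisson_sums poisson_gf_sums m)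
  moreover have "h * (c k * psi \<nu> (real k)) - h\<^sup>2 * (psi \<nu> 1)\<^sup>2 * (c k * 4 ^ k)
      \<le> c k * (1 - exp (- h * psi \<nu> (real k)))" for k
  proof -
    have "(psi \<nu> (real k))\<^sup>2 \<le> (real k * psi \<nu> 1)\<^sup>2" using psi_le p0 by (intro power_mono)
    also have "\<dots> = (real k)\<^sup>2 * (psi \<nu> 1)\<^sup>2" by (simp add: power_mult_distrib)
    also have "\<dots> \<le> (2 ^ k)\<^sup>2 * (psi \<nu> 1)\<^sup>2" using of_nat_le_two_power by (intro mult_right_mono power_mono) auto
    also have "(2 ^ k)\<^sup>2 = (4::real) ^ k" by (simp add: power_mult[symmetric] power2_eq_square power_mult_distrib[symmetric])
    finally have "(psi \<nu> (real k))\<^sup>2 \<le> (psi \<nu> 1)\<^sup>2 * 4 ^ k" by (simp add: mult.commute)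
    then have "h\<^sup>2 * (psi \<nu> (real k))\<^sup>2 \<le> h\<^sup>2 * ((psi \<nu> 1)\<^sup>2 * 4 ^ k)" by (intro mult_left_mono) auto
    moreover have "h * psi \<nu> (real k) - (h * psi \<nu> (real k))\<^sup>2 / 2 \<le> 1 - exp (- (h * psi \<nu> (real k)))"
      using h p0 by (intro one_minus_exp_ge) simp
    moreover have "0 \<le> h\<^sup>2 * (psi \<nu> (real k))\<^sup>2" by (rule mult_nonneg_nonneg; rule zero_le_power2)
    ultimately have "h * psi \<nu> (real k) - h\<^sup>2 * ((psi \<nu> 1)\<^sup>2 * 4 ^ k) \<le> 1 - exp (- h * psi \<nu> (real k))"
      unfolding power_mult_distrib minus_mult_left[symmetric] by linarith
    then have "c k * (h * psi \<nu> (real k) - h\<^sup>2 * ((psi \<nu> 1)\<^sup>2 * 4 ^ k)) \<le> c k * (1 - exp (- h * psi \<nu> (real k)))"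
      using c by (intro mult_left_mono)
    then show ?thesis by (simp add: algebra_simps)
  qed
  ultimately have "h * Phi \<nu> m - h\<^sup>2 * (psi \<nu> 1)\<^sup>2 * exp (- (m * (1 - 4))) \<le> hit_prob h m"
    by (intro sums_le[OF _ _ hit_prob_sums[OF h m], folded c_def])
  then show ?thesis by (simp add: mult.commute)
qed

lemma hit_prob_nonneg: assumes h: "0 \<le> h" and m: "0 \<le> m" shows "0 \<le> hit_prob h m"
proof -
  have "0 \<le> exp (- m) * m ^ k / fact k * (1 - exp (- h * psi \<nu> (real k)))" for k
    using h m psi_nonneg[of "real k"] by simp
  from sums_le[OF this sums_zero hit_prob_sums[OF h m]] show ?thesis .
qed

end

section \<open>A maximal inequality\<close>

text \<open>The differences are stopped when the partial sums leave \<open>(-\<eta>, \<eta>)\<close>; the stopped sums are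
  still orthogonal and detect the event.\<close>

lemma (in prob_space) kolmogorov_maximal_inequality:
  fixes X :: "nat \<Rightarrow> 'a \<Rightarrow> real" and F :: "nat \<Rightarrow> 'a measure"
  assumes sub: "\<And>j. j < N \<Longrightarrow> subalgebra M (F j)"
    and adapted: "\<And>i j. i < j \<Longrightarrow> j < N \<Longrightarrow> X i \<in> borel_measurable (F j)"
    and meas: "\<And>j. j < N \<Longrightarrow> X j \<in> borel_measurable M"
    and sq: "\<And>j. j < N \<Longrightarrow> integrable M (\<lambda>\<omega>. (X j \<omega>)\<^sup>2)"
    and zero: "\<And>j A. j < N \<Longrightarrow> A \<in> sets (F j) \<Longrightarrow> (LINT \<omega>:A|M. X j \<omega>) = 0"
    and \<eta>: "0 < \<eta>"
  shows "prob {\<omega>\<in>space M. \<exists>k\<le>N. \<eta> \<le> \<bar>\<Sum>i<k. X i \<omega>\<bar>} \<le> (\<Sum>j<N. expectation (\<lambda>\<omega>. (X j \<omega>)\<^sup>2)) / \<eta>\<^sup>2"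
proof -
  \<comment> \<open>\<open>e j\<close> indicates that no partial sum up to index \<open>j\<close>
    has left the band. These sums involve \<open>X i\<close> for \<open>i < j\<close> only, so
    \<open>e j\<close> is known before \<open>X j\<close>.\<close>
  define e where "e j \<omega> = (if \<forall>k\<le>j. \<bar>\<Sum>i<k. X i \<omega>\<bar> < \<eta> then 1 else 0 :: real)" for j \<omega>
  define Z where "Z k \<omega> = (\<Sum>j<k. e j \<omega> * X j \<omega>)" for k \<omega>
  have Z_eq: "e k \<omega> * Z k \<omega> = e k \<omega> * (\<Sum>i<k. X i \<omega>)" for k \<omega>
  proof (cases "e k \<omega> = 0")
    case False
    then have "e j \<omega> = 1" if "j \<le> k" for j using that by (auto simp: e_def split: if_splits)
    then show ?thesis by (simp add: Z_def)
  qed simp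
  \<comment> \<open>Before stopping, \<open>Z\<close> is the unstopped sum and lies within the band.
    This bound makes the cross term \<open>H * X\<close> integrable.\<close>
  have eZ: "\<bar>e k \<omega> * Z k \<omega>\<bar> \<le> \<eta>" for k \<omega>
    unfolding Z_eq using \<eta> by (auto simp: e_def intro: less_imp_le)
  have e01: "0 \<le> e j \<omega>" "e j \<omega> \<le> 1" "e j \<omega> * e j \<omega> = e j \<omega>" for j \<omega> by (auto simp: e_def)
  have sumF: "(\<lambda>\<omega>. \<Sum>i<k. X i \<omega>) \<in> borel_measurable (F j)" if "k \<le> j" "j < N" for k j
    using that adapted by (intro borel_measurable_sum) auto
  have eF: "e j \<in> borel_measurable (F j)" if j: "j < N" for j
  proof -
    have "{\<omega> \<in> space (F j). \<forall>k\<in>{..j}. \<bar>\<Sum>i<k. X i \<omega>\<bar> < \<eta>} \<in> sets (F j)"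
    proof (intro sets.sets_Collect_finite_All finite_atMost)
      fix k assume "k \<in> {..j}"
      then have m: "(\<lambda>\<omega>. \<Sum>i<k. X i \<omega>) \<in> borel_measurable (F j)" by (intro sumF j) simp
      show "{\<omega> \<in> space (F j). \<bar>\<Sum>i<k. X i \<omega>\<bar> < \<eta>} \<in> sets (F j)"
        by (rule borel_measurable_less[OF borel_measurable_abs[OF m] borel_measurable_const])
    qed
    then have "{\<omega> \<in> space (F j). \<forall>k\<le>j. \<bar>\<Sum>i<k. X i \<omega>\<bar> < \<eta>} \<in> sets (F j)"
      by (simp only: Ball_def atMost_iff)
    from measurable_If[OF borel_measurable_const borel_measurable_const this] show ?thesis unfolding e_def .
  qed
  have eM: "e j \<in> borel_measurable M" if "j < N" for j
    using measurable_from_subalg[OF sub eF] that by blast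
  have ZM: "Z k \<in> borel_measurable M" if "k \<le> N" for k
    unfolding Z_def[abs_def] using that by (intro borel_measurable_sum borel_measurable_times eM meas) auto
  have ind: "integrable M (\<lambda>\<omega>. (Z k \<omega>)\<^sup>2) \<and> expectation (\<lambda>\<omega>. (Z k \<omega>)\<^sup>2) \<le> (\<Sum>j<k. expectation (\<lambda>\<omega>. (X j \<omega>)\<^sup>2))"
    if "k \<le> N" for k
    using that
  proof (induction k)
    case (Suc k)
    then have k: "k < N" and IH: "integrable M (\<lambda>\<omega>. (Z k \<omega>)\<^sup>2)"
      "expectation (\<lambda>\<omega>. (Z k \<omega>)\<^sup>2) \<le> (\<Sum>j<k. expectation (\<lambda>\<omega>. (X j \<omega>)\<^sup>2))" by auto
    interpret Fk: finite_measure_subalgebra M "F k" by unfold_locales (rule sub[OF k])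
    have [measurable]: "Z k \<in> borel_measurable M" "e k \<in> borel_measurable M" "X k \<in> borel_measurable M"
      using ZM eM meas k by auto
    have intX: "integrable M (X k)" by (rule square_integrable_imp_integrable[OF _ sq[OF k]]) simp
    define H where "H \<omega> = e k \<omega> * Z k \<omega>" for \<omega>
    have H_F: "H \<in> borel_measurable (F k)"
      unfolding H_def[abs_def] Z_eq by (intro borel_measurable_times eF[OF k] sumF k) simp
    have [measurable]: "H \<in> borel_measurable M" unfolding H_def[abs_def] by measurable
    have iHX: "integrable M (\<lambda>\<omega>. H \<omega> * X k \<omega>)"
    proof (rule Bochner_Integration.integrable_bound)
      show "integrable M (\<lambda>\<omega>. \<eta> * X k \<omega>)" using intX by simp
      show "AE \<omega> in M. norm (H \<omega> * X k \<omega>) \<le> norm (\<eta> * X k \<omega>)"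
        using eZ \<eta> by (intro AE_I2) (auto simp: abs_mult H_def intro!: mult_right_mono)
    qed measurable
    \<comment> \<open>The hypothesis \<open>zero\<close> says that the constant 0 has the defining
      property of the conditional expectation of \<open>X k\<close> given
      \<open>F k\<close>.\<close>
    have "AE \<omega> in M. real_cond_exp M (F k) (X k) \<omega> = 0"
      by (rule Fk.real_cond_exp_charact) (auto simp: zero[OF k] intX)
    then have "(\<integral>\<omega>. H \<omega> * real_cond_exp M (F k) (X k) \<omega> \<partial>M) = (\<integral>\<omega>. 0 \<partial>M)"
      by (intro integral_cong_AE) auto
    then have orth: "(\<integral>\<omega>. H \<omega> * X k \<omega> \<partial>M) = 0"
      using Fk.real_cond_exp_intg(2)[OF iHX H_F] by simp
    have ieX: "integrable M (\<lambda>\<omega>. e k \<omega> * (X k \<omega>)\<^sup>2)"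
      by (rule Bochner_Integration.integrable_bound[OF sq[OF k]])
        (use e01 in \<open>auto intro!: AE_I2 simp: mult_left_le_one_le\<close>)
    have eq: "(Z (Suc k) \<omega>)\<^sup>2 = (Z k \<omega>)\<^sup>2 + 2 * (H \<omega> * X k \<omega>) + e k \<omega> * (X k \<omega>)\<^sup>2" for \<omega>
    proof -
      have "(e k \<omega> * X k \<omega>)\<^sup>2 = e k \<omega> * (X k \<omega>)\<^sup>2"
        unfolding power_mult_distrib by (simp add: power2_eq_square e01)
      then show ?thesis by (simp add: Z_def H_def power2_sum)
    qed
    have "expectation (\<lambda>\<omega>. e k \<omega> * (X k \<omega>)\<^sup>2) \<le> expectation (\<lambda>\<omega>. (X k \<omega>)\<^sup>2)"
      using e01 by (intro integral_mono ieX sq[OF k]) (simp add: mult_left_le_one_le)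
    then show ?case unfolding eq using IH iHX ieX orth by simp
  qed (simp add: Z_def)
  \<comment> \<open>From the first exit index \<open>l\<close> on, \<open>e\<close> vanishes, so the
    stopped sum keeps its value at \<open>l\<close> up to index \<open>N\<close>.\<close>
  have incl: "\<eta> \<le> \<bar>Z N \<omega>\<bar>" if "k \<le> N" "\<eta> \<le> \<bar>\<Sum>i<k. X i \<omega>\<bar>" for k \<omega>
  proof -
    define l where "l = (LEAST k. \<eta> \<le> \<bar>\<Sum>i<k. X i \<omega>\<bar>)"
    have l: "\<eta> \<le> \<bar>\<Sum>i<l. X i \<omega>\<bar>" unfolding l_def by (rule LeastI[of _ k]) (rule that(2))
    have "l \<le> k" unfolding l_def by (rule Least_le) (rule that(2))
    then have lN: "l \<le> N" using that(1) by simp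
    have e: "e j \<omega> = (if j < l then 1 else 0)" for j
    proof (cases "j < l")
      case True
      then have "\<bar>\<Sum>i<k. X i \<omega>\<bar> < \<eta>" if "k \<le> j" for k
        using not_less_Least[of k "\<lambda>k. \<eta> \<le> \<bar>\<Sum>i<k. X i \<omega>\<bar>"] that by (simp add: l_def)
      then show ?thesis using True by (auto simp: e_def)
    next
      case False
      then show ?thesis using l by (auto simp: e_def not_less intro!: exI[of _ l])
    qed
    have "Z N \<omega> = (\<Sum>j<N. if j \<in> {..<l} then X j \<omega> else 0)"
      unfolding Z_def by (intro sum.cong) (auto simp: e)
    also have "\<dots> = (\<Sum>i<l. X i \<omega>)" using lN
      by (subst sum.inter_restrict[symmetric]) (auto intro!: sum.cong)
    finally show ?thesis using l by simp
  qed
  have "prob {\<omega>\<in>space M. \<exists>k\<le>N. \<eta> \<le> \<bar>\<Sum>i<k. X i \<omega>\<bar>} \<le> prob {\<omega>\<in>space M. \<eta> \<le> \<bar>Z N \<omega>\<bar>}"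
    using incl ZM[of N] by (intro finite_measure_mono) auto
  also have "\<dots> \<le> expectation (\<lambda>\<omega>. (Z N \<omega>)\<^sup>2) / \<eta>\<^sup>2"
    using ind[of N] ZM[of N] \<eta> by (intro second_moment_method) auto
  also have "\<dots> \<le> (\<Sum>j<N. expectation (\<lambda>\<omega>. (X j \<omega>)\<^sup>2)) / \<eta>\<^sup>2"
    using ind[of N] by (intro divide_right_mono) auto
  finally show ?thesis .
qed

text \<open>\<open>X j\<close> may depend on all earlier innovations, but as \<open>Z j\<close> is
  independent of them the past can be frozen. The martingale property then reduces to
  \<open>centred\<close>, an unconditional expectation for each fixed past.\<close>

lemma (in prob_space) maximal_inequality_innovations:
  fixes X Z :: "nat \<Rightarrow> 'a \<Rightarrow> real" and \<phi> :: "nat \<Rightarrow> (nat \<Rightarrow> real) \<Rightarrow> real \<Rightarrow> real"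
  assumes indep: "indep_vars (\<lambda>_. borel) Z {..<N}"
    and \<phi>_meas: "\<And>j. j < N \<Longrightarrow> (\<lambda>(z, x). \<phi> j z x) \<in> borel_measurable ((\<Pi>\<^sub>M i\<in>{..<j}. borel) \<Otimes>\<^sub>M borel)"
    and X: "\<And>j \<omega>. j < N \<Longrightarrow> \<omega> \<in> space M \<Longrightarrow> X j \<omega> = \<phi> j (\<lambda>i\<in>{..<j}. Z i \<omega>) (Z j \<omega>)"
    and sq: "\<And>j. j < N \<Longrightarrow> integrable M (\<lambda>\<omega>. (X j \<omega>)\<^sup>2)"
    and centred: "\<And>j \<omega>'. j < N \<Longrightarrow> \<omega>' \<in> space M \<Longrightarrow>
      expectation (\<lambda>\<omega>. \<phi> j (\<lambda>i\<in>{..<j}. Z i \<omega>') (Z j \<omega>)) = 0"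
    and \<eta>: "0 < \<eta>"
  shows "prob {\<omega>\<in>space M. \<exists>k\<le>N. \<eta> \<le> \<bar>\<Sum>i<k. X i \<omega>\<bar>} \<le> (\<Sum>j<N. expectation (\<lambda>\<omega>. (X j \<omega>)\<^sup>2)) / \<eta>\<^sup>2"
proof -
  have ZM: "Z i \<in> borel_measurable M" if "i < N" for i
    using indep that by (auto simp: indep_vars_def)
  define T where "T j \<omega> = (\<lambda>i\<in>{..<j}. Z i \<omega>)" for j \<omega>
  define PM where "PM j = (\<Pi>\<^sub>M i\<in>{..<(j::nat)}. (borel :: real measure))" for j
  define F where "F j = vimage_algebra (space M) (T j) (PM j)" for j
  have T_space: "T j \<in> space M \<rightarrow> space (PM j)" for j by (auto simp: T_def PM_def space_PiM)
  have T_meas: "T j \<in> measurable M (PM j)" if "j \<le> N" for j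
    unfolding T_def PM_def using that by (intro measurable_restrict ZM) auto
  have T_F: "T j \<in> measurable (F j) (PM j)" for j
    unfolding F_def by (rule measurable_vimage_algebra1[OF T_space])
  have setsF: "sets (F j) = {T j -` B \<inter> space M | B. B \<in> sets (PM j)}" for j
    unfolding F_def by (rule sets_vimage_algebra2[OF T_space])
  have sp: "space (F j) = space M" for j by (simp add: F_def)
  have sub: "subalgebra M (F j)" if "j < N" for j
    unfolding subalgebra_def sp setsF using T_meas[of j] that by (auto intro: measurable_sets)
  \<comment> \<open>Stated for an arbitrary \<open>N'\<close> on the same space because it is used
    both for \<open>M\<close> and for the \<sigma>-algebra \<open>F j\<close> of the past.\<close>
  have X_meas: "X j \<in> borel_measurable N'" if "space N' = space M" "T j \<in> measurable N' (PM j)"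
      "Z j \<in> borel_measurable N'" "j < N" for j and N' :: "'a measure"
  proof -
    have "(\<lambda>\<omega>. (\<lambda>(z, x). \<phi> j z x) (T j \<omega>, Z j \<omega>)) \<in> borel_measurable N'"
      using \<phi>_meas[OF that(4), folded PM_def] that by (intro measurable_compose[OF measurable_Pair]) auto
    then show ?thesis using X[OF that(4)] that(1) by (subst measurable_cong) (auto simp: T_def)
  qed
  have XM: "X j \<in> borel_measurable M" if "j < N" for j
    using that by (intro X_meas T_meas ZM) auto
  show ?thesis
  proof (rule kolmogorov_maximal_inequality[where F = F, OF sub _ XM sq _ \<eta>])
    fix i j assume ij: "i < j" "j < N"
    have Zl: "Z l \<in> borel_measurable (F j)" if "l < j" for l
    proof -
      have "(\<lambda>\<omega>. T j \<omega> l) \<in> borel_measurable (F j)"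
        by (rule measurable_compose[OF T_F]) (use that in \<open>simp add: PM_def\<close>)
      then show ?thesis using that by (simp add: T_def)
    qed
    have "T i \<in> measurable (F j) (PM i)"
      unfolding T_def PM_def using ij by (intro measurable_restrict Zl) auto
    then show "X i \<in> borel_measurable (F j)" using ij by (intro X_meas sp Zl) auto
  next
    fix j A assume j: "j < N" and "A \<in> sets (F j)"
    then obtain B where B [measurable]: "B \<in> sets (PM j)" and A: "A = T j -` B \<inter> space M"
      unfolding setsF by blast
    note [measurable] = T_meas[of j] ZM[OF j] \<phi>_meas[OF j, folded PM_def]
    have Tj [measurable]: "T j \<in> measurable M (PM j)" using j by (intro T_meas) auto
    \<comment> \<open>\<open>indep_var_restrict\<close> speaks of families, so the single variable
      \<open>Z j\<close> enters as a function on the index set \<open>{j}\<close>.\<close>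
    define PS where "PS = (\<Pi>\<^sub>M i\<in>{j}. (borel :: real measure))"
    define W where "W \<omega> = (\<lambda>i\<in>{j}. Z i \<omega>)" for \<omega>
    have [measurable]: "W \<in> measurable M PS" unfolding W_def[abs_def] PS_def using ZM[OF j] by (intro measurable_restrict) simp
    have [measurable]: "(\<lambda>x. x j) \<in> borel_measurable PS" by (simp add: PS_def)
    have Wj: "W \<omega> j = Z j \<omega>" for \<omega> by (simp add: W_def)
    have "indep_var (PM j) (\<lambda>\<omega>. restrict (\<lambda>i. Z i \<omega>) {..<j}) (\<Pi>\<^sub>M i\<in>{j}. borel) (\<lambda>\<omega>. restrict (\<lambda>i. Z i \<omega>) {j})"
      unfolding PM_def using j by (intro indep_var_restrict[OF indep]) auto
    then have iv: "indep_var (PM j) (T j) PS W" by (simp add: T_def[abs_def] W_def[abs_def] PS_def)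
    \<comment> \<open>An event of the past is the preimage of some \<open>B\<close> under
      \<open>T j\<close>; the integral over it is thus the integral of \<open>f\<close> under a
      product law.\<close>
    define f where "f = (\<lambda>(z, x). indicat_real B z * \<phi> j z (x j))"
    have [measurable]: "f \<in> borel_measurable (PM j \<Otimes>\<^sub>M PS)"
    proof -
      have "(\<lambda>p. indicat_real B (fst p) * (\<lambda>(z, x). \<phi> j z x) (fst p, snd p j)) \<in> borel_measurable (PM j \<Otimes>\<^sub>M PS)"
        by measurable
      then show ?thesis by (simp add: f_def case_prod_beta')
    qed
    have fX: "f (T j \<omega>, W \<omega>) = indicat_real A \<omega> * X j \<omega>" if "\<omega> \<in> space M" for \<omega>
      using that X[OF j that] by (auto simp: f_def A T_def indicator_def Wj)
    have Aset [measurable]: "A \<in> sets M" unfolding A by measurable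
    have intX: "integrable M (X j)" by (rule square_integrable_imp_integrable[OF XM[OF j] sq[OF j]])
    have "integrable M (\<lambda>\<omega>. indicat_real A \<omega> *\<^sub>R X j \<omega>)" by (rule integrable_mult_indicator[OF Aset intX])
    then have if1: "integrable M (\<lambda>\<omega>. f (T j \<omega>, W \<omega>))"
      by (subst Bochner_Integration.integrable_cong[OF refl fX]) auto
    interpret D1: prob_space "distr M (PM j) (T j)" by (rule prob_space_distr) measurable
    interpret D2: prob_space "distr M PS W" by (rule prob_space_distr) measurable
    interpret D: pair_prob_space "distr M (PM j) (T j)" "distr M PS W" ..
    have eq: "distr M (PM j) (T j) \<Otimes>\<^sub>M distr M PS W = distr M (PM j \<Otimes>\<^sub>M PS) (\<lambda>x. (T j x, W x))"
      using iv unfolding indep_var_distribution_eq by simp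
    have if2: "integrable (distr M (PM j) (T j) \<Otimes>\<^sub>M distr M PS W) f"
      unfolding eq using if1 by (subst integrable_distr_eq) auto
    have "(LINT \<omega>:A|M. X j \<omega>) = (LINT \<omega>|M. f (T j \<omega>, W \<omega>))"
      unfolding set_lebesgue_integral_def using fX by (intro Bochner_Integration.integral_cong) auto
    also have "\<dots> = integral\<^sup>L (distr M (PM j) (T j) \<Otimes>\<^sub>M distr M PS W) f"
      unfolding eq by (subst integral_distr) auto
    also have "\<dots> = (LINT z|distr M (PM j) (T j). LINT x|distr M PS W. f (z, x))"
      by (rule D.integral_fst'[OF if2, symmetric])
    also have "\<dots> = (LINT \<omega>'|M. LINT x|distr M PS W. f (T j \<omega>', x))"
      by (subst integral_distr) auto
    also have "\<dots> = (LINT \<omega>'|M. 0)"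
    proof (rule Bochner_Integration.integral_cong[OF refl])
      fix \<omega>' assume \<omega>': "\<omega>' \<in> space M"
      then have Ts: "T j \<omega>' \<in> space (PM j)" using T_space by auto
      have [measurable]: "(\<lambda>x. f (T j \<omega>', x)) \<in> borel_measurable PS"
        using Ts by measurable
      have "(LINT x|distr M PS W. f (T j \<omega>', x)) = (LINT \<omega>|M. f (T j \<omega>', W \<omega>))"
        by (subst integral_distr) auto
      also have "\<dots> = indicat_real B (T j \<omega>') * expectation (\<lambda>\<omega>. \<phi> j (\<lambda>i\<in>{..<j}. Z i \<omega>') (Z j \<omega>))"
        by (simp add: f_def T_def Wj)
      also have "\<dots> = 0" using centred[OF j \<omega>'] by simp
      finally show "(LINT x|distr M PS W. f (T j \<omega>', x)) = 0" .
    qed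
    finally show "(LINT \<omega>:A|M. X j \<omega>) = 0" by simp
  qed
qed

section \<open>Sieving the subordinator\<close>

lemma emeasure_exp_intensity_Ioc:
  assumes n: "0 < n" and ab: "0 \<le> a" "a \<le> b"
  shows "emeasure (exp_intensity n) {a<..b} = ennreal (n * (exp (- a) - exp (- b)))"
proof -
  have "emeasure (exp_intensity n) {a<..b}
      = (\<integral>\<^sup>+x. ennreal (n * exp (- x)) * indicator {0<..} x * indicator {a<..b} x \<partial>lborel)"
    unfolding exp_intensity_def by (subst emeasure_density) auto
  also have "\<dots> = (\<integral>\<^sup>+x. ennreal (n * exp (- x)) * indicator {a..b} x \<partial>lborel)"
  proof (rule nn_integral_cong_AE)
    show "AE x in lborel. ennreal (n * exp (- x)) * indicator {0<..} x * indicator {a<..b} x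
        = ennreal (n * exp (- x)) * indicator {a..b} x"
      using AE_lborel_singleton[of a] by eventually_elim (use ab in \<open>auto simp: indicator_def\<close>)
  qed
  also have "\<dots> = ennreal (- n * exp (- b) - (- n * exp (- a)))"
    by (rule nn_integral_FTC_Icc) (use n ab in \<open>auto intro!: derivative_eq_intros\<close>)
  finally show ?thesis by (simp add: algebra_simps)
qed

lemma emeasure_exp_intensity_tail:
  assumes n: "0 < n" and a: "0 \<le> a"
  shows "emeasure (exp_intensity n) {a<..} = ennreal (n * exp (- a))"
proof -
  have "emeasure (exp_intensity n) {a<..}
      = (\<integral>\<^sup>+x. ennreal (n * exp (- x)) * indicator {0<..} x * indicator {a<..} x \<partial>lborel)"
    unfolding exp_intensity_def by (subst emeasure_density) auto
  also have "\<dots> = (\<integral>\<^sup>+x. ennreal (n * exp (- x)) * indicator {a..} x \<partial>lborel)"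
  proof (rule nn_integral_cong_AE)
    show "AE x in lborel. ennreal (n * exp (- x)) * indicator {0<..} x * indicator {a<..} x
        = ennreal (n * exp (- x)) * indicator {a..} x"
      using AE_lborel_singleton[of a] by eventually_elim (use a in \<open>auto simp: indicator_def\<close>)
  qed
  also have "\<dots> = ennreal (0 - (- n * exp (- a)))"
  proof (rule nn_integral_FTC_atLeast)
    have "((\<lambda>x. - n * exp (- x)) \<longlongrightarrow> - n * 0) at_top"
      by (intro tendsto_mult tendsto_const filterlim_compose[OF exp_at_bot filterlim_uminus_at_bot_at_top])
    then show "((\<lambda>x. - n * exp (- x)) \<longlongrightarrow> 0) at_top" by simp
  qed (use n in \<open>auto intro!: derivative_eq_intros\<close>)
  finally show ?thesis by simp
qed

lemma sets_exp_intensity [simp]: "sets (exp_intensity n) = sets borel"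
  by (simp add: exp_intensity_def)

locale sieved_subordinator = zero_drift_subordinator M S \<nu>
  for M :: "'a measure" and S :: "real \<Rightarrow> 'a \<Rightarrow> real" and \<nu> :: "real measure" +
  fixes \<xi> :: "'a \<Rightarrow> real set" and n :: real
  assumes n_pos: "0 < n"
    and \<xi>_pos: "\<And>\<omega>. \<omega> \<in> space M \<Longrightarrow> \<xi> \<omega> \<subseteq> {0<..}"
    and ppp: "poisson_point_process M \<xi> (exp_intensity n)"
    and indep: "indep_of_process M \<xi> S"
begin

text \<open>\<open>M1\<close> and \<open>M2\<close> carry the \<open>\<sigma>\<close>-algebras of the point process and of \<open>S\<close>. As these are independent,
  a joint event may be evaluated at two independent outcomes.\<close>

definition M1 :: "'a measure" where
  "M1 = vimage_algebra (space M) (\<lambda>\<omega>. \<lambda>A\<in>sets borel. card (\<xi> \<omega> \<inter> A)) (\<Pi>\<^sub>M A\<in>sets borel. count_space UNIV)"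

definition M2 :: "'a measure" where
  "M2 = vimage_algebra (space M) (\<lambda>\<omega>. \<lambda>t\<in>{0..}. S t \<omega>) (\<Pi>\<^sub>M t\<in>{0..}. borel)"

lemma space_M1 [simp]: "space M1 = space M" and space_M2 [simp]: "space M2 = space M"
  by (simp_all add: M1_def M2_def)

lemma \<xi>_finite: "\<omega> \<in> space M \<Longrightarrow> finite (\<xi> \<omega>)"
  using ppp by (simp add: poisson_point_process_def)

lemma card_M1: "A \<in> sets borel \<Longrightarrow> (\<lambda>\<omega>. card (\<xi> \<omega> \<inter> A)) \<in> measurable M1 (count_space UNIV)"
proof -
  assume A: "A \<in> sets borel"
  have "(\<lambda>\<omega>. \<lambda>A\<in>sets borel. card (\<xi> \<omega> \<inter> A)) \<in> measurable M1 (\<Pi>\<^sub>M A\<in>sets borel. count_space UNIV)"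
    unfolding M1_def by (rule measurable_vimage_algebra1) (auto simp: space_PiM)
  from measurable_compose[OF this measurable_component_singleton[OF A]] A show ?thesis by simp
qed

lemma S_M2: "0 \<le> t \<Longrightarrow> S t \<in> borel_measurable M2"
proof -
  assume t: "0 \<le> t"
  have "(\<lambda>\<omega>. \<lambda>t\<in>{0..}. S t \<omega>) \<in> measurable M2 (\<Pi>\<^sub>M t\<in>{0..}. borel)"
    unfolding M2_def by (rule measurable_vimage_algebra1) (auto simp: space_PiM)
  from measurable_compose[OF this measurable_component_singleton[of t]] t show ?thesis by simp
qed

lemma ident_M1: "(\<lambda>\<omega>. \<omega>) \<in> measurable M M1"
  unfolding M1_def
  by (rule measurable_vimage_algebra2)
    (use ppp in \<open>auto simp: poisson_point_process_def intro!: measurable_restrict\<close>)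

lemma ident_M2: "(\<lambda>\<omega>. \<omega>) \<in> measurable M M2"
  unfolding M2_def
  by (rule measurable_vimage_algebra2) (auto intro!: measurable_restrict)

lemma diagonal_measurable: "(\<lambda>\<omega>. (\<omega>, \<omega>)) \<in> measurable M (M1 \<Otimes>\<^sub>M M2)"
  by (intro measurable_Pair ident_M1 ident_M2)

lemma fubini_diagonal:
  assumes Q: "Q \<in> sets (M1 \<Otimes>\<^sub>M M2)"
  shows "emeasure M {\<omega>\<in>space M. (\<omega>, \<omega>) \<in> Q} = (\<integral>\<^sup>+\<omega>2. emeasure M {\<omega>1\<in>space M. (\<omega>1, \<omega>2) \<in> Q} \<partial>M)"
proof -
  \<comment> \<open>Preimages under the identity give back the same sets; this matches
    \<open>indep_of_process\<close> with the independence of two random variables.\<close>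
  have vim: "{A \<inter> space M | A. A \<in> sets N} = sets N" if "space N = space M" for N :: "'a measure"
  proof -
    have "A \<inter> space M = A" if "A \<in> sets N" for A using sets.sets_into_space[OF that] \<open>space N = space M\<close> by auto
    then show ?thesis by auto
  qed
  have "indep_var M1 (\<lambda>\<omega>. \<omega>) M2 (\<lambda>\<omega>. \<omega>)"
    unfolding indep_var_eq
    using indep ident_M1 ident_M2
    by (simp add: vim sets.sigma_sets_eq[of M1, simplified] sets.sigma_sets_eq[of M2, simplified]
      indep_of_process_def M1_def[symmetric] M2_def[symmetric])
  then have eq: "distr M M1 (\<lambda>\<omega>. \<omega>) \<Otimes>\<^sub>M distr M M2 (\<lambda>\<omega>. \<omega>) = distr M (M1 \<Otimes>\<^sub>M M2) (\<lambda>\<omega>. (\<omega>, \<omega>))"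
    unfolding indep_var_distribution_eq by simp
  interpret D1: prob_space "distr M M1 (\<lambda>\<omega>. \<omega>)" by (rule prob_space_distr[OF ident_M1])
  interpret D2: prob_space "distr M M2 (\<lambda>\<omega>. \<omega>)" by (rule prob_space_distr[OF ident_M2])
  interpret D: pair_prob_space "distr M M1 (\<lambda>\<omega>. \<omega>)" "distr M M2 (\<lambda>\<omega>. \<omega>)" ..
  have Q': "Q \<in> sets (distr M M1 (\<lambda>\<omega>. \<omega>) \<Otimes>\<^sub>M distr M M2 (\<lambda>\<omega>. \<omega>))" using Q by (simp cong: sets_pair_measure_cong)
  have sect: "emeasure (distr M M1 (\<lambda>\<omega>. \<omega>)) ((\<lambda>x. (x, y)) -` Q) = emeasure M {\<omega>1\<in>space M. (\<omega>1, y) \<in> Q}" for y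
    by (subst emeasure_distr[OF ident_M1 sets_Pair2[OF Q]]) (auto intro!: arg_cong[where f="emeasure M"])
  have "emeasure M {\<omega>\<in>space M. (\<omega>, \<omega>) \<in> Q} = emeasure (distr M (M1 \<Otimes>\<^sub>M M2) (\<lambda>\<omega>. (\<omega>, \<omega>))) Q"
    by (subst emeasure_distr[OF diagonal_measurable Q]) (auto intro!: arg_cong[where f="emeasure M"])
  also have "\<dots> = emeasure (distr M M1 (\<lambda>\<omega>. \<omega>) \<Otimes>\<^sub>M distr M M2 (\<lambda>\<omega>. \<omega>)) Q" by (simp only: eq)
  also have "\<dots> = (\<integral>\<^sup>+y. emeasure (distr M M1 (\<lambda>\<omega>. \<omega>)) ((\<lambda>x. (x, y)) -` Q) \<partial>distr M M2 (\<lambda>\<omega>. \<omega>))"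
    by (rule D.emeasure_pair_measure_alt2[OF Q'])
  also have "\<dots> = (\<integral>\<^sup>+y. emeasure (distr M M1 (\<lambda>\<omega>. \<omega>)) ((\<lambda>x. (x, y)) -` Q) \<partial>M)"
    by (rule nn_integral_distr[OF ident_M2])
      (use D.measurable_emeasure_Pair2[OF Q'] in \<open>simp cong: measurable_cong_sets\<close>)
  finally show ?thesis by (simp add: sect)
qed

text \<open>A bound on the conditional probability given the path of \<open>S\<close> integrates to
  an unconditional one. Below, \<open>b\<close> comes from a conditional variance or from a union
  bound.\<close>

lemma fubini_diagonal_le:
  assumes Q: "Q \<in> sets (M1 \<Otimes>\<^sub>M M2)"
    and b: "integrable M b"
    and le: "\<And>\<omega>2. \<omega>2 \<in> space M \<Longrightarrow> prob {\<omega>1\<in>space M. (\<omega>1, \<omega>2) \<in> Q} \<le> b \<omega>2"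
  shows "prob {\<omega>\<in>space M. (\<omega>, \<omega>) \<in> Q} \<le> expectation b"
proof -
  have b0: "0 \<le> b \<omega>" if "\<omega> \<in> space M" for \<omega> using le[OF that] measure_nonneg order_trans by blast
  have "ennreal (prob {\<omega>\<in>space M. (\<omega>, \<omega>) \<in> Q}) = (\<integral>\<^sup>+\<omega>2. emeasure M {\<omega>1\<in>space M. (\<omega>1, \<omega>2) \<in> Q} \<partial>M)"
    using fubini_diagonal[OF Q] by (simp add: emeasure_eq_measure)
  also have "\<dots> \<le> (\<integral>\<^sup>+\<omega>2. ennreal (b \<omega>2) \<partial>M)"
    by (intro nn_integral_mono) (simp add: emeasure_eq_measure le ennreal_leI)
  also have "\<dots> = ennreal (expectation b)"
    by (rule nn_integral_eq_integral[OF b]) (auto intro!: AE_I2 b0)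
  finally show ?thesis
    by (subst (asm) ennreal_le_iff) (auto intro!: integral_nonneg_AE AE_I2 b0)
qed

text \<open>Half-open intervals make the cells between successive positions of \<open>S\<close>
  disjoint. The jump intervals in \<open>K_count\<close> are open; the discrepancy is what the
  exceptional points below are about.\<close>

definition hits :: "'a \<Rightarrow> real \<Rightarrow> real \<Rightarrow> bool" where
  "hits \<omega> a b \<longleftrightarrow> (\<exists>x\<in>\<xi> \<omega>. a < x \<and> x \<le> b)"

text \<open>Comparing counts on two half-lines separates the endpoints, so that joint measurability
  in the outcome and a random endpoint has to be shown for one endpoint at a time.\<close>

lemma hits_iff:
  assumes "\<omega> \<in> space M"
  shows "hits \<omega> a b \<longleftrightarrow> real (card (\<xi> \<omega> \<inter> {..a})) < real (card (\<xi> \<omega> \<inter> {..b}))"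
proof -
  have fin: "finite (\<xi> \<omega> \<inter> {..c})" for c using \<xi>_finite[OF assms] by simp
  show ?thesis
  proof
    assume "hits \<omega> a b"
    then have "\<xi> \<omega> \<inter> {..a} \<subset> \<xi> \<omega> \<inter> {..b}" by (force simp: hits_def)
    then show "real (card (\<xi> \<omega> \<inter> {..a})) < real (card (\<xi> \<omega> \<inter> {..b}))" using psubset_card_mono[OF fin] by simp
  next
    assume *: "real (card (\<xi> \<omega> \<inter> {..a})) < real (card (\<xi> \<omega> \<inter> {..b}))"
    show "hits \<omega> a b"
    proof (rule ccontr)
      assume "\<not> hits \<omega> a b"
      then have "\<xi> \<omega> \<inter> {..b} \<subseteq> \<xi> \<omega> \<inter> {..a}" by (auto simp: hits_def not_less)
      then show False using card_mono[OF fin] * by (metis not_less of_nat_less_iff)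
    qed
  qed
qed

text \<open>The counting function of a finite set is right continuous in its endpoint, so a random
  endpoint can be tested against the rational numbers above it.\<close>

lemma card_atMost_measurable:
  assumes f: "f \<in> measurable N M1" and b: "b \<in> borel_measurable N"
  shows "(\<lambda>x. real (card (\<xi> (f x) \<inter> {..b x}))) \<in> borel_measurable N"
  unfolding borel_measurable_iff_ge
proof
  fix k :: real
  have sp: "f x \<in> space M" if "x \<in> space N" for x using measurable_space[OF f that] by simp
  have "{x \<in> space N. k \<le> real (card (\<xi> (f x) \<inter> {..b x}))}
    = {x \<in> space N. \<forall>q::rat. of_rat q < b x \<or> k \<le> real (card (\<xi> (f x) \<inter> {..of_rat q}))}"
  proof (intro Collect_cong conj_cong refl iffI allI)
    fix x and q :: rat assume x: "x \<in> space N" and k: "k \<le> real (card (\<xi> (f x) \<inter> {..b x}))"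
    have "card (\<xi> (f x) \<inter> {..b x}) \<le> card (\<xi> (f x) \<inter> {..of_rat q})" if "b x \<le> of_rat q"
      using that \<xi>_finite[OF sp[OF x]] by (intro card_mono) auto
    then show "of_rat q < b x \<or> k \<le> real (card (\<xi> (f x) \<inter> {..of_rat q}))" using k by (cases "of_rat q < b x") auto
  next
    fix x assume x: "x \<in> space N" and k: "\<forall>q::rat. of_rat q < b x \<or> k \<le> real (card (\<xi> (f x) \<inter> {..of_rat q}))"
    \<comment> \<open>The extra element keeps \<open>A\<close> nonempty when no point lies beyond
      \<open>b x\<close>. Between \<open>b x\<close> and \<open>Min A\<close> the count does not
      change.\<close>
    define A where "A = insert (b x + 1) (\<xi> (f x) \<inter> {b x<..})"
    have A: "finite A" "A \<noteq> {}" using \<xi>_finite[OF sp[OF x]] by (auto simp: A_def)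
    have "b x < Min A" using A by (subst Min_gr_iff) (auto simp: A_def)
    then obtain q where q: "b x < of_rat q" "of_rat q < Min A" using of_rat_dense by blast
    have "\<xi> (f x) \<inter> {..of_rat q} = \<xi> (f x) \<inter> {..b x}"
    proof -
      have "y \<le> b x" if "y \<in> \<xi> (f x)" "y \<le> of_rat q" for y
      proof (rule ccontr)
        assume "\<not> y \<le> b x"
        then have "Min A \<le> y" using that A by (intro Min_le) (auto simp: A_def)
        then show False using q that by simp
      qed
      then show ?thesis using q by auto
    qed
    then show "k \<le> real (card (\<xi> (f x) \<inter> {..b x}))" using k[rule_format, of q] q by simp
  qed
  also have "\<dots> \<in> sets N"
  proof (rule sets.sets_Collect_countable_All, rule sets.sets_Collect_disj)
    fix q :: rat
    show "{x \<in> space N. of_rat q < b x} \<in> sets N" using b by measurable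
    have "(\<lambda>x. real (card (\<xi> (f x) \<inter> {..of_rat q}))) \<in> borel_measurable N"
      by (rule measurable_compose[OF measurable_compose[OF f card_M1]]) auto
    then show "{x \<in> space N. k \<le> real (card (\<xi> (f x) \<inter> {..of_rat q}))} \<in> sets N" by measurable
  qed
  finally show "{x \<in> space N. k \<le> real (card (\<xi> (f x) \<inter> {..b x}))} \<in> sets N" .
qed

lemma hits_measurable:
  assumes "f \<in> measurable N M1" "a \<in> borel_measurable N" "b \<in> borel_measurable N"
  shows "Measurable.pred N (\<lambda>x. hits (f x) (a x) (b x))"
proof -
  have [measurable]: "(\<lambda>x. real (card (\<xi> (f x) \<inter> {..a x}))) \<in> borel_measurable N"
    "(\<lambda>x. real (card (\<xi> (f x) \<inter> {..b x}))) \<in> borel_measurable N"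
    using assms by (auto intro: card_atMost_measurable)
  have "Measurable.pred N (\<lambda>x. real (card (\<xi> (f x) \<inter> {..a x})) < real (card (\<xi> (f x) \<inter> {..b x})))"
    by measurable
  moreover have "Measurable.pred N (\<lambda>x. hits (f x) (a x) (b x)) \<longleftrightarrow>
      Measurable.pred N (\<lambda>x. real (card (\<xi> (f x) \<inter> {..a x})) < real (card (\<xi> (f x) \<inter> {..b x})))"
    by (rule measurable_cong) (use hits_iff measurable_space[OF assms(1)] in simp)
  ultimately show ?thesis by simp
qed

text \<open>The complement of the Poisson void probability of the interval from \<open>a\<close> to
  \<open>b\<close>.\<close>

definition q_hit :: "real \<Rightarrow> real \<Rightarrow> real" where
  "q_hit a b = 1 - exp (- n * (exp (- a) - exp (- b)))"

lemma q_hit_nonneg: "a \<le> b \<Longrightarrow> 0 \<le> q_hit a b" and q_hit_le_1: "q_hit a b \<le> 1"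
  using n_pos by (auto simp: q_hit_def)

lemma q_hit_le_diff: assumes "0 \<le> a" "a \<le> b" shows "q_hit a b \<le> n * (b - a)"
proof -
  have "exp (- a) - exp (- b) = exp (- a) * (1 - exp (- (b - a)))" by (simp add: exp_diff exp_minus field_simps)
  also have "\<dots> \<le> 1 * (b - a)" using assms by (intro mult_mono one_minus_exp_le) auto
  finally have "n * (exp (- a) - exp (- b)) \<le> n * (b - a)" using n_pos by simp
  then show ?thesis using one_minus_exp_le[of "n * (exp (- a) - exp (- b))"] by (simp add: q_hit_def)
qed

lemma prob_card_zero:
  assumes "A \<in> sets borel"
  shows "prob {\<omega>\<in>space M. card (\<xi> \<omega> \<inter> A) = 0} = exp (- measure (exp_intensity n) A)"
proof -
  have "\<forall>j::nat. prob {\<omega> \<in> space M. card (\<xi> \<omega> \<inter> A) = j} =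
     exp (- measure (exp_intensity n) A) * measure (exp_intensity n) A ^ j / fact j"
    using ppp assms by (simp add: poisson_point_process_def)
  from this[rule_format, of 0] show ?thesis by simp
qed

lemma hits_pred: "Measurable.pred M (\<lambda>\<omega>. hits \<omega> a b)"
  by (rule hits_measurable[OF ident_M1]) auto

lemma prob_hits:
  assumes "0 \<le> a" "a \<le> b" shows "prob {\<omega>\<in>space M. hits \<omega> a b} = q_hit a b"
proof -
  have "{\<omega>\<in>space M. \<not> hits \<omega> a b} = {\<omega>\<in>space M. card (\<xi> \<omega> \<inter> {a<..b}) = 0}"
    using \<xi>_finite by (fastforce simp: hits_def)
  then have "prob {\<omega>\<in>space M. \<not> hits \<omega> a b} = exp (- n * (exp (- a) - exp (- b)))"
    using prob_card_zero[of "{a<..b}"] emeasure_exp_intensity_Ioc[OF n_pos assms] assms n_pos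
    by (simp add: measure_def)
  then show ?thesis using prob_neg[OF hits_pred[of a b, unfolded pred_def]] by (simp add: q_hit_def)
qed

lemma tail_event: "{\<omega>\<in>space M. \<xi> \<omega> \<inter> {a<..} \<noteq> {}} \<in> events"
proof -
  have eq: "{\<omega>\<in>space M. \<xi> \<omega> \<inter> {a<..} = {}} = {\<omega>\<in>space M. card (\<xi> \<omega> \<inter> {a<..}) = 0}"
    using \<xi>_finite by auto
  have "{\<omega>\<in>space M. \<xi> \<omega> \<inter> {a<..} = {}} \<in> events"
    using measurable_compose[OF ident_M1 card_M1[of "{a<..}"]] eq by simp
  then show ?thesis by (rule sets.sets_Collect_neg)
qed

lemma prob_tail_le:
  assumes "0 \<le> a" shows "prob {\<omega>\<in>space M. \<xi> \<omega> \<inter> {a<..} \<noteq> {}} \<le> n * exp (- a)"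
proof -
  have eq: "{\<omega>\<in>space M. \<not> \<xi> \<omega> \<inter> {a<..} \<noteq> {}} = {\<omega>\<in>space M. card (\<xi> \<omega> \<inter> {a<..}) = 0}"
    using \<xi>_finite by auto
  have "prob {\<omega>\<in>space M. \<not> \<xi> \<omega> \<inter> {a<..} \<noteq> {}} = exp (- (n * exp (- a)))"
    unfolding eq using prob_card_zero[of "{a<..}"] emeasure_exp_intensity_tail[OF n_pos assms] n_pos
    by (simp add: measure_def)
  then show ?thesis using prob_neg[OF tail_event[of a]] one_minus_exp_le[of "n * exp (- a)"] by simp
qed

lemma hits_indep:
  fixes s :: "nat \<Rightarrow> real"
  assumes "0 \<le> s 0" "mono s"
  shows "indep_vars (\<lambda>_. borel) (\<lambda>j \<omega>. of_bool (card (\<xi> \<omega> \<inter> {s j<..s (Suc j)}) \<noteq> 0) :: real) {..<N}"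
proof -
  have "disjoint_family_on (\<lambda>j. {s j<..s (Suc j)}) {..<N}"
    unfolding disjoint_family_on_def
  proof (intro ballI impI)
    fix i j :: nat assume "i \<noteq> j"
    then have "s (Suc i) \<le> s j \<or> s (Suc j) \<le> s i"
      using monoD[OF assms(2)] by (metis Suc_leI linorder_neqE_nat)
    then show "{s i<..s (Suc i)} \<inter> {s j<..s (Suc j)} = {}" by auto
  qed
  then have "indep_vars (\<lambda>_. count_space UNIV) (\<lambda>j \<omega>. card (\<xi> \<omega> \<inter> {s j<..s (Suc j)})) {..<N}"
    using ppp unfolding poisson_point_process_def sets_exp_intensity
    by (elim conjE allE[of _ N] allE[of _ "\<lambda>j. {s j<..s (Suc j)}"]) auto
  then show ?thesis by (rule indep_vars_compose2) auto
qed

lemma hits_iff_card: "\<omega> \<in> space M \<Longrightarrow> hits \<omega> a b \<longleftrightarrow> card (\<xi> \<omega> \<inter> {a<..b}) \<noteq> 0"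
  using \<xi>_finite[of \<omega>] by (auto simp: hits_def)

end

section \<open>Riemann sums and the conditional probabilities of hitting a cell\<close>

lemma antimono_integrable_on:
  fixes f :: "real \<Rightarrow> real"
  assumes "antimono_on {a..b} f" shows "f integrable_on {a..b}"
proof -
  have "(\<lambda>x. - f x) integrable_on {a..b}"
    by (rule integrable_on_mono_on) (use assms in \<open>auto simp: monotone_on_def\<close>)
  then have "(\<lambda>x. - (- f x)) integrable_on {a..b}" by (rule integrable_neg)
  then show ?thesis by simp
qed

text \<open>On each cell the sum and the integral differ by at most \<open>h\<close> times the drop
  of \<open>f\<close>, and the drops telescope. Monotonicity replaces a modulus of continuity, which
  a path with jumps does not offer.\<close>

lemma antimono_riemann_sum:
  fixes f :: "real \<Rightarrow> real"
  assumes f: "antimono_on {0..} f" and h: "0 \<le> h"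
  shows "integral {0..real k * h} f \<le> h * (\<Sum>j<k. f (real j * h))"
    and "h * (\<Sum>j<k. f (real j * h)) \<le> integral {0..real k * h} f + h * (f 0 - f (real k * h))"
proof -
  have int: "f integrable_on {a..b}" if "0 \<le> a" for a b
    by (rule antimono_integrable_on) (use f that in \<open>auto simp: monotone_on_def\<close>)
  have "integral {0..real k * h} f \<le> h * (\<Sum>j<k. f (real j * h)) \<and>
    h * (\<Sum>j<k. f (real j * h)) \<le> integral {0..real k * h} f + h * (f 0 - f (real k * h))"
  proof (induction k)
    case (Suc k)
    let ?a = "real k * h" and ?b = "real (Suc k) * h"
    have ab: "0 \<le> ?a" "?a \<le> ?b" "?b - ?a = h" using h by (auto simp: algebra_simps)
    have split: "integral {0..?b} f = integral {0..?a} f + integral {?a..?b} f"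
      using ab by (intro Henstock_Kurzweil_Integration.integral_combine[symmetric] int) auto
    have bnd: "f x \<le> f ?a" "f ?b \<le> f x" if "x \<in> {?a..?b}" for x
      using that ab order_trans[OF ab(1), of x] by (auto intro!: monotone_onD[OF f])
    have "integral {?a..?b} f \<le> integral {?a..?b} (\<lambda>x. f ?a)"
      using ab bnd by (intro integral_le int) auto
    moreover have "integral {?a..?b} (\<lambda>x. f ?b) \<le> integral {?a..?b} f"
      using ab bnd by (intro integral_le int) auto
    ultimately have "integral {?a..?b} f \<le> h * f ?a" "h * f ?b \<le> integral {?a..?b} f"
      using ab by simp_all
    then show ?case using Suc split by (simp add: algebra_simps)
  qed simp
  then show "integral {0..real k * h} f \<le> h * (\<Sum>j<k. f (real j * h))"
    and "h * (\<Sum>j<k. f (real j * h)) \<le> integral {0..real k * h} f + h * (f 0 - f (real k * h))" by auto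
qed

lemma (in prob_space) expectation_cong_distr:
  fixes f :: "real \<Rightarrow> real"
  assumes "distr M borel X = distr M borel Y" "X \<in> borel_measurable M" "Y \<in> borel_measurable M"
    "f \<in> borel_measurable borel"
  shows "expectation (\<lambda>\<omega>. f (X \<omega>)) = expectation (\<lambda>\<omega>. f (Y \<omega>))"
  using integral_distr[of X M borel f] integral_distr[of Y M borel f] assms by simp

context zero_drift_subordinator begin

lemma hit_prob_measurable [measurable]: "0 \<le> h \<Longrightarrow> hit_prob h \<in> borel_measurable borel"
proof -
  assume h: "0 \<le> h"
  note [measurable] = S_measurable[OF h]
  show ?thesis unfolding hit_prob_def[abs_def]
    by (intro borel_measurable_diff borel_measurable_const borel_measurable_lebesgue_integral) measurable
qed

end

context sieved_subordinator begin

text \<open>Memorylessness of the exponential intensity: seen from \<open>a\<close>, the points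
  beyond it form a process of the same kind with \<open>n\<close> replaced by
  \<open>n * exp (- a)\<close>. This is the origin of the argument of \<open>Phi\<close> in the
  compensator.\<close>

lemma q_hit_eq: "q_hit a b = 1 - exp (- (n * exp (- a)) * (1 - exp (- (b - a))))"
proof -
  have "exp (- b) = exp (- a) * exp (- (b - a))" by (simp add: exp_add[symmetric])
  then have "n * (exp (- a) - exp (- b)) = n * exp (- a) * (1 - exp (- (b - a)))"
    by (simp add: algebra_simps)
  then show ?thesis by (simp add: q_hit_def)
qed

lemma expectation_q_hit_increment:
  assumes "0 \<le> t" "0 \<le> h"
  shows "expectation (\<lambda>\<omega>. q_hit a (a + (S (t + h) \<omega> - S t \<omega>))) = hit_prob h (n * exp (- a))"
proof -
  have [measurable]: "S t \<in> borel_measurable M" "S (t + h) \<in> borel_measurable M" "S h \<in> borel_measurable M"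
    using assms by auto
  have "expectation (\<lambda>\<omega>. q_hit a (a + (S (t + h) \<omega> - S t \<omega>))) =
      expectation (\<lambda>\<omega>. 1 - exp (- (n * exp (- a)) * (1 - exp (- (S (t + h) \<omega> - S t \<omega>)))))"
    by (simp add: q_hit_eq)
  also have "\<dots> = expectation (\<lambda>\<omega>. 1 - exp (- (n * exp (- a)) * (1 - exp (- (S h \<omega>)))))"
    by (rule expectation_cong_distr[OF increment_distr[OF assms], where f = "\<lambda>x. 1 - exp (- (n * exp (- a)) * (1 - exp (- x)))"])
      measurable
  also have "\<dots> = hit_prob h (n * exp (- a))"
  proof -
    have "integrable M (\<lambda>\<omega>. exp (- (n * exp (- a)) * (1 - exp (- S h \<omega>))))"
      by (rule integrable_const_bound[where B = 1])
        (use n_pos S_nonneg[of _ h] assms in \<open>auto intro!: AE_I2\<close>)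
    then show ?thesis by (simp add: hit_prob_def prob_space)
  qed
  finally show ?thesis .
qed

text \<open>Moving the start of the cell to 0 only increases the intensity, and it leaves a function
  of the increment alone, whose law does not depend on \<open>t\<close>.\<close>

lemma q_hit_increment_le:
  assumes "\<omega> \<in> space M" "0 \<le> t" "0 \<le> h"
  shows "q_hit (S t \<omega>) (S (t + h) \<omega>) \<le> q_hit 0 (0 + (S (t + h) \<omega> - S t \<omega>))"
proof -
  have "exp (- S t \<omega>) * (1 - exp (- (S (t + h) \<omega> - S t \<omega>))) \<le> 1 * (1 - exp (- (S (t + h) \<omega> - S t \<omega>)))"
    using S_nonneg S_mono[of \<omega> t "t + h"] assms by (intro mult_right_mono) auto
  then show ?thesis using n_pos unfolding q_hit_eq by simp
qed

lemma q_hit_S_measurable [measurable]: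
  "0 \<le> s \<Longrightarrow> 0 \<le> t \<Longrightarrow> (\<lambda>\<omega>. q_hit (S s \<omega>) (S t \<omega>)) \<in> borel_measurable M"
  unfolding q_hit_def by measurable

lemma integrable_q_hit:
  assumes "0 \<le> s" "s \<le> t"
  shows "integrable M (\<lambda>\<omega>. q_hit (S s \<omega>) (S t \<omega>))"
  by (rule integrable_const_bound[where B = 1])
    (use assms q_hit_nonneg q_hit_le_1 S_mono in \<open>auto intro!: AE_I2\<close>)

lemma expectation_q_hit_le:
  assumes "0 \<le> t" "0 \<le> h"
  shows "expectation (\<lambda>\<omega>. q_hit (S t \<omega>) (S (t + h) \<omega>)) \<le> h * Phi \<nu> n"
proof -
  have [measurable]: "S t \<in> borel_measurable M" "S (t + h) \<in> borel_measurable M" using assms by auto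
  have "expectation (\<lambda>\<omega>. q_hit (S t \<omega>) (S (t + h) \<omega>)) \<le> expectation (\<lambda>\<omega>. q_hit 0 (0 + (S (t + h) \<omega> - S t \<omega>)))"
  proof (intro integral_mono integrable_q_hit)
    show "integrable M (\<lambda>\<omega>. q_hit 0 (0 + (S (t + h) \<omega> - S t \<omega>)))"
    proof (rule integrable_const_bound[where B = 1])
      show "AE \<omega> in M. norm (q_hit 0 (0 + (S (t + h) \<omega> - S t \<omega>))) \<le> 1"
        using q_hit_le_1 assms S_mono by (auto intro!: AE_I2 simp: q_hit_nonneg)
    qed (unfold q_hit_def, measurable)
  qed (use assms q_hit_increment_le in auto)
  also have "\<dots> = hit_prob h n" using expectation_q_hit_increment[OF assms, of 0] by simp
  also have "\<dots> \<le> h * Phi \<nu> n" using assms n_pos by (intro hit_prob_le) auto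
  finally show ?thesis .
qed

text \<open>The first layer of randomness. Given \<open>S\<close>, the cells are hit independently
  with probabilities \<open>q_hit\<close>, and a Bernoulli variance is at most its success
  probability. The resulting conditional bound is integrated over \<open>S\<close>.\<close>

lemma hit_indicator_maximal:
  assumes h: "0 \<le> h" and \<eta>: "0 < \<eta>"
  shows "prob {\<omega>\<in>space M. \<exists>k\<le>N. \<eta> \<le> \<bar>\<Sum>j<k. of_bool (hits \<omega> (S (real j * h) \<omega>) (S (real (Suc j) * h) \<omega>))
       - q_hit (S (real j * h) \<omega>) (S (real (Suc j) * h) \<omega>)\<bar>} \<le> real N * h * Phi \<nu> n / \<eta>\<^sup>2"
    (is "prob {\<omega>\<in>space M. ?P \<omega> \<omega>} \<le> _")
    and "{\<omega>\<in>space M. \<exists>k\<le>N. \<eta> \<le> \<bar>\<Sum>j<k. of_bool (hits \<omega> (S (real j * h) \<omega>) (S (real (Suc j) * h) \<omega>))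
       - q_hit (S (real j * h) \<omega>) (S (real (Suc j) * h) \<omega>)\<bar>} \<in> events"
proof -
  define s where "s j \<omega> = S (real j * h) \<omega>" for j \<omega>
  have tj: "0 \<le> real j * h" for j using h by simp
  have ts: "real (Suc j) * h = real j * h + h" for j by (simp add: algebra_simps)
  have tle: "real j * h \<le> real (Suc j) * h" for j using h by (intro mult_right_mono) auto
  \<comment> \<open>The points are read off at the first outcome and the path at the second; on the
    diagonal this is the event of the statement.\<close>
  define Q where "Q = {p \<in> space (M1 \<Otimes>\<^sub>M M2). \<exists>k\<le>N. \<eta> \<le> \<bar>\<Sum>j<k. of_bool (hits (fst p) (s j (snd p)) (s (Suc j) (snd p)))
       - q_hit (s j (snd p)) (s (Suc j) (snd p))\<bar>}"
  have sm [measurable]: "(\<lambda>p. s j (snd p)) \<in> borel_measurable (M1 \<Otimes>\<^sub>M M2)" for j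
    unfolding s_def by (rule measurable_compose[OF measurable_snd S_M2[OF tj]])
  have [measurable]: "Measurable.pred (M1 \<Otimes>\<^sub>M M2) (\<lambda>p. hits (fst p) (s j (snd p)) (s (Suc j) (snd p)))" for j
    by (rule hits_measurable) auto
  have Q: "Q \<in> sets (M1 \<Otimes>\<^sub>M M2)" unfolding Q_def q_hit_def by measurable
  have spQ: "(\<omega>1, \<omega>2) \<in> space (M1 \<Otimes>\<^sub>M M2)" if "\<omega>1 \<in> space M" "\<omega>2 \<in> space M" for \<omega>1 \<omega>2
    using that by (simp add: space_pair_measure)
  define b where "b \<omega> = (\<Sum>j<N. q_hit (s j \<omega>) (s (Suc j) \<omega>)) / \<eta>\<^sup>2" for \<omega>
  have ib: "integrable M b"
    unfolding b_def[abs_def] s_def by (intro integrable_divide Bochner_Integration.integrable_sum integrable_q_hit tj tle)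
  have eb: "expectation b \<le> real N * h * Phi \<nu> n / \<eta>\<^sup>2"
  proof -
    have "expectation b = (\<Sum>j<N. expectation (\<lambda>\<omega>. q_hit (s j \<omega>) (s (Suc j) \<omega>))) / \<eta>\<^sup>2"
      unfolding b_def[abs_def] integral_divide_zero
      by (subst Bochner_Integration.integral_sum) (auto simp: s_def simp del: of_nat_Suc intro!: integrable_q_hit tj tle)
    also have "\<dots> \<le> (\<Sum>j<N. h * Phi \<nu> n) / \<eta>\<^sup>2"
      unfolding s_def ts using h by (intro divide_right_mono sum_mono expectation_q_hit_le) auto
    finally show ?thesis by simp
  qed
  have eqQ: "{\<omega>\<in>space M. (\<omega>, \<omega>) \<in> Q} = {\<omega>\<in>space M. ?P \<omega> \<omega>}"
    unfolding Q_def s_def using spQ by auto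
  have "(\<lambda>\<omega>. (\<omega>, \<omega>)) -` Q \<inter> space M \<in> events" by (rule measurable_sets[OF diagonal_measurable Q])
  then show "{\<omega>\<in>space M. ?P \<omega> \<omega>} \<in> events"
    unfolding eqQ[symmetric] by (simp add: vimage_def Int_def conj_commute)
  have "prob {\<omega>\<in>space M. (\<omega>, \<omega>) \<in> Q} \<le> expectation b"
  proof (rule fubini_diagonal_le[OF Q ib])
    fix \<omega>2 assume \<omega>2: "\<omega>2 \<in> space M"
    have s0: "0 \<le> s j \<omega>2" for j unfolding s_def by (rule S_nonneg[OF \<omega>2 tj])
    have smono: "mono (\<lambda>j. s j \<omega>2)"
      unfolding s_def using h by (intro monoI S_mono[OF \<omega>2 tj] mult_right_mono) auto
    have sle: "s j \<omega>2 \<le> s (Suc j) \<omega>2" for j using monoD[OF smono, of j "Suc j"] by simp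
    define D where "D j \<omega> = (of_bool (card (\<xi> \<omega> \<inter> {s j \<omega>2<..s (Suc j) \<omega>2}) \<noteq> 0) :: real)" for j \<omega>
    define q where "q j = q_hit (s j \<omega>2) (s (Suc j) \<omega>2)" for j
    have q01: "0 \<le> q j" "q j \<le> 1" for j using q_hit_nonneg[OF sle] q_hit_le_1 by (auto simp: q_def)
    have indD: "indep_vars (\<lambda>_. borel) D {..<N}" unfolding D_def by (rule hits_indep[OF s0 smono])
    have DM [measurable]: "D j \<in> borel_measurable M" for j
      using hits_indep[OF s0 smono, of "Suc j"] unfolding D_def indep_vars_def by auto
    have D01: "0 \<le> D j \<omega>" "D j \<omega> \<le> 1" "(D j \<omega>)\<^sup>2 = D j \<omega>" for j \<omega> by (auto simp: D_def)
    have iD: "integrable M (D j)" for j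
      by (rule integrable_const_bound[where B = 1]) (use D01 in \<open>auto intro!: AE_I2\<close>)
    have ED: "expectation (D j) = q j" for j
    proof -
      have "expectation (D j) = expectation (indicat_real {\<omega>\<in>space M. hits \<omega> (s j \<omega>2) (s (Suc j) \<omega>2)})"
        by (rule Bochner_Integration.integral_cong) (auto simp: D_def hits_iff_card indicator_def)
      also have "\<dots> = prob {\<omega>\<in>space M. hits \<omega> (s j \<omega>2) (s (Suc j) \<omega>2)}"
        by (simp add: Int_absorb2)
      also have "\<dots> = q j" using prob_hits[OF s0 sle] by (simp add: q_def)
      finally show ?thesis .
    qed
    have sq: "(D j \<omega> - q j)\<^sup>2 = D j \<omega> * (1 - 2 * q j) + (q j)\<^sup>2" for j \<omega>
      using D01(3)[of j \<omega>] by (simp add: power2_diff algebra_simps)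
    have isq: "integrable M (\<lambda>\<omega>. (D j \<omega> - q j)\<^sup>2)" for j
      unfolding sq using iD by (intro Bochner_Integration.integrable_add integrable_mult_left) auto
    have Esq: "expectation (\<lambda>\<omega>. (D j \<omega> - q j)\<^sup>2) \<le> q j" for j
    proof -
      have "expectation (\<lambda>\<omega>. (D j \<omega> - q j)\<^sup>2) = q j * (1 - 2 * q j) + (q j)\<^sup>2"
        unfolding sq using iD by (subst Bochner_Integration.integral_add) (auto simp: ED prob_space)
      also have "\<dots> \<le> q j" by (simp add: algebra_simps power2_eq_square)
      finally show ?thesis .
    qed
    have "prob {\<omega>\<in>space M. \<exists>k\<le>N. \<eta> \<le> \<bar>\<Sum>j<k. D j \<omega> - q j\<bar>} \<le> (\<Sum>j<N. expectation (\<lambda>\<omega>. (D j \<omega> - q j)\<^sup>2)) / \<eta>\<^sup>2"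
    proof (rule maximal_inequality_innovations[OF indD, where \<phi> = "\<lambda>j z x. x - q j"])
      fix j
      show "(\<lambda>(z :: nat \<Rightarrow> real, x). x - q j) \<in> borel_measurable ((\<Pi>\<^sub>M i\<in>{..<j}. borel) \<Otimes>\<^sub>M borel)" by measurable
      show "expectation (\<lambda>\<omega>. D j \<omega> - q j) = 0" using iD by (simp add: ED prob_space)
    qed (use isq \<eta> in auto)
    also have "\<dots> \<le> b \<omega>2" unfolding b_def q_def[symmetric] using Esq by (intro divide_right_mono sum_mono) auto
    also have "{\<omega>\<in>space M. \<exists>k\<le>N. \<eta> \<le> \<bar>\<Sum>j<k. D j \<omega> - q j\<bar>} = {\<omega>1\<in>space M. (\<omega>1, \<omega>2) \<in> Q}"
      unfolding Q_def using spQ[OF _ \<omega>2] by (auto simp: D_def q_def hits_iff_card)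
    finally show "prob {\<omega>1\<in>space M. (\<omega>1, \<omega>2) \<in> Q} \<le> b \<omega>2" .
  qed
  then show "prob {\<omega>\<in>space M. ?P \<omega> \<omega>} \<le> real N * h * Phi \<nu> n / \<eta>\<^sup>2" using eb eqQ by simp
qed

text \<open>The second layer of randomness. \<open>q_hit\<close> still depends on the increment of
  \<open>S\<close> over the cell, and \<open>hit_prob\<close> is its conditional mean given the
  position at the left end. Both lie between 0 and 1, so their squares are bounded by their values,
  each of mean at most \<open>h * Phi \<nu> n\<close>; hence the factor 2.\<close>

lemma hit_prob_maximal:
  assumes h: "0 \<le> h" and \<eta>: "0 < \<eta>"
  shows "prob {\<omega>\<in>space M. \<exists>k\<le>N. \<eta> \<le> \<bar>\<Sum>j<k. q_hit (S (real j * h) \<omega>) (S (real (Suc j) * h) \<omega>)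
       - hit_prob h (n * exp (- S (real j * h) \<omega>))\<bar>} \<le> 2 * (real N * h * Phi \<nu> n) / \<eta>\<^sup>2"
proof -
  define t where "t j = real j * h" for j
  have tj: "0 \<le> t j" "t j \<le> t (Suc j)" "t (Suc j) = t j + h" for j using h by (auto simp: t_def algebra_simps)
  note [measurable] = S_measurable[OF tj(1)] hit_prob_measurable[OF h]
  define Z where "Z j \<omega> = S (t (Suc j)) \<omega> - S (t j) \<omega>" for j \<omega>
  define X where "X j \<omega> = q_hit (S (t j) \<omega>) (S (t (Suc j)) \<omega>) - hit_prob h (n * exp (- S (t j) \<omega>))" for j \<omega>
  \<comment> \<open>The increments before index \<open>j\<close> sum to the current position
    \<open>S (t j)\<close>, which \<open>\<phi>\<close> recovers in this way from the past
    innovations.\<close>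
  define \<phi> where "\<phi> j z x = q_hit (\<Sum>i<j. z i) ((\<Sum>i<j. z i) + x) - hit_prob h (n * exp (- (\<Sum>i<j. z i)))"
    for j and z :: "nat \<Rightarrow> real" and x :: real
  have indZ: "indep_vars (\<lambda>_. borel) Z {..<N}"
    unfolding Z_def using tj by (intro increments_indep) auto
  have sumZ: "(\<Sum>i<j. Z i \<omega>) = S (t j) \<omega>" if "\<omega> \<in> space M" for j \<omega>
    using S_zero[OF that] sum_lessThan_telescope[of "\<lambda>j. S (t j) \<omega>" j] by (simp add: Z_def t_def)
  have hp: "0 \<le> hit_prob h (n * exp (- S (t j) \<omega>))" "hit_prob h (n * exp (- S (t j) \<omega>)) \<le> h * Phi \<nu> n"
    if "\<omega> \<in> space M" for j \<omega>
  proof -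
    show "0 \<le> hit_prob h (n * exp (- S (t j) \<omega>))" using n_pos h by (intro hit_prob_nonneg) auto
    have "hit_prob h (n * exp (- S (t j) \<omega>)) \<le> h * Phi \<nu> (n * exp (- S (t j) \<omega>))" using n_pos h by (intro hit_prob_le) auto
    also have "\<dots> \<le> h * Phi \<nu> n"
      using n_pos h S_nonneg[OF that tj(1)] by (intro mult_left_mono Phi_mono) (auto simp: mult_left_le)
    finally show "hit_prob h (n * exp (- S (t j) \<omega>)) \<le> h * Phi \<nu> n" .
  qed
  have hp1: "hit_prob h m \<le> 1" for m
    unfolding hit_prob_def by (simp add: integral_nonneg_AE)
  have q01: "0 \<le> q_hit (S (t j) \<omega>) (S (t (Suc j)) \<omega>)" if "\<omega> \<in> space M" for j \<omega>
    using S_mono[OF that tj(1,2)] by (rule q_hit_nonneg)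
  have XM [measurable]: "X j \<in> borel_measurable M" for j
    unfolding X_def[abs_def] by (intro borel_measurable_diff q_hit_S_measurable tj) measurable
  have sqle: "(X j \<omega>)\<^sup>2 \<le> q_hit (S (t j) \<omega>) (S (t (Suc j)) \<omega>) + h * Phi \<nu> n" if \<omega>: "\<omega> \<in> space M" for j \<omega>
  proof -
    let ?q = "q_hit (S (t j) \<omega>) (S (t (Suc j)) \<omega>)" and ?p = "hit_prob h (n * exp (- S (t j) \<omega>))"
    have "(X j \<omega>)\<^sup>2 = ?q * ?q + ?p * ?p - 2 * (?q * ?p)" by (simp add: X_def power2_eq_square algebra_simps)
    also have "\<dots> \<le> ?q * 1 + ?p * 1 - 0"
      using q01[OF \<omega>] hp[OF \<omega>] q_hit_le_1 hp1 by (intro diff_mono add_mono mult_left_mono) auto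
    also have "\<dots> \<le> ?q + h * Phi \<nu> n" using hp(2)[OF \<omega>] by simp
    finally show ?thesis .
  qed
  have iq: "integrable M (\<lambda>\<omega>. q_hit (S (t j) \<omega>) (S (t (Suc j)) \<omega>) + h * Phi \<nu> n)" for j
    using integrable_q_hit[OF tj(1,2)] by simp
  have isq: "integrable M (\<lambda>\<omega>. (X j \<omega>)\<^sup>2)" for j
    by (rule Bochner_Integration.integrable_bound[OF iq[of j]])
      (use sqle in \<open>auto intro!: AE_I2 order_trans[OF _ abs_ge_self]\<close>)
  have Esq: "expectation (\<lambda>\<omega>. (X j \<omega>)\<^sup>2) \<le> 2 * (h * Phi \<nu> n)" for j
  proof -
    have "expectation (\<lambda>\<omega>. (X j \<omega>)\<^sup>2) \<le> expectation (\<lambda>\<omega>. q_hit (S (t j) \<omega>) (S (t (Suc j)) \<omega>) + h * Phi \<nu> n)"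
      using sqle by (intro integral_mono isq iq) auto
    also have "\<dots> = expectation (\<lambda>\<omega>. q_hit (S (t j) \<omega>) (S (t (Suc j)) \<omega>)) + h * Phi \<nu> n"
      using integrable_q_hit[OF tj(1,2)] by (simp add: prob_space)
    also have "\<dots> \<le> 2 * (h * Phi \<nu> n)" using expectation_q_hit_le[OF tj(1) h] by (simp add: tj(3))
    finally show ?thesis .
  qed
  have "prob {\<omega>\<in>space M. \<exists>k\<le>N. \<eta> \<le> \<bar>\<Sum>j<k. X j \<omega>\<bar>} \<le> (\<Sum>j<N. expectation (\<lambda>\<omega>. (X j \<omega>)\<^sup>2)) / \<eta>\<^sup>2"
  proof (rule maximal_inequality_innovations[OF indZ, where \<phi> = \<phi>])
    fix j assume j: "j < N"
    have [measurable]: "(\<lambda>p. \<Sum>i<j. fst p i) \<in> borel_measurable ((\<Pi>\<^sub>M i\<in>{..<j}. (borel :: real measure)) \<Otimes>\<^sub>M (borel :: real measure))"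
      by (intro borel_measurable_sum measurable_compose[OF measurable_fst]) simp
    have "(\<lambda>p. q_hit (\<Sum>i<j. fst p i) ((\<Sum>i<j. fst p i) + snd p) - hit_prob h (n * exp (- (\<Sum>i<j. fst p i))))
      \<in> borel_measurable ((\<Pi>\<^sub>M i\<in>{..<j}. (borel :: real measure)) \<Otimes>\<^sub>M (borel :: real measure))"
      unfolding q_hit_def by measurable
    then show "(\<lambda>(z, x). \<phi> j z x) \<in> borel_measurable ((\<Pi>\<^sub>M i\<in>{..<j}. borel) \<Otimes>\<^sub>M borel)"
      by (simp add: \<phi>_def case_prod_beta')
    show "X j \<omega> = \<phi> j (\<lambda>i\<in>{..<j}. Z i \<omega>) (Z j \<omega>)" if "\<omega> \<in> space M" for \<omega>
      using sumZ[OF that, of j] by (simp add: X_def \<phi>_def) (simp add: Z_def)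
    fix \<omega>' assume "\<omega>' \<in> space M"
    let ?a = "S (t j) \<omega>'"
    have "expectation (\<lambda>\<omega>. \<phi> j (\<lambda>i\<in>{..<j}. Z i \<omega>') (Z j \<omega>)) =
        expectation (\<lambda>\<omega>. q_hit ?a (?a + (S (t j + h) \<omega> - S (t j) \<omega>)) - hit_prob h (n * exp (- ?a)))"
      using sumZ[OF \<open>\<omega>' \<in> space M\<close>, of j] by (simp add: \<phi>_def Z_def[of j] tj(3))
    also have "\<dots> = expectation (\<lambda>\<omega>. q_hit ?a (?a + (S (t j + h) \<omega> - S (t j) \<omega>))) - hit_prob h (n * exp (- ?a))"
    proof -
      have [measurable]: "S (t j + h) \<in> borel_measurable M" using tj(1)[of "Suc j"] tj(3)[of j] by auto
      have "integrable M (\<lambda>\<omega>. q_hit ?a (?a + (S (t j + h) \<omega> - S (t j) \<omega>)))"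
      proof (rule integrable_const_bound[where B = 1])
        show "AE \<omega> in M. norm (q_hit ?a (?a + (S (t j + h) \<omega> - S (t j) \<omega>))) \<le> 1"
          using q_hit_le_1 S_mono[OF _ tj(1,2)] by (auto intro!: AE_I2 simp: q_hit_nonneg tj(3))
      qed (unfold q_hit_def, measurable)
      then show ?thesis by (simp add: prob_space)
    qed
    also have "\<dots> = 0" using expectation_q_hit_increment[OF tj(1) h] by simp
    finally show "expectation (\<lambda>\<omega>. \<phi> j (\<lambda>i\<in>{..<j}. Z i \<omega>') (Z j \<omega>)) = 0" .
  qed (use isq \<eta> in auto)
  also have "\<dots> \<le> (\<Sum>j<N. 2 * (h * Phi \<nu> n)) / \<eta>\<^sup>2"
    using Esq by (intro divide_right_mono sum_mono) auto
  finally show ?thesis by (simp add: X_def t_def mult_ac)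
qed

end

section \<open>Hits along an increasing path\<close>

definition hit_at :: "(real \<Rightarrow> real) \<Rightarrow> real set \<Rightarrow> real \<Rightarrow> bool" where
  "hit_at s X t \<longleftrightarrow> X \<inter> {left_lim s t <..< s t} \<noteq> {}"

locale increasing_path =
  fixes s :: "real \<Rightarrow> real"
  assumes mono: "mono_on {0..} s" and cadlag: "cadlag s"
begin

lemma monoD: "0 \<le> u \<Longrightarrow> u \<le> v \<Longrightarrow> s u \<le> s v"
  using mono by (auto simp: mono_on_def)

lemma right_cont: "0 \<le> t \<Longrightarrow> (s \<longlongrightarrow> s t) (at_right t)"
  using cadlag by (simp add: cadlag_def)

lemma left_lim_tendsto: "0 < t \<Longrightarrow> (s \<longlongrightarrow> left_lim s t) (at_left t)"
proof -
  assume t: "0 < t"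
  then obtain l where "(s \<longlongrightarrow> l) (at_left t)" using cadlag by (auto simp: cadlag_def)
  moreover from this have "Lim (at_left t) s = l" by (intro tendsto_Lim) auto
  ultimately show ?thesis using t by (simp add: left_lim_def)
qed

lemma eventually_at_left_pos: "0 < t \<Longrightarrow> \<forall>\<^sub>F v in at_left t. u < v \<and> 0 \<le> v \<and> v < t" if "u < t" for u t :: real
proof -
  assume t: "0 < t"
  have "\<forall>\<^sub>F v in at_left t. v \<in> {max u 0<..<t}" using that t by (intro eventually_at_left_real) auto
  then show ?thesis by eventually_elim auto
qed

lemma le_left_lim: "0 \<le> u \<Longrightarrow> u < t \<Longrightarrow> s u \<le> left_lim s t"
proof (rule tendsto_lowerbound[OF left_lim_tendsto])
  assume ut: "0 \<le> u" "u < t"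
  show "\<forall>\<^sub>F v in at_left t. s u \<le> s v"
    using eventually_at_left_pos[of u t] ut by (auto elim!: eventually_mono intro: monoD)
qed auto

lemma left_lim_le_bound: "0 < t \<Longrightarrow> (\<And>v. 0 \<le> v \<Longrightarrow> v < t \<Longrightarrow> s v \<le> c) \<Longrightarrow> left_lim s t \<le> c"
proof (rule tendsto_upperbound[OF left_lim_tendsto])
  assume t: "0 < t" and b: "\<And>v. 0 \<le> v \<Longrightarrow> v < t \<Longrightarrow> s v \<le> c"
  show "\<forall>\<^sub>F v in at_left t. s v \<le> c"
    using eventually_at_left_pos[of 0 t] t by (auto elim!: eventually_mono intro: b)
qed auto

lemma hit_at_pos: "0 \<le> t \<Longrightarrow> hit_at s X t \<Longrightarrow> 0 < t"
  by (cases "t = 0") (auto simp: hit_at_def left_lim_def)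

lemma jump_interval_unique:
  assumes "0 \<le> t" "0 \<le> u" "left_lim s t < x" "x < s t" "left_lim s u < x" "x < s u"
  shows "t = u"
proof (rule linorder_cases[of t u])
  assume "t < u"
  then show ?thesis using le_left_lim[OF assms(1) \<open>t < u\<close>] assms by linarith
next
  assume "u < t"
  then show ?thesis using le_left_lim[OF assms(2) \<open>u < t\<close>] assms by linarith
qed simp

text \<open>Distinct jump intervals are disjoint, so each point accounts for at most one hit
  time.\<close>

lemma finite_hits:
  assumes "finite X" shows "finite {t. 0 \<le> t \<and> hit_at s X t}"
proof -
  have "finite {t. 0 \<le> t \<and> left_lim s t < x \<and> x < s t}" for x
  proof (cases "\<exists>t\<ge>0. left_lim s t < x \<and> x < s t")
    case True
    then obtain u where u: "0 \<le> u" "left_lim s u < x" "x < s u" by blast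
    have "{t. 0 \<le> t \<and> left_lim s t < x \<and> x < s t} \<subseteq> {u}"
    proof
      fix t assume "t \<in> {t. 0 \<le> t \<and> left_lim s t < x \<and> x < s t}"
      then have "t = u" by (intro jump_interval_unique[OF _ u(1) _ _ u(2,3)]) blast+
      then show "t \<in> {u}" by blast
    qed
    then show ?thesis by (rule finite_subset) simp
  next
    case False
    then have "{t. 0 \<le> t \<and> left_lim s t < x \<and> x < s t} = {}" by blast
    then show ?thesis by (simp only: finite.emptyI)
  qed
  then have "finite (\<Union>x\<in>X. {t. 0 \<le> t \<and> left_lim s t < x \<and> x < s t})" using assms by blast
  moreover have "{t. 0 \<le> t \<and> hit_at s X t} = (\<Union>x\<in>X. {t. 0 \<le> t \<and> left_lim s t < x \<and> x < s t})"
    by (auto simp: hit_at_def)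
  ultimately show ?thesis by simp
qed

end

section \<open>Counting with dyadic meshes\<close>

lemma mesh_cell_exists:
  fixes u h :: real
  assumes "0 < h" "0 < u" shows "\<exists>j. real j * h < u \<and> u \<le> real (Suc j) * h"
proof -
  define j where "j = nat (\<lceil>u / h\<rceil> - 1)"
  have "0 < u / h" using assms by simp
  then have j: "real j = of_int \<lceil>u / h\<rceil> - 1" by (simp add: j_def)
  have "real j < u / h" "u / h \<le> real (Suc j)" using j by linarith+
  then have "real j * h < u \<and> u \<le> real (Suc j) * h" using assms by (simp add: field_simps)
  then show ?thesis by blast
qed

lemma mesh_cell_unique:
  fixes u h :: real
  assumes "0 < h" "real i * h < u" "u \<le> real (Suc i) * h" "real j * h < u" "u \<le> real (Suc j) * h"
  shows "i = j"
proof -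
  have "\<not> i < j" if "real j * h < u" "u \<le> real (Suc i) * h" for i j
  proof
    assume "i < j"
    then have "real (Suc i) * h \<le> real j * h" using assms(1) by (intro mult_right_mono) auto
    then show False using that by linarith
  qed
  then show ?thesis using assms by (metis linorder_neqE_nat)
qed

lemma card_mesh_cells:
  fixes U :: "real set" and h :: real
  assumes h: "0 < h" and U: "finite U" "U \<subseteq> {0<..}"
    and gap: "\<And>u v. u \<in> U \<Longrightarrow> v \<in> U \<Longrightarrow> u < v \<Longrightarrow> h < v - u"
  shows "card {j. j < k \<and> (\<exists>u\<in>U. real j * h < u \<and> u \<le> real (Suc j) * h)} = card {u\<in>U. u \<le> real k * h}"
proof -
  have "\<forall>u\<in>U. \<exists>j. real j * h < u \<and> u \<le> real (Suc j) * h" using mesh_cell_exists[OF h] U by auto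
  then obtain J where J: "\<And>u. u \<in> U \<Longrightarrow> real (J u) * h < u \<and> u \<le> real (Suc (J u)) * h" by metis
  have "bij_betw J {u\<in>U. u \<le> real k * h} {j. j < k \<and> (\<exists>u\<in>U. real j * h < u \<and> u \<le> real (Suc j) * h)}"
  proof (rule bij_betwI')
    fix u v assume u: "u \<in> {u\<in>U. u \<le> real k * h}" and v: "v \<in> {u\<in>U. u \<le> real k * h}"
    have "\<not> u < v" if "u \<in> U" "v \<in> U" "J u = J v" for u v
    proof
      assume "u < v"
      then have "h < v - u" using gap that by auto
      moreover have "real (J v) * h < u" "v \<le> real (Suc (J v)) * h" using J[of u] J[of v] that by auto
      ultimately show False by (simp add: algebra_simps)
    qed
    then show "J u = J v \<longleftrightarrow> u = v" using u v by (metis (no_types, lifting) linorder_neqE mem_Collect_eq)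
  next
    fix u assume u: "u \<in> {u\<in>U. u \<le> real k * h}"
    then have Ju: "real (J u) * h < u" "u \<le> real (Suc (J u)) * h" using J by auto
    have "real (J u) * h < real k * h" using Ju u by simp
    then have "J u < k" using h by simp
    then show "J u \<in> {j. j < k \<and> (\<exists>u\<in>U. real j * h < u \<and> u \<le> real (Suc j) * h)}" using Ju u by auto
  next
    fix j assume "j \<in> {j. j < k \<and> (\<exists>u\<in>U. real j * h < u \<and> u \<le> real (Suc j) * h)}"
    then obtain u where u: "j < k" "u \<in> U" "real j * h < u" "u \<le> real (Suc j) * h" by auto
    have "real (Suc j) * h \<le> real k * h" using u h by (intro mult_right_mono) auto
    moreover have "j = J u" using mesh_cell_unique[OF h] J[OF u(2)] u by blast
    ultimately show "\<exists>x\<in>{u \<in> U. u \<le> real k * h}. j = J x" using u by (intro bexI[of _ u]) auto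
  qed
  then show ?thesis by (rule bij_betw_same_card[symmetric])
qed

lemma eventually_dyadic_mesh_less:
  fixes T e :: real assumes "0 < e" shows "\<forall>\<^sub>F m in sequentially. T / 2 ^ m < e"
proof -
  have "(\<lambda>m. T * (1 / 2) ^ m) \<longlonglongrightarrow> T * 0" by (intro tendsto_intros LIMSEQ_power_zero) auto
  then have "\<forall>\<^sub>F m in sequentially. T * (1 / 2) ^ m < e" using assms by (intro order_tendstoD(2)[where y = "T * 0"]) auto
  then show ?thesis by (simp add: power_divide)
qed

lemma eventually_card_mesh_cells:
  fixes U :: "real set" and T :: real
  assumes T: "0 < T" and U: "finite U" "U \<subseteq> {0<..}"
  shows "\<forall>\<^sub>F m in sequentially. \<forall>k. card {j. j < k \<and> (\<exists>u\<in>U. real j * (T / 2 ^ m) < u \<and> u \<le> real (Suc j) * (T / 2 ^ m))}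
    = card {u\<in>U. u \<le> real k * (T / 2 ^ m)}"
proof -
  \<comment> \<open>The gaps of \<open>U\<close>, together with 1 to keep the set nonempty when
    \<open>U\<close> has fewer than two elements.\<close>
  define A where "A = insert 1 ((\<lambda>(u, v). v - u) ` {(u, v). u \<in> U \<and> v \<in> U \<and> u < v})"
  have "finite {(u, v). u \<in> U \<and> v \<in> U \<and> u < v}" by (rule finite_subset[of _ "U \<times> U"]) (use U in auto)
  then have A: "finite A" "A \<noteq> {}" by (auto simp: A_def)
  have "0 < Min A" using A by (subst Min_gr_iff) (auto simp: A_def)
  then have "\<forall>\<^sub>F m in sequentially. T / 2 ^ m < Min A" by (rule eventually_dyadic_mesh_less)
  then show ?thesis
  proof eventually_elim
    case (elim m)
    have "T / 2 ^ m < v - u" if "u \<in> U" "v \<in> U" "u < v" for u v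
    proof -
      have "Min A \<le> v - u" using that A by (intro Min_le) (auto simp: A_def image_iff)
      then show ?thesis using elim by simp
    qed
    then show ?case using T U by (intro allI card_mesh_cells) auto
  qed
qed

context increasing_path begin

text \<open>Right continuity makes the infimum of the times at which the path is at or above
  \<open>x\<close> attained.\<close>

lemma first_passage:
  assumes x: "s 0 < x" "x \<le> s T" and T: "0 \<le> T"
  obtains u where "0 < u" "u \<le> T" "x \<le> s u" "\<And>v. 0 \<le> v \<Longrightarrow> v < u \<Longrightarrow> s v < x"
proof -
  define A where "A = {u. 0 \<le> u \<and> x \<le> s u}"
  define u where "u = Inf A"
  have TA: "T \<in> A" using x T by (simp add: A_def)
  have bdd: "bdd_below A" by (rule bdd_belowI[of _ 0]) (auto simp: A_def)
  have u0: "0 \<le> u" unfolding u_def using TA by (intro cInf_greatest) (auto simp: A_def)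
  have uT: "u \<le> T" unfolding u_def using TA bdd by (rule cInf_lower)
  have less: "s v < x" if "0 \<le> v" "v < u" for v
  proof (rule ccontr)
    assume "\<not> s v < x"
    then have "u \<le> v" unfolding u_def using that bdd by (intro cInf_lower) (auto simp: A_def)
    then show False using that by simp
  qed
  have xu: "x \<le> s u"
  proof (rule ccontr)
    assume "\<not> x \<le> s u"
    then have "s u < x" by simp
    with right_cont[OF u0] have "\<forall>\<^sub>F v in at_right u. s v < x" by (rule order_tendstoD)
    then obtain b where b: "u < b" "\<And>v. u < v \<Longrightarrow> v < b \<Longrightarrow> s v < x" by (auto simp: eventually_at_right_field)
    have "b \<le> u" unfolding u_def
    proof (rule cInf_greatest)
      fix v assume v: "v \<in> A"
      show "b \<le> v"
      proof (rule ccontr)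
        assume "\<not> b \<le> v"
        then have "s v < x" using b(2)[of v] less[of v] v \<open>s u < x\<close> by (cases v u rule: linorder_cases) (auto simp: A_def)
        then show False using v by (simp add: A_def)
      qed
    qed (use TA in auto)
    then show False using b by simp
  qed
  have "0 < u" using u0 xu x by (cases "u = 0") auto
  then show thesis using that uT xu less by blast
qed

text \<open>A point in no open jump interval is either the left limit or the value of the path at
  its first passage time. For a fine mesh it then lies within \<open>\<delta>\<close> of one end of
  the range of its cell, and the Poisson process hits such end pieces with small
  probability.\<close>

lemma exceptional_point_near_mesh:
  assumes x: "s 0 < x" "x \<le> s T" and T: "0 < T" and \<delta>: "0 < \<delta>"
    and no: "\<And>t. 0 \<le> t \<Longrightarrow> \<not> (left_lim s t < x \<and> x < s t)"
  shows "\<forall>\<^sub>F m in sequentially. \<exists>j<2^m. let a = s (real j * (T / 2 ^ m)); b = s (real (Suc j) * (T / 2 ^ m))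
    in (a < x \<and> x \<le> min (a + \<delta>) b) \<or> (max (b - \<delta>) a < x \<and> x \<le> b)"
proof -
  obtain u where u: "0 < u" "u \<le> T" "x \<le> s u" and less: "\<And>v. 0 \<le> v \<Longrightarrow> v < u \<Longrightarrow> s v < x"
    using first_passage[OF x] T by auto
  have "left_lim s u \<le> x" using u less by (intro left_lim_le_bound) (auto intro: less_imp_le)
  \<comment> \<open>The point lies between left limit and value at \<open>u\<close>; that both
    inequalities are strict is what \<open>no\<close> excludes.\<close>
  then have cases: "left_lim s u = x \<or> s u = x" using no[of u] u by auto
  have "\<exists>e>0. \<forall>v w. 0 \<le> v \<longrightarrow> v < u \<longrightarrow> u \<le> w \<longrightarrow> u - v < e \<longrightarrow> w - u < e \<longrightarrow> x \<le> s v + \<delta> \<or> s w - \<delta> < x"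
    using cases
  proof
    assume "left_lim s u = x"
    then have "\<forall>\<^sub>F v in at_left u. x - \<delta> < s v" using left_lim_tendsto[OF u(1)] \<delta> by (intro order_tendstoD) auto
    then obtain b where b: "b < u" "\<And>v. b < v \<Longrightarrow> v < u \<Longrightarrow> x - \<delta> < s v" by (auto simp: eventually_at_left_field)
    show ?thesis
    proof (intro exI[of _ "u - b"] conjI allI impI disjI1)
      fix v w assume "u - v < u - b" "v < u"
      then show "x \<le> s v + \<delta>" using b(2)[of v] by simp
    qed (use b in simp)
  next
    assume su: "s u = x"
    then have "\<forall>\<^sub>F v in at_right u. s v < x + \<delta>" using right_cont[of u] u \<delta> by (intro order_tendstoD) auto
    then obtain b where b: "u < b" "\<And>v. u < v \<Longrightarrow> v < b \<Longrightarrow> s v < x + \<delta>" by (auto simp: eventually_at_right_field)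
    show ?thesis
    proof (intro exI[of _ "b - u"] conjI allI impI disjI2)
      fix v w assume "w - u < b - u" "u \<le> w"
      then show "s w - \<delta> < x" using b(2)[of w] su \<delta> by (cases "w = u") auto
    qed (use b in simp)
  qed
  then obtain e where e: "0 < e" and near: "\<And>v w. 0 \<le> v \<Longrightarrow> v < u \<Longrightarrow> u \<le> w \<Longrightarrow> u - v < e \<Longrightarrow> w - u < e \<Longrightarrow> x \<le> s v + \<delta> \<or> s w - \<delta> < x"
    by blast
  show ?thesis using eventually_dyadic_mesh_less[OF e, of T]
  proof eventually_elim
    case (elim m)
    define h where "h = T / 2 ^ m"
    have h: "0 < h" "h < e" using T elim by (auto simp: h_def)
    obtain j where j: "real j * h < u" "u \<le> real (Suc j) * h" using mesh_cell_exists[OF h(1) u(1)] by blast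
    have "real j * h < T" using j u by simp
    then have "real j * h < 2 ^ m * h" by (simp add: h_def)
    then have "real j < real (2 ^ m)" using h by simp
    then have jm: "j < 2 ^ m" using of_nat_less_iff by blast
    have d: "real (Suc j) * h - real j * h = h" by (simp add: algebra_simps)
    have j0: "0 \<le> real j * h" using h by simp
    have "x \<le> s (real j * h) + \<delta> \<or> s (real (Suc j) * h) - \<delta> < x"
      by (rule near[OF j0 j(1) j(2)]) (use d h j in linarith)+
    moreover have "s (real j * h) < x" using less[OF j0 j(1)] .
    moreover have "x \<le> s (real (Suc j) * h)" using u monoD[of u "real (Suc j) * h"] j by simp
    ultimately show ?case unfolding h_def[symmetric] Let_def using jm by (intro exI[of _ j]) auto
  qed
qed

text \<open>Each point up to level \<open>s T\<close> belongs to a jump, and the jump time lies in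
  the mesh cell over which the path crosses the point. So the hit cells are the cells that contain a
  hit time, and these are counted exactly once the mesh separates the hit times.\<close>

lemma mesh_count_eq_jump_count:
  assumes T: "0 < T" and X: "finite X" "\<And>x. x \<in> X \<Longrightarrow> s 0 < x"
    and yes: "\<And>x. x \<in> X \<Longrightarrow> x \<le> s T \<Longrightarrow> \<exists>t\<ge>0. left_lim s t < x \<and> x < s t"
  shows "\<forall>\<^sub>F m in sequentially. \<forall>k\<le>2^m.
    card {j. j < k \<and> (\<exists>x\<in>X. s (real j * (T / 2 ^ m)) < x \<and> x \<le> s (real (Suc j) * (T / 2 ^ m)))}
    = card {t \<in> {0..real k * (T / 2 ^ m)}. hit_at s X t}"
proof -
  define U where "U = {t \<in> {0..T}. hit_at s X t}"
  have "finite U" by (rule finite_subset[OF _ finite_hits[OF X(1)]]) (auto simp: U_def)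
  moreover have "U \<subseteq> {0<..}" using hit_at_pos by (auto simp: U_def)
  ultimately have "\<forall>\<^sub>F m in sequentially. \<forall>k. card {j. j < k \<and> (\<exists>u\<in>U. real j * (T / 2 ^ m) < u \<and> u \<le> real (Suc j) * (T / 2 ^ m))}
    = card {u\<in>U. u \<le> real k * (T / 2 ^ m)}" by (rule eventually_card_mesh_cells[OF T])
  then show ?thesis
  proof eventually_elim
    case (elim m)
    show ?case
    proof (intro allI impI)
      fix k :: nat assume k: "k \<le> 2 ^ m"
      define h where "h = T / 2 ^ m"
      have h: "0 < h" using T by (simp add: h_def)
      have T_eq: "T = 2 ^ m * h" by (simp add: h_def)
      have kT: "real i * h \<le> T" if "i \<le> k" for i
      proof -
        have "real i \<le> real (2 ^ m)" using that k by (intro of_nat_mono) simp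
        then show ?thesis unfolding T_eq using h by (intro mult_right_mono) auto
      qed
      have iff: "(\<exists>x\<in>X. s (real j * h) < x \<and> x \<le> s (real (Suc j) * h)) \<longleftrightarrow>
          (\<exists>u\<in>U. real j * h < u \<and> u \<le> real (Suc j) * h)" if j: "j < k" for j
      proof
        have j0: "0 \<le> real j * h" "0 \<le> real (Suc j) * h" using h by auto
        have jT: "real (Suc j) * h \<le> T" using kT[of "Suc j"] j by simp
        assume "\<exists>x\<in>X. s (real j * h) < x \<and> x \<le> s (real (Suc j) * h)"
        then obtain x where x: "x \<in> X" "s (real j * h) < x" "x \<le> s (real (Suc j) * h)" by blast
        then have "x \<le> s T" using monoD[OF j0(2) jT] by simp
        then obtain u where u: "0 \<le> u" "left_lim s u < x" "x < s u" using yes x by blast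
        have 1: "real j * h < u" using monoD[OF u(1), of "real j * h"] u x by (cases "real j * h < u") auto
        have 2: "u \<le> real (Suc j) * h" using le_left_lim[OF j0(2), of u] u x by (cases "u \<le> real (Suc j) * h") auto
        have "u \<in> U" using u x 2 jT by (auto simp: U_def hit_at_def)
        then show "\<exists>u\<in>U. real j * h < u \<and> u \<le> real (Suc j) * h" using 1 2 by blast
      next
        assume "\<exists>u\<in>U. real j * h < u \<and> u \<le> real (Suc j) * h"
        then obtain u where u: "u \<in> U" "real j * h < u" "u \<le> real (Suc j) * h" by blast
        then obtain x where x: "x \<in> X" "left_lim s u < x" "x < s u" by (auto simp: U_def hit_at_def)
        have "s (real j * h) \<le> left_lim s u" using u h by (intro le_left_lim) auto
        moreover have "s u \<le> s (real (Suc j) * h)" using u by (intro monoD) (auto simp: U_def)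
        ultimately have "s (real j * h) < x" "x \<le> s (real (Suc j) * h)" using x by linarith+
        then show "\<exists>x\<in>X. s (real j * h) < x \<and> x \<le> s (real (Suc j) * h)" using x by blast
      qed
      have "{j. j < k \<and> (\<exists>x\<in>X. s (real j * h) < x \<and> x \<le> s (real (Suc j) * h))}
        = {j. j < k \<and> (\<exists>u\<in>U. real j * h < u \<and> u \<le> real (Suc j) * h)}" using iff by blast
      moreover have "{t \<in> {0..real k * h}. hit_at s X t} = {u\<in>U. u \<le> real k * h}"
        using kT[of k] by (auto simp: U_def)
      ultimately show "card {j. j < k \<and> (\<exists>x\<in>X. s (real j * (T / 2 ^ m)) < x \<and> x \<le> s (real (Suc j) * (T / 2 ^ m)))}
        = card {t \<in> {0..real k * (T / 2 ^ m)}. hit_at s X t}"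
        using elim[rule_format, of k] unfolding h_def by simp
    qed
  qed
qed

text \<open>Only countably many operations occur on the right, which gives measurability of the left.\<close>

lemma hit_in_interval_iff:
  assumes ab: "0 \<le> a" "a < b"
  shows "(\<exists>t. a < t \<and> t \<le> b \<and> hit_at s X t) \<longleftrightarrow>
    (\<exists>p q r :: rat. q < r \<and> (\<exists>x\<in>X. of_rat p < x \<and> x \<le> of_rat q) \<and>
      (\<forall>m::nat. \<exists>k<2^m. s (a + real k * ((b - a) / 2 ^ m)) \<le> of_rat p \<and>
         of_rat r \<le> s (a + real (Suc k) * ((b - a) / 2 ^ m))))"
    (is "?L \<longleftrightarrow> ?R")
proof
  assume ?L
  then obtain t x where t: "a < t" "t \<le> b" and x: "x \<in> X" "left_lim s t < x" "x < s t"
    by (auto simp: hit_at_def)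
  \<comment> \<open>\<open>p\<close> and \<open>q\<close> enclose the point, and \<open>r\<close>
    leaves a gap above \<open>q\<close> inside the jump, from which the converse direction regains
    strict inequalities.\<close>
  obtain p :: rat where p: "left_lim s t < of_rat p" "of_rat p < x" using of_rat_dense[OF x(2)] by blast
  obtain q :: rat where q: "x < of_rat q" "of_rat q < s t" using of_rat_dense[OF x(3)] by blast
  obtain r :: rat where r: "of_rat q < (of_rat r :: real)" "of_rat r < s t" using of_rat_dense[OF q(2)] by blast
  have "\<exists>k<2^m. s (a + real k * ((b - a) / 2 ^ m)) \<le> of_rat p \<and>
         of_rat r \<le> s (a + real (Suc k) * ((b - a) / 2 ^ m))" for m :: nat
  proof -
    define h where "h = (b - a) / 2 ^ m"
    have h: "0 < h" using ab by (simp add: h_def)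
    obtain k where k: "real k * h < t - a" "t - a \<le> real (Suc k) * h" using mesh_cell_exists[OF h, of "t - a"] t by auto
    have "real k * h < b - a" using k t by linarith
    then have "real k * h < 2 ^ m * h" by (simp add: h_def)
    then have "real k < real (2 ^ m)" using h by simp
    then have km: "k < 2 ^ m" using of_nat_less_iff by blast
    have "s (a + real k * h) \<le> left_lim s t" using k ab h by (intro le_left_lim) auto
    moreover have "s t \<le> s (a + real (Suc k) * h)" using k ab t by (intro monoD) auto
    ultimately have "s (a + real k * h) \<le> of_rat p" "of_rat r \<le> s (a + real (Suc k) * h)"
      using p r by linarith+
    then show ?thesis unfolding h_def[symmetric] using km by blast
  qed
  moreover have "\<exists>x\<in>X. of_rat p < x \<and> x \<le> of_rat q" using x p q by (intro bexI[of _ x]) auto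
  moreover have "q < r" using r by (simp add: of_rat_less)
  ultimately show ?R by blast
next
  assume ?R
  then obtain p q r :: rat and x where qr: "q < r" and x: "x \<in> X" "of_rat p < x" "x \<le> of_rat q"
    and cell: "\<And>m::nat. \<exists>k<2^m. s (a + real k * ((b - a) / 2 ^ m)) \<le> of_rat p \<and>
         of_rat r \<le> s (a + real (Suc k) * ((b - a) / 2 ^ m))" by blast
  have qr': "of_rat q < (of_rat r :: real)" using qr by (simp add: of_rat_less)
  from cell[of 0] have sa: "s a \<le> of_rat p" and sb: "of_rat r \<le> s b" by auto
  have "s 0 \<le> s a" using ab by (intro monoD) auto
  then have s0: "s 0 < of_rat r" using sa x qr' by linarith
  obtain u where u: "0 < u" "u \<le> b" "of_rat r \<le> s u" and less: "\<And>v. 0 \<le> v \<Longrightarrow> v < u \<Longrightarrow> s v < of_rat r"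
    using first_passage[OF s0 sb] ab by auto
  have au: "a < u"
  proof (rule ccontr)
    assume "\<not> a < u"
    then have "s u \<le> s a" using u by (intro monoD) auto
    then show False using u sa x qr' by linarith
  qed
  \<comment> \<open>Every mesh has a cell across which the path climbs from at most \<open>p\<close>
    to at least \<open>r\<close>. As level \<open>r\<close> is first reached at \<open>u\<close>,
    this cell ends no earlier than \<open>u\<close>; for a fine mesh it starts no earlier than any
    given \<open>v < u\<close>.\<close>
  have "left_lim s u \<le> of_rat p"
  proof (rule left_lim_le_bound[OF u(1)])
    fix v assume v: "0 \<le> v" "v < u"
    have "\<exists>m. (b - a) / 2 ^ m < u - v"
      using eventually_dyadic_mesh_less[of "u - v" "b - a"] v by (auto dest: eventually_happens)
    then obtain m where m: "(b - a) / 2 ^ m < u - v" by blast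
    define h where "h = (b - a) / 2 ^ m"
    have h: "0 < h" using ab by (simp add: h_def)
    obtain k where k: "s (a + real k * h) \<le> of_rat p" "of_rat r \<le> s (a + real (Suc k) * h)"
      using cell[of m] unfolding h_def by blast
    have "0 \<le> a + real (Suc k) * h" using ab h by simp
    then have "u \<le> a + real (Suc k) * h" using less[of "a + real (Suc k) * h"] k by (meson leD not_le)
    then have "v \<le> a + real k * h" using m unfolding h_def[symmetric] by (simp add: algebra_simps)
    then have "s v \<le> s (a + real k * h)" using v by (intro monoD)
    then show "s v \<le> of_rat p" using k by linarith
  qed
  then have "left_lim s u < x" "x < s u" using x u qr' by linarith+
  then have "hit_at s X u" using x by (auto simp: hit_at_def)
  then show ?L using au u by blast
qed

end

section \<open>Counting process and compensator\<close>

context sieved_subordinator begin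

lemma path: "\<omega> \<in> space M \<Longrightarrow> increasing_path (\<lambda>t. S t \<omega>)"
  using sub by (simp add: increasing_path_def subordinator_def)

lemma K_count_eq: "K_count S \<xi> T \<omega> = card {t \<in> {0..T}. hit_at (\<lambda>t. S t \<omega>) (\<xi> \<omega>) t}"
  by (simp add: K_count_def hit_at_def)

lemma finite_hit_times: "\<omega> \<in> space M \<Longrightarrow> finite {t \<in> {0..T}. hit_at (\<lambda>t. S t \<omega>) (\<xi> \<omega>) t}"
  by (rule finite_subset[OF _ increasing_path.finite_hits[OF path \<xi>_finite]]) auto

lemma K_count_mono: "\<omega> \<in> space M \<Longrightarrow> t \<le> u \<Longrightarrow> K_count S \<xi> t \<omega> \<le> K_count S \<xi> u \<omega>"
  unfolding K_count_eq by (intro card_mono finite_hit_times) auto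

lemma hit_times_pos: "\<omega> \<in> space M \<Longrightarrow> 0 \<le> t \<Longrightarrow> hit_at (\<lambda>t. S t \<omega>) (\<xi> \<omega>) t \<Longrightarrow> 0 < t"
  by (rule increasing_path.hit_at_pos[OF path])

lemma K_count_zero: "\<omega> \<in> space M \<Longrightarrow> K_count S \<xi> 0 \<omega> = 0"
proof -
  assume "\<omega> \<in> space M"
  then have "{t \<in> {0..0}. hit_at (\<lambda>t. S t \<omega>) (\<xi> \<omega>) t} = {}" using hit_times_pos by force
  then show ?thesis by (simp only: K_count_eq card.empty)
qed

lemma hit_in_interval_pred:
  assumes ab: "0 \<le> a" "a < b"
  shows "Measurable.pred M (\<lambda>\<omega>. \<exists>t. a < t \<and> t \<le> b \<and> hit_at (\<lambda>t. S t \<omega>) (\<xi> \<omega>) t)"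
proof -
  have [measurable]: "Measurable.pred M (\<lambda>\<omega>. hits \<omega> c d)" for c d by (rule hits_pred)
  have [measurable]: "S (a + real k * ((b - a) / 2 ^ m)) \<in> borel_measurable M" for k m
    using ab by (intro S_measurable) auto
  have "Measurable.pred M (\<lambda>\<omega>. \<exists>p q r :: rat. q < r \<and> hits \<omega> (of_rat p) (of_rat q) \<and>
      (\<forall>m::nat. \<exists>k<2^m. S (a + real k * ((b - a) / 2 ^ m)) \<omega> \<le> of_rat p \<and>
         of_rat r \<le> S (a + real (Suc k) * ((b - a) / 2 ^ m)) \<omega>))"
    by measurable
  also have "?this \<longleftrightarrow> ?thesis"
    by (intro measurable_cong) (simp only: increasing_path.hit_in_interval_iff[OF path ab] hits_def)
  finally show ?thesis .
qed

lemma sum_of_bool_card: fixes k :: nat shows "(\<Sum>j<k. of_bool (P j) :: real) = real (card {j. j < k \<and> P j})"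
proof -
  have "(\<Sum>j<k. of_bool (P j) :: real) = (\<Sum>j\<in>{j\<in>{..<k}. P j}. 1)"
    using sum.inter_filter[OF finite_lessThan, where g = "\<lambda>_. 1 :: real" and P = P] by (simp add: of_bool_def)
  also have "{j\<in>{..<k}. P j} = {j. j < k \<and> P j}" by auto
  finally show ?thesis by simp
qed

text \<open>For fine meshes the finitely many hit times fall into different cells, so the count is
  the pointwise limit of the numbers of cells containing a hit time.\<close>

lemma K_count_measurable:
  assumes T: "0 \<le> T" shows "(\<lambda>\<omega>. real (K_count S \<xi> T \<omega>)) \<in> borel_measurable M"
proof (cases "T = 0")
  case True
  then show ?thesis using K_count_zero by (subst measurable_cong[where g = "\<lambda>_. 0"]) auto
next
  case False
  then have T: "0 < T" using T by simp
  define c where "c m \<omega> = (\<Sum>j<2^m. of_bool (\<exists>t. real j * (T / 2 ^ m) < t \<and> t \<le> real (Suc j) * (T / 2 ^ m) \<and>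
      hit_at (\<lambda>t. S t \<omega>) (\<xi> \<omega>) t) :: real)" for m :: nat and \<omega>
  show ?thesis
  proof (rule borel_measurable_LIMSEQ_real)
    show "c m \<in> borel_measurable M" for m
    proof -
      have [measurable]: "Measurable.pred M (\<lambda>\<omega>. \<exists>t. real j * (T / 2 ^ m) < t \<and> t \<le> real (Suc j) * (T / 2 ^ m) \<and>
        hit_at (\<lambda>t. S t \<omega>) (\<xi> \<omega>) t)" for j
        using T by (intro hit_in_interval_pred mult_strict_right_mono) auto
      show ?thesis unfolding c_def[abs_def] by measurable
    qed
    fix \<omega> assume \<omega>: "\<omega> \<in> space M"
    define U where "U = {t \<in> {0..T}. hit_at (\<lambda>t. S t \<omega>) (\<xi> \<omega>) t}"
    have U: "finite U" "U \<subseteq> {0<..}" using finite_hit_times[OF \<omega>] hit_times_pos[OF \<omega>] by (auto simp: U_def)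
    have "\<forall>\<^sub>F m in sequentially. c m \<omega> = real (K_count S \<xi> T \<omega>)"
      using eventually_card_mesh_cells[OF T U]
    proof eventually_elim
      case (elim m)
      have Tm: "real (2 ^ m) * (T / 2 ^ m) = T" by simp
      have "(\<exists>t. real j * (T / 2 ^ m) < t \<and> t \<le> real (Suc j) * (T / 2 ^ m) \<and> hit_at (\<lambda>t. S t \<omega>) (\<xi> \<omega>) t)
        \<longleftrightarrow> (\<exists>u\<in>U. real j * (T / 2 ^ m) < u \<and> u \<le> real (Suc j) * (T / 2 ^ m))" if j: "j < 2 ^ m" for j
      proof -
        have "0 \<le> real j * (T / 2 ^ m)" using T by simp
        moreover have "real (Suc j) * (T / 2 ^ m) \<le> real (2 ^ m) * (T / 2 ^ m)"
          using j T by (intro mult_right_mono of_nat_mono) auto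
        ultimately have "t \<in> {0..T}" if "real j * (T / 2 ^ m) < t" "t \<le> real (Suc j) * (T / 2 ^ m)" for t
          using that unfolding Tm by auto
        then show ?thesis unfolding U_def by blast
      qed
      then have "c m \<omega> = (\<Sum>j<2^m. of_bool (\<exists>u\<in>U. real j * (T / 2 ^ m) < u \<and> u \<le> real (Suc j) * (T / 2 ^ m)))"
        unfolding c_def by (intro sum.cong arg_cong[where f = of_bool]) auto
      also have "\<dots> = real (card {u\<in>U. u \<le> real (2 ^ m) * (T / 2 ^ m)})"
        unfolding sum_of_bool_card using elim[rule_format, of "2^m"] by (simp only:)
      also have "{u\<in>U. u \<le> real (2 ^ m) * (T / 2 ^ m)} = U" unfolding Tm by (auto simp: U_def)
      finally show ?case by (simp add: K_count_eq U_def)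
    qed
    then show "(\<lambda>m. c m \<omega>) \<longlonglongrightarrow> real (K_count S \<xi> T \<omega>)" by (rule tendsto_eventually)
  qed
qed

text \<open>Two outcomes, because \<open>fubini_diagonal\<close> takes the points from the first and
  the path from the second. On the diagonal and for fine meshes the event captures the exceptional
  points.\<close>

definition near_mesh :: "real \<Rightarrow> real \<Rightarrow> nat \<Rightarrow> 'a \<Rightarrow> 'a \<Rightarrow> bool" where
  "near_mesh \<delta> h N \<omega>1 \<omega>2 \<longleftrightarrow> (\<exists>j<N. let a = S (real j * h) \<omega>2; b = S (real (Suc j) * h) \<omega>2
    in hits \<omega>1 a (min (a + \<delta>) b) \<or> hits \<omega>1 (max (b - \<delta>) a) b)"

text \<open>\<open>min 1 y\<close> is at most twice \<open>1 - exp (- y)\<close>. With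
  \<open>y = r * x\<close> this bounds the truncated increment by a Laplace transform, and
  \<open>psi \<nu> r / r\<close> is small for large \<open>r\<close> by sublinearity.\<close>

lemma expectation_min_increment:
  assumes t: "0 \<le> t" and h: "0 \<le> h" and r: "0 < r"
  shows "integrable M (\<lambda>\<omega>. min (1 / r) (S (t + h) \<omega> - S t \<omega>))"
    and "expectation (\<lambda>\<omega>. min (1 / r) (S (t + h) \<omega> - S t \<omega>)) \<le> 2 * h * (psi \<nu> r / r)"
proof -
  have [measurable]: "S t \<in> borel_measurable M" "S (t + h) \<in> borel_measurable M" "S h \<in> borel_measurable M"
    using assms by auto
  define I where "I \<omega> = S (t + h) \<omega> - S t \<omega>" for \<omega>
  have I0: "0 \<le> I \<omega>" if "\<omega> \<in> space M" for \<omega> using S_mono[OF that t, of "t + h"] h by (simp add: I_def)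
  have [measurable]: "I \<in> borel_measurable M" unfolding I_def[abs_def] by measurable
  show int: "integrable M (\<lambda>\<omega>. min (1 / r) (S (t + h) \<omega> - S t \<omega>))"
    unfolding I_def[symmetric]
    by (rule integrable_const_bound[where B = "1 / r"]) (use I0 r in \<open>auto intro!: AE_I2\<close>)
  have int2: "integrable M (\<lambda>\<omega>. exp (- r * I \<omega>))"
    by (rule integrable_const_bound[where B = 1]) (use I0 r in \<open>auto intro!: AE_I2\<close>)
  have "min (1 / r) x \<le> 2 / r * (1 - exp (- r * x))" if x: "0 \<le> x" for x
  proof -
    define y where "y = r * x"
    have y: "0 \<le> y" using r x by (simp add: y_def)
    have "min 1 y \<le> 2 * (1 - exp (- y))"
    proof (cases "y \<le> 1")
      case True
      have "y\<^sup>2 \<le> y" using y True by (simp add: power2_eq_square mult_left_le)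
      then show ?thesis using one_minus_exp_ge[OF y] True by simp
    next
      case False
      then have "2 \<le> exp y" using exp_ge_add_one_self[of y] by linarith
      then have "exp (- y) \<le> 1 / 2" by (simp add: exp_minus field_simps)
      then show ?thesis using False by simp
    qed
    moreover have "min (1 / r) x = min 1 y / r" using r by (auto simp: y_def min_def field_simps)
    ultimately show ?thesis using r by (simp add: y_def field_simps)
  qed
  then have "expectation (\<lambda>\<omega>. min (1 / r) (I \<omega>)) \<le> expectation (\<lambda>\<omega>. 2 / r * (1 - exp (- r * I \<omega>)))"
    using I0 int int2 by (intro integral_mono) (auto simp: I_def)
  also have "\<dots> = 2 / r * (1 - expectation (\<lambda>\<omega>. exp (- r * I \<omega>)))"
    using int2 by (simp add: prob_space)
  also have "expectation (\<lambda>\<omega>. exp (- r * I \<omega>)) = expectation (\<lambda>\<omega>. exp (- r * S h \<omega>))"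
    unfolding I_def by (rule expectation_cong_distr[OF increment_distr[OF t h], where f = "\<lambda>x. exp (- r * x)"]) measurable
  also have "\<dots> = exp (- (h * psi \<nu> r))" using laplace[OF h, of r] r by simp
  also have "2 / r * (1 - exp (- (h * psi \<nu> r))) \<le> 2 / r * (h * psi \<nu> r)"
    using r by (intro mult_left_mono one_minus_exp_le) auto
  finally show "expectation (\<lambda>\<omega>. min (1 / r) (S (t + h) \<omega> - S t \<omega>)) \<le> 2 * h * (psi \<nu> r / r)"
    by (simp add: I_def mult_ac)
qed

text \<open>Each cell contributes two end pieces no longer than the truncated increment, and a piece
  is hit with probability at most \<open>n\<close> times its length. The mesh enters the bound only
  through \<open>real N * h\<close>, so all meshes of one time interval share the same
  bound.\<close>

lemma prob_near_mesh:
  assumes h: "0 \<le> h" and r: "0 < r"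
  shows "prob {\<omega>\<in>space M. near_mesh (1 / r) h N \<omega> \<omega>} \<le> 4 * n * (real N * h) * (psi \<nu> r / r)"
    and "{\<omega>\<in>space M. near_mesh (1 / r) h N \<omega> \<omega>} \<in> events"
proof -
  define \<delta> where "\<delta> = 1 / r"
  have \<delta>: "0 < \<delta>" using r by (simp add: \<delta>_def)
  define s where "s j \<omega> = S (real j * h) \<omega>" for j \<omega>
  have tj: "0 \<le> real j * h" for j using h by simp
  have ts: "real (Suc j) * h = real j * h + h" for j by (simp add: algebra_simps)
  define Q where "Q = {p \<in> space (M1 \<Otimes>\<^sub>M M2). near_mesh \<delta> h N (fst p) (snd p)}"
  have sm [measurable]: "(\<lambda>p. s j (snd p)) \<in> borel_measurable (M1 \<Otimes>\<^sub>M M2)" for j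
    unfolding s_def by (rule measurable_compose[OF measurable_snd S_M2[OF tj]])
  have [measurable]: "Measurable.pred (M1 \<Otimes>\<^sub>M M2) (\<lambda>p. hits (fst p) (s j (snd p)) (min (s j (snd p) + \<delta>) (s (Suc j) (snd p))))" for j
    by (rule hits_measurable; measurable)
  have [measurable]: "Measurable.pred (M1 \<Otimes>\<^sub>M M2) (\<lambda>p. hits (fst p) (max (s (Suc j) (snd p) - \<delta>) (s j (snd p))) (s (Suc j) (snd p)))" for j
    by (rule hits_measurable; measurable)
  have Q: "Q \<in> sets (M1 \<Otimes>\<^sub>M M2)" unfolding Q_def near_mesh_def Let_def s_def[symmetric] by measurable
  have spQ: "(\<omega>1, \<omega>2) \<in> space (M1 \<Otimes>\<^sub>M M2)" if "\<omega>1 \<in> space M" "\<omega>2 \<in> space M" for \<omega>1 \<omega>2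
    using that by (simp add: space_pair_measure)
  have eqQ: "{\<omega>\<in>space M. (\<omega>, \<omega>) \<in> Q} = {\<omega>\<in>space M. near_mesh \<delta> h N \<omega> \<omega>}"
    unfolding Q_def using spQ by auto
  have "(\<lambda>\<omega>. (\<omega>, \<omega>)) -` Q \<inter> space M \<in> events" by (rule measurable_sets[OF diagonal_measurable Q])
  then show "{\<omega>\<in>space M. near_mesh (1 / r) h N \<omega> \<omega>} \<in> events"
    unfolding eqQ[symmetric] \<delta>_def[symmetric] by (simp add: vimage_def Int_def conj_commute)
  define b where "b \<omega> = (\<Sum>j<N. 2 * n * min \<delta> (s (Suc j) \<omega> - s j \<omega>))" for \<omega>
  have ib: "integrable M b"
    unfolding b_def[abs_def] s_def ts \<delta>_def
    using h r by (intro Bochner_Integration.integrable_sum integrable_mult_right expectation_min_increment(1)) auto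
  have eb: "expectation b \<le> 4 * n * (real N * h) * (psi \<nu> r / r)"
  proof -
    have "expectation b = (\<Sum>j<N. 2 * n * expectation (\<lambda>\<omega>. min \<delta> (s (Suc j) \<omega> - s j \<omega>)))"
      unfolding b_def[abs_def] s_def ts \<delta>_def
      using h r by (subst Bochner_Integration.integral_sum) (auto intro!: expectation_min_increment(1))
    also have "\<dots> \<le> (\<Sum>j<N. 2 * n * (2 * h * (psi \<nu> r / r)))"
      unfolding s_def ts \<delta>_def using h r n_pos by (intro sum_mono mult_left_mono expectation_min_increment(2)) auto
    finally show ?thesis by (simp add: mult_ac)
  qed
  have "prob {\<omega>\<in>space M. (\<omega>, \<omega>) \<in> Q} \<le> expectation b"
  proof (rule fubini_diagonal_le[OF Q ib])
    fix \<omega>2 assume \<omega>2: "\<omega>2 \<in> space M"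
    have s0: "0 \<le> s j \<omega>2" for j unfolding s_def by (rule S_nonneg[OF \<omega>2 tj])
    have sle: "s j \<omega>2 \<le> s (Suc j) \<omega>2" for j
      unfolding s_def using h by (intro S_mono[OF \<omega>2 tj] mult_right_mono) auto
    define A where "A j = {\<omega>\<in>space M. hits \<omega> (s j \<omega>2) (min (s j \<omega>2 + \<delta>) (s (Suc j) \<omega>2))}" for j
    define B where "B j = {\<omega>\<in>space M. hits \<omega> (max (s (Suc j) \<omega>2 - \<delta>) (s j \<omega>2)) (s (Suc j) \<omega>2)}" for j
    have AB: "A j \<in> events" "B j \<in> events" for j unfolding A_def B_def using hits_pred by (auto simp: pred_def)
    have pA: "prob (A j) \<le> n * min \<delta> (s (Suc j) \<omega>2 - s j \<omega>2)" for j
    proof -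
      have "prob (A j) = q_hit (s j \<omega>2) (min (s j \<omega>2 + \<delta>) (s (Suc j) \<omega>2))"
        unfolding A_def using s0 sle \<delta> by (intro prob_hits) auto
      also have "\<dots> \<le> n * (min (s j \<omega>2 + \<delta>) (s (Suc j) \<omega>2) - s j \<omega>2)"
        using s0 sle \<delta> by (intro q_hit_le_diff) auto
      finally show ?thesis by (simp add: min_def algebra_simps split: if_splits)
    qed
    have pB: "prob (B j) \<le> n * min \<delta> (s (Suc j) \<omega>2 - s j \<omega>2)" for j
    proof -
      have "prob (B j) = q_hit (max (s (Suc j) \<omega>2 - \<delta>) (s j \<omega>2)) (s (Suc j) \<omega>2)"
        unfolding B_def using s0[of j] sle[of j] \<delta> by (intro prob_hits) auto
      also have "\<dots> \<le> n * (s (Suc j) \<omega>2 - max (s (Suc j) \<omega>2 - \<delta>) (s j \<omega>2))"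
        using s0[of j] sle[of j] \<delta> by (intro q_hit_le_diff) auto
      also have "s (Suc j) \<omega>2 - max (s (Suc j) \<omega>2 - \<delta>) (s j \<omega>2) = min \<delta> (s (Suc j) \<omega>2 - s j \<omega>2)" by (simp add: min_def max_def)
      finally show ?thesis .
    qed
    have "{\<omega>1\<in>space M. (\<omega>1, \<omega>2) \<in> Q} = (\<Union>j<N. A j \<union> B j)"
      unfolding Q_def A_def B_def near_mesh_def Let_def s_def[symmetric] using spQ[OF _ \<omega>2] by auto
    also have "prob \<dots> \<le> (\<Sum>j<N. prob (A j \<union> B j))"
      using AB by (intro finite_measure_subadditive_finite) auto
    also have "\<dots> \<le> b \<omega>2" unfolding b_def
    proof (intro sum_mono)
      fix j
      have "prob (A j \<union> B j) \<le> prob (A j) + prob (B j)" using AB by (intro measure_Un_le)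
      then show "prob (A j \<union> B j) \<le> 2 * n * min \<delta> (s (Suc j) \<omega>2 - s j \<omega>2)" using pA[of j] pB[of j] by simp
    qed
    finally show "prob {\<omega>1\<in>space M. (\<omega>1, \<omega>2) \<in> Q} \<le> b \<omega>2" .
  qed
  then show "prob {\<omega>\<in>space M. near_mesh (1 / r) h N \<omega> \<omega>} \<le> 4 * n * (real N * h) * (psi \<nu> r / r)"
    using eb eqQ by (simp add: \<delta>_def)
qed

text \<open>An outcome with an exceptional point lies in \<open>F i m\<close> for every
  \<open>i\<close> and all large \<open>m\<close>. For fixed \<open>i\<close> the lower limit of
  these events in \<open>m\<close> has probability at most \<open>\<beta> i\<close>, since the bound
  is uniform in the mesh, and \<open>\<beta>\<close> tends to 0.\<close>

lemma AE_no_exceptional_points: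
  assumes T: "0 < T"
  shows "AE \<omega> in M. \<forall>x\<in>\<xi> \<omega>. x \<le> S T \<omega> \<longrightarrow> (\<exists>t\<ge>0. left_lim (\<lambda>t. S t \<omega>) t < x \<and> x < S t \<omega>)"
proof -
  define F where "F i m = {\<omega>\<in>space M. near_mesh (1 / real (Suc i)) (T / 2 ^ m) (2 ^ m) \<omega> \<omega>}" for i m :: nat
  define \<beta> where "\<beta> i = 4 * n * T * (psi \<nu> (real (Suc i)) / real (Suc i))" for i
  have F: "F i m \<in> events" "prob (F i m) \<le> \<beta> i" for i m
    unfolding F_def \<beta>_def using prob_near_mesh[of "T / 2 ^ m" "real (Suc i)" "2 ^ m"] T by auto
  define G where "G i k = (\<Inter>m\<in>{k..}. F i m)" for i k :: nat
  have G: "G i k \<in> events" for i k unfolding G_def by (rule sets.countable_INT') (auto simp: F)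
  have B: "(\<Union>k. G i k) \<in> events" for i using G by auto
  have PB: "prob (\<Union>k. G i k) \<le> \<beta> i" for i
  proof (rule LIMSEQ_le_const2)
    show "(\<lambda>k. prob (G i k)) \<longlonglongrightarrow> prob (\<Union>k. G i k)"
      by (rule finite_Lim_measure_incseq) (use G in \<open>auto simp: incseq_def G_def\<close>)
    have "prob (G i k) \<le> prob (F i k)" for k using F by (intro finite_measure_mono) (auto simp: G_def)
    then show "\<exists>N. \<forall>k\<ge>N. prob (G i k) \<le> \<beta> i" using F(2) order_trans by blast
  qed
  define B' where "B' = (\<Inter>i. \<Union>k. G i k)"
  have B'e: "B' \<in> events" unfolding B'_def using B by auto
  have "prob B' \<le> \<beta> i" for i using PB[of i] B finite_measure_mono[of B' "\<Union>k. G i k"] by (force simp: B'_def)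
  moreover have "\<beta> \<longlonglongrightarrow> 4 * n * T * 0" unfolding \<beta>_def by (intro tendsto_mult tendsto_const psi_sublinear)
  ultimately have "prob B' \<le> 0" by (intro LIMSEQ_le_const[of \<beta> 0 "prob B'"]) auto
  then have "prob B' = 0" using measure_nonneg[of M B'] by linarith
  then have "AE \<omega> in M. \<omega> \<notin> B'" using B'e by (simp add: AE_iff_measurable[OF _ refl] prob_eq_0)
  moreover have "\<omega> \<in> B'" if \<omega>: "\<omega> \<in> space M" and x: "x \<in> \<xi> \<omega>" "x \<le> S T \<omega>"
    and no: "\<not> (\<exists>t\<ge>0. left_lim (\<lambda>t. S t \<omega>) t < x \<and> x < S t \<omega>)" for \<omega> x
  proof -
    have x0: "S 0 \<omega> < x" using \<xi>_pos[OF \<omega>] x S_zero[OF \<omega>] by auto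
    have "\<exists>k. \<forall>m\<ge>k. \<omega> \<in> F i m" for i
    proof -
      have "\<forall>\<^sub>F m in sequentially. \<omega> \<in> F i m"
      proof (rule eventually_mono[OF increasing_path.exceptional_point_near_mesh[OF path[OF \<omega>] x0 x(2) T]])
        show "0 < 1 / real (Suc i)" by simp
        show "\<And>t. 0 \<le> t \<Longrightarrow> \<not> (left_lim (\<lambda>t. S t \<omega>) t < x \<and> x < S t \<omega>)" using no by blast
      next
        fix m assume "\<exists>j<2 ^ m. let a = S (real j * (T / 2 ^ m)) \<omega>; b = S (real (Suc j) * (T / 2 ^ m)) \<omega>
           in a < x \<and> x \<le> min (a + 1 / real (Suc i)) b \<or> max (b - 1 / real (Suc i)) a < x \<and> x \<le> b"
        then show "\<omega> \<in> F i m" unfolding F_def near_mesh_def hits_def Let_def using x \<omega> by blast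
      qed
      then show ?thesis by (simp add: eventually_sequentially)
    qed
    then have "\<exists>k. \<omega> \<in> G i k" for i unfolding G_def INT_iff Ball_def atLeast_iff .
    then show ?thesis by (simp add: B'_def)
  qed
  ultimately show ?thesis by (elim AE_mp) (intro AE_I2, blast)
qed

definition mesh_agrees :: "real \<Rightarrow> nat \<Rightarrow> 'a set" where
  "mesh_agrees T m = {\<omega>\<in>space M. \<forall>k\<le>2^m.
    (\<Sum>j<k. of_bool (hits \<omega> (S (real j * (T / 2 ^ m)) \<omega>) (S (real (Suc j) * (T / 2 ^ m)) \<omega>)))
      = real (K_count S \<xi> (real k * (T / 2 ^ m)) \<omega>)}"

lemma mesh_agrees:
  assumes T: "0 < T"
  shows "mesh_agrees T m \<in> events" and "(\<lambda>m. prob (mesh_agrees T m)) \<longlonglongrightarrow> 1"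
proof -
  have ev: "mesh_agrees T m \<in> events" for m
  proof -
    have [measurable]: "Measurable.pred M (\<lambda>\<omega>. hits \<omega> (S (real j * (T / 2 ^ m)) \<omega>) (S (real (Suc j) * (T / 2 ^ m)) \<omega>))" for j
      using T by (intro hits_measurable ident_M1 S_measurable) auto
    have [measurable]: "(\<lambda>\<omega>. real (K_count S \<xi> (real k * (T / 2 ^ m)) \<omega>)) \<in> borel_measurable M" for k
      using T by (intro K_count_measurable) auto
    show ?thesis unfolding mesh_agrees_def by measurable
  qed
  then show "mesh_agrees T m \<in> events" .
  have "(\<lambda>m. expectation (indicat_real (mesh_agrees T m))) \<longlonglongrightarrow> expectation (\<lambda>_. 1)"
  proof (rule integral_dominated_convergence[where w = "\<lambda>_. 1"])
    show "AE \<omega> in M. (\<lambda>m. indicat_real (mesh_agrees T m) \<omega>) \<longlonglongrightarrow> 1"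
      using AE_no_exceptional_points[OF T]
    proof (rule AE_mp, intro AE_I2 impI)
      fix \<omega> assume \<omega>: "\<omega> \<in> space M"
        and ok: "\<forall>x\<in>\<xi> \<omega>. x \<le> S T \<omega> \<longrightarrow> (\<exists>t\<ge>0. left_lim (\<lambda>t. S t \<omega>) t < x \<and> x < S t \<omega>)"
      have "\<forall>\<^sub>F m in sequentially. \<forall>k\<le>2^m.
        card {j. j < k \<and> (\<exists>x\<in>\<xi> \<omega>. S (real j * (T / 2 ^ m)) \<omega> < x \<and> x \<le> S (real (Suc j) * (T / 2 ^ m)) \<omega>)}
        = card {t \<in> {0..real k * (T / 2 ^ m)}. hit_at (\<lambda>t. S t \<omega>) (\<xi> \<omega>) t}"
        using \<xi>_pos[OF \<omega>] S_zero[OF \<omega>] ok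
        by (intro increasing_path.mesh_count_eq_jump_count[OF path[OF \<omega>] T \<xi>_finite[OF \<omega>]]) auto
      then have "\<forall>\<^sub>F m in sequentially. indicat_real (mesh_agrees T m) \<omega> = 1"
      proof eventually_elim
        case (elim m)
        then show ?case using \<omega> unfolding mesh_agrees_def hits_def sum_of_bool_card K_count_eq by simp
      qed
      then show "(\<lambda>m. indicat_real (mesh_agrees T m) \<omega>) \<longlonglongrightarrow> 1" by (rule tendsto_eventually)
    qed
  qed (use ev in \<open>auto simp: indicator_def\<close>)
  moreover have "expectation (indicat_real (mesh_agrees T m)) = prob (mesh_agrees T m)" for m
    using sets.sets_into_space[OF ev[of m]] by (simp add: Int_absorb2)
  ultimately show "(\<lambda>m. prob (mesh_agrees T m)) \<longlonglongrightarrow> 1" by (simp add: prob_space)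
qed

text \<open>To first order in \<open>h\<close>, \<open>hit_prob h m\<close> is
  \<open>h * Phi \<nu> m\<close>; so this is the limit of the sums of conditional hitting
  probabilities along the path.\<close>

definition compensator :: "real \<Rightarrow> 'a \<Rightarrow> real" where
  "compensator t \<omega> = integral {0..t} (\<lambda>u. Phi \<nu> (n * exp (- S u \<omega>)))"

lemma compensator_integrand:
  assumes \<omega>: "\<omega> \<in> space M"
  shows "antimono_on {0..} (\<lambda>u. Phi \<nu> (n * exp (- S u \<omega>)))"
    and "0 \<le> u \<Longrightarrow> 0 \<le> Phi \<nu> (n * exp (- S u \<omega>))"
    and "0 \<le> u \<Longrightarrow> Phi \<nu> (n * exp (- S u \<omega>)) \<le> Phi \<nu> n"
    and "0 \<le> a \<Longrightarrow> (\<lambda>u. Phi \<nu> (n * exp (- S u \<omega>))) integrable_on {a..b}"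
proof -
  show *: "antimono_on {0..} (\<lambda>u. Phi \<nu> (n * exp (- S u \<omega>)))"
    unfolding monotone_on_def using n_pos S_mono[OF \<omega>] by (auto intro!: Phi_mono)
  show "0 \<le> u \<Longrightarrow> 0 \<le> Phi \<nu> (n * exp (- S u \<omega>))" using n_pos by (intro Phi_nonneg) auto
  show "0 \<le> u \<Longrightarrow> Phi \<nu> (n * exp (- S u \<omega>)) \<le> Phi \<nu> n"
    using n_pos S_nonneg[OF \<omega>] by (intro Phi_mono) (auto simp: mult_left_le)
  show "0 \<le> a \<Longrightarrow> (\<lambda>u. Phi \<nu> (n * exp (- S u \<omega>))) integrable_on {a..b}"
    by (rule antimono_integrable_on, rule monotone_on_subset[OF *]) auto
qed

lemma compensator_increment:
  assumes \<omega>: "\<omega> \<in> space M" and "0 \<le> s" "s \<le> t"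
  shows "compensator s \<omega> \<le> compensator t \<omega>"
    and "compensator t \<omega> \<le> compensator s \<omega> + (t - s) * Phi \<nu> n"
proof -
  note I = compensator_integrand[OF \<omega>]
  have eq: "compensator t \<omega> = compensator s \<omega> + integral {s..t} (\<lambda>u. Phi \<nu> (n * exp (- S u \<omega>)))"
    unfolding compensator_def
    using assms by (intro Henstock_Kurzweil_Integration.integral_combine[symmetric] I) auto
  have "0 \<le> integral {s..t} (\<lambda>u. Phi \<nu> (n * exp (- S u \<omega>)))"
    using assms by (intro integral_nonneg I) auto
  then show "compensator s \<omega> \<le> compensator t \<omega>" using eq by simp
  have "integral {s..t} (\<lambda>u. Phi \<nu> (n * exp (- S u \<omega>))) \<le> integral {s..t} (\<lambda>u. Phi \<nu> n)"
    using assms by (intro integral_le I) auto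
  then show "compensator t \<omega> \<le> compensator s \<omega> + (t - s) * Phi \<nu> n" using eq assms by simp
qed

text \<open>The mesh is chosen after \<open>T\<close>, \<open>\<eta>\<close> and
  \<open>\<epsilon>\<close>, so all discretisation errors fit into \<open>\<epsilon>\<close>. What
  remains are the two maximal inequalities: each costs \<open>\<eta>\<close>, and their probability
  bounds, 1 and 2 times \<open>T * Phi \<nu> n / \<eta>\<^sup>2\<close>, add up to the factor
  3.\<close>

lemma K_count_near_compensator:
  assumes T: "0 < T" and \<eta>: "0 < \<eta>" and \<epsilon>: "0 < \<epsilon>"
  shows "\<exists>C\<in>events. 1 - (3 * T * Phi \<nu> n / \<eta>\<^sup>2 + \<epsilon>) \<le> prob C \<and>
    (\<forall>\<omega>\<in>C. \<forall>t\<in>{0..T}. \<bar>real (K_count S \<xi> t \<omega>) - compensator t \<omega>\<bar> \<le> 2 * \<eta> + \<epsilon>)"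
proof -
  \<comment> \<open>The discretisation error per unit of mesh: the second-order term of
    \<open>hit_prob_ge\<close> summed over the cells, one \<open>Phi \<nu> n\<close> for the Riemann
    sum, and one more for times between mesh points.\<close>
  define c where "c = T * (psi \<nu> 1)\<^sup>2 * exp (3 * n) + 2 * Phi \<nu> n"
  have c0: "0 \<le> c" using T n_pos Phi_nonneg[of n] by (simp add: c_def)
  have "\<forall>\<^sub>F m in sequentially. prob (mesh_agrees T m) > 1 - \<epsilon>"
    using mesh_agrees(2)[OF T] \<epsilon> by (intro order_tendstoD(1)) auto
  moreover have "\<forall>\<^sub>F m in sequentially. T / 2 ^ m < \<epsilon> / (c + 1)"
    using c0 \<epsilon> by (intro eventually_dyadic_mesh_less divide_pos_pos) auto
  ultimately have "\<forall>\<^sub>F m in sequentially. prob (mesh_agrees T m) > 1 - \<epsilon> \<and> T / 2 ^ m < \<epsilon> / (c + 1)"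
    by eventually_elim auto
  then obtain m where m: "prob (mesh_agrees T m) > 1 - \<epsilon>" "T / 2 ^ m < \<epsilon> / (c + 1)"
    by (auto dest: eventually_happens)
  define h where "h = T / 2 ^ m"
  define N :: nat where "N = 2 ^ m"
  have h: "0 < h" using T by (simp add: h_def)
  have Nh: "real N * h = T" by (simp add: N_def h_def)
  have hc: "h * c \<le> \<epsilon>"
  proof -
    have "h * (c + 1) < \<epsilon>" using m(2) c0 by (simp add: h_def pos_less_divide_eq)
    then show ?thesis using h by (simp add: algebra_simps)
  qed
  define D where "D j \<omega> = (of_bool (hits \<omega> (S (real j * h) \<omega>) (S (real (Suc j) * h) \<omega>)) :: real)" for j \<omega>
  define q where "q j \<omega> = q_hit (S (real j * h) \<omega>) (S (real (Suc j) * h) \<omega>)" for j \<omega>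
  define p where "p j \<omega> = hit_prob h (n * exp (- S (real j * h) \<omega>))" for j \<omega>
  define f where "f \<omega> u = Phi \<nu> (n * exp (- S u \<omega>))" for \<omega> u
  define B1 where "B1 = {\<omega>\<in>space M. \<exists>k\<le>N. \<eta> \<le> \<bar>\<Sum>j<k. D j \<omega> - q j \<omega>\<bar>}"
  define B2 where "B2 = {\<omega>\<in>space M. \<exists>k\<le>N. \<eta> \<le> \<bar>\<Sum>j<k. q j \<omega> - p j \<omega>\<bar>}"
  have B1: "B1 \<in> events" "prob B1 \<le> T * Phi \<nu> n / \<eta>\<^sup>2"
    unfolding B1_def D_def q_def
    using hit_indicator_maximal[OF less_imp_le[OF h] \<eta>, of N, unfolded Nh] by blast+
  have B2e: "B2 \<in> events"
  proof -
    have tj: "0 \<le> real j * h" for j using h by simp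
    have [measurable]: "S (real j * h) \<in> borel_measurable M" for j by (rule S_measurable[OF tj])
    have [measurable]: "hit_prob h \<in> borel_measurable borel" using h by (intro hit_prob_measurable) simp
    show ?thesis unfolding B2_def q_def p_def q_hit_def by measurable
  qed
  have B2: "prob B2 \<le> 2 * (T * Phi \<nu> n) / \<eta>\<^sup>2"
    unfolding B2_def p_def q_def by (rule hit_prob_maximal[OF less_imp_le[OF h] \<eta>, of N, unfolded Nh])
  define C where "C = mesh_agrees T m - (B1 \<union> B2)"
  have He: "mesh_agrees T m \<in> events" by (rule mesh_agrees(1)[OF T])
  have Ce: "C \<in> events" using He B1(1) B2e by (auto simp: C_def)
  have "prob (mesh_agrees T m) \<le> prob (C \<union> (B1 \<union> B2))"
    by (intro finite_measure_mono sets.Un Ce B1(1) B2e) (auto simp: C_def)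
  also have "\<dots> \<le> prob C + prob (B1 \<union> B2)" using Ce B1(1) B2e by (intro measure_Un_le) auto
  also have "\<dots> \<le> prob C + (prob B1 + prob B2)" using B1(1) B2e by (intro add_left_mono measure_Un_le) auto
  finally have "1 - \<epsilon> \<le> prob C + (prob B1 + prob B2)" using m(1) by simp
  have PC: "1 - (3 * T * Phi \<nu> n / \<eta>\<^sup>2 + \<epsilon>) \<le> prob C"
  proof -
    have "3 * T * Phi \<nu> n / \<eta>\<^sup>2 = T * Phi \<nu> n / \<eta>\<^sup>2 + 2 * (T * Phi \<nu> n) / \<eta>\<^sup>2"
      by (simp add: add_divide_distrib[symmetric])
    then show ?thesis using B1(2) B2 \<open>1 - \<epsilon> \<le> prob C + (prob B1 + prob B2)\<close> by linarith
  qed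
  have grid: "\<bar>real (K_count S \<xi> (real k * h) \<omega>) - compensator (real k * h) \<omega>\<bar>
      \<le> 2 * \<eta> + (h * (T * (psi \<nu> 1)\<^sup>2 * exp (3 * n)) + h * Phi \<nu> n)"
    if \<omega>: "\<omega> \<in> C" and k: "k \<le> N" for \<omega> k
  proof -
    have \<omega>M: "\<omega> \<in> space M" using \<omega> by (auto simp: C_def mesh_agrees_def)
    note I = compensator_integrand[OF \<omega>M]
    have 1: "real (K_count S \<xi> (real k * h) \<omega>) = (\<Sum>j<k. D j \<omega>)"
      using \<omega> k unfolding C_def mesh_agrees_def D_def h_def N_def by auto
    have 2: "\<bar>(\<Sum>j<k. D j \<omega>) - (\<Sum>j<k. q j \<omega>)\<bar> < \<eta>" "\<bar>(\<Sum>j<k. q j \<omega>) - (\<Sum>j<k. p j \<omega>)\<bar> < \<eta>"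
    proof -
      have "\<omega> \<notin> B1" "\<omega> \<notin> B2" using \<omega> by (auto simp: C_def)
      then show "\<bar>(\<Sum>j<k. D j \<omega>) - (\<Sum>j<k. q j \<omega>)\<bar> < \<eta>" "\<bar>(\<Sum>j<k. q j \<omega>) - (\<Sum>j<k. p j \<omega>)\<bar> < \<eta>"
        unfolding B1_def B2_def using \<omega>M k by (simp_all add: sum_subtractf not_le[symmetric])
    qed
    have 3: "p j \<omega> \<le> h * f \<omega> (real j * h)" "h * f \<omega> (real j * h) - h\<^sup>2 * (psi \<nu> 1)\<^sup>2 * exp (3 * n) \<le> p j \<omega>" for j
    proof -
      have m0: "0 \<le> n * exp (- S (real j * h) \<omega>)" "n * exp (- S (real j * h) \<omega>) \<le> n"
        using n_pos S_nonneg[OF \<omega>M, of "real j * h"] h by (auto simp: mult_left_le)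
      show "p j \<omega> \<le> h * f \<omega> (real j * h)" unfolding p_def f_def using h m0 by (intro hit_prob_le) auto
      have "h\<^sup>2 * (psi \<nu> 1)\<^sup>2 * exp (3 * (n * exp (- S (real j * h) \<omega>))) \<le> h\<^sup>2 * (psi \<nu> 1)\<^sup>2 * exp (3 * n)"
        using m0 by (intro mult_left_mono) auto
      then show "h * f \<omega> (real j * h) - h\<^sup>2 * (psi \<nu> 1)\<^sup>2 * exp (3 * n) \<le> p j \<omega>"
        using hit_prob_ge[OF less_imp_le[OF h] m0(1)] unfolding p_def f_def by linarith
    qed
    have 4: "(\<Sum>j<k. p j \<omega>) \<le> h * (\<Sum>j<k. f \<omega> (real j * h))"
      unfolding sum_distrib_left using 3 by (intro sum_mono) auto
    have "h * (\<Sum>j<k. f \<omega> (real j * h)) - real k * (h\<^sup>2 * (psi \<nu> 1)\<^sup>2 * exp (3 * n)) =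
        (\<Sum>j<k. h * f \<omega> (real j * h) - h\<^sup>2 * (psi \<nu> 1)\<^sup>2 * exp (3 * n))"
      by (simp add: sum_distrib_left sum_subtractf)
    also have "\<dots> \<le> (\<Sum>j<k. p j \<omega>)" using 3 by (intro sum_mono) auto
    finally have 5: "h * (\<Sum>j<k. f \<omega> (real j * h)) - real k * (h\<^sup>2 * (psi \<nu> 1)\<^sup>2 * exp (3 * n)) \<le> (\<Sum>j<k. p j \<omega>)" .
    have "real k * (h\<^sup>2 * (psi \<nu> 1)\<^sup>2 * exp (3 * n)) \<le> real N * (h\<^sup>2 * (psi \<nu> 1)\<^sup>2 * exp (3 * n))"
      using k by (intro mult_right_mono) auto
    also have "\<dots> = h * ((real N * h) * (psi \<nu> 1)\<^sup>2 * exp (3 * n))" by (simp add: power2_eq_square mult_ac)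
    finally have 6: "real k * (h\<^sup>2 * (psi \<nu> 1)\<^sup>2 * exp (3 * n)) \<le> h * (T * (psi \<nu> 1)\<^sup>2 * exp (3 * n))" unfolding Nh .
    have 7: "compensator (real k * h) \<omega> \<le> h * (\<Sum>j<k. f \<omega> (real j * h))"
      "h * (\<Sum>j<k. f \<omega> (real j * h)) \<le> compensator (real k * h) \<omega> + h * (f \<omega> 0 - f \<omega> (real k * h))"
      using antimono_riemann_sum[OF I(1), of h k] h unfolding f_def compensator_def by auto
    have "h * (f \<omega> 0 - f \<omega> (real k * h)) \<le> h * Phi \<nu> n"
      using I(2)[of "real k * h"] I(3)[of 0] h unfolding f_def by (intro mult_left_mono) auto
    then show ?thesis using 1 2 4 5 6 7 by linarith
  qed
  have "\<bar>real (K_count S \<xi> t \<omega>) - compensator t \<omega>\<bar> \<le> 2 * \<eta> + \<epsilon>" if \<omega>: "\<omega> \<in> C" and t: "t \<in> {0..T}" for \<omega> t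
  proof (cases "t = 0")
    \<comment> \<open>Time 0 is treated apart because the mesh cells are open on the left.\<close>
    case True
    have "\<omega> \<in> space M" using \<omega> by (auto simp: C_def mesh_agrees_def)
    then show ?thesis using True K_count_zero \<eta> \<epsilon> by (simp add: compensator_def)
  next
    case False
    have \<omega>M: "\<omega> \<in> space M" using \<omega> by (auto simp: C_def mesh_agrees_def)
    from False obtain j where j: "real j * h < t" "t \<le> real (Suc j) * h" using mesh_cell_exists[OF h, of t] t by auto
    have "real j * h < real N * h" using j t Nh by simp
    then have jN: "Suc j \<le> N" using h by simp
    have d: "real (Suc j) * h - real j * h = h" by (simp add: algebra_simps)
    have j0: "0 \<le> real j * h" using h by simp
    have K: "real (K_count S \<xi> (real j * h) \<omega>) \<le> real (K_count S \<xi> t \<omega>)"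
      "real (K_count S \<xi> t \<omega>) \<le> real (K_count S \<xi> (real (Suc j) * h) \<omega>)"
      using K_count_mono[OF \<omega>M] j by simp_all
    have A: "compensator (real j * h) \<omega> \<le> compensator t \<omega>" "compensator t \<omega> \<le> compensator (real (Suc j) * h) \<omega>"
      using compensator_increment(1)[OF \<omega>M] j j0 by auto
    have A2: "compensator (real (Suc j) * h) \<omega> \<le> compensator (real j * h) \<omega> + h * Phi \<nu> n"
      using compensator_increment(2)[OF \<omega>M j0, of "real (Suc j) * h"] d h by (simp add: mult_right_mono)
    have G1: "\<bar>real (K_count S \<xi> (real j * h) \<omega>) - compensator (real j * h) \<omega>\<bar>
      \<le> 2 * \<eta> + (h * (T * (psi \<nu> 1)\<^sup>2 * exp (3 * n)) + h * Phi \<nu> n)" using grid[OF \<omega>, of j] jN by simp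
    have G2: "\<bar>real (K_count S \<xi> (real (Suc j) * h) \<omega>) - compensator (real (Suc j) * h) \<omega>\<bar>
      \<le> 2 * \<eta> + (h * (T * (psi \<nu> 1)\<^sup>2 * exp (3 * n)) + h * Phi \<nu> n)" using grid[OF \<omega> jN] .
    have "h * c = h * (T * (psi \<nu> 1)\<^sup>2 * exp (3 * n)) + 2 * (h * Phi \<nu> n)" by (simp add: c_def algebra_simps)
    then show ?thesis using G1 G2 K A A2 hc by linarith
  qed
  then show ?thesis using Ce PC by blast
qed

end

section \<open>Slowly varying integrands\<close>

text \<open>For \<open>g v = Phi \<nu> (exp v)\<close> the relation between \<open>L_fun\<close> and
  \<open>c2\<close> becomes the differential equation \<open>deriv\<close>. The bound
  \<open>exp_bound\<close> controls the integrals over negative \<open>v\<close>, which occur after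
  the path has passed the level \<open>ln n\<close>.\<close>

locale slowly_growing =
  fixes g c :: "real \<Rightarrow> real" and B :: real
  assumes mono: "mono g" and nonneg: "\<And>v. 0 \<le> g v" and exp_bound: "\<And>v. g v \<le> B * exp v"
    and cont: "continuous_on UNIV g"
    and c_at_top: "filterlim c at_top at_top"
    and deriv: "\<forall>\<^sub>F v in at_top. (g has_real_derivative g v / (c v * v)) (at v)"
    and g_at_top: "filterlim g at_top at_top"
begin

lemma B_nonneg: "0 \<le> B"
  using nonneg[of 0] exp_bound[of 0] by simp

text \<open>As soon as \<open>c v \<ge> 1\<close>, the quotient \<open>g v / v\<close> has
  nonpositive derivative.\<close>

lemma doubling: "\<forall>\<^sub>F a in at_top. g (2 * a) \<le> 2 * g a"
proof -
  have "\<forall>\<^sub>F v in at_top. (g has_real_derivative g v / (c v * v)) (at v) \<and> 1 \<le> c v"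
    using deriv c_at_top by (auto simp: filterlim_at_top intro: eventually_conj)
  then obtain v0 where v0: "\<And>v. v \<ge> v0 \<Longrightarrow> (g has_real_derivative g v / (c v * v)) (at v) \<and> 1 \<le> c v"
    by (auto simp: eventually_at_top_linorder)
  have "\<forall>\<^sub>F a in at_top. max v0 1 \<le> a" by (rule eventually_ge_at_top)
  then show ?thesis
  proof eventually_elim
    case (elim a)
    have "g (2 * a) / (2 * a) \<le> g a / a"
    proof (rule DERIV_nonpos_imp_nonincreasing[of a "2 * a" "\<lambda>v. g v / v"])
      fix x assume x: "a \<le> x" "x \<le> 2 * a"
      then have xp: "0 < x" and cx: "1 \<le> c x" using elim v0[of x] by auto
      have "((\<lambda>v. g v / v) has_real_derivative (g x / (c x * x) * x - g x * 1) / (x * x)) (at x)"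
        using v0[of x] x elim xp by (intro DERIV_divide DERIV_ident) auto
      moreover have "(g x / (c x * x) * x - g x * 1) / (x * x) \<le> 0"
      proof -
        have "g x / (c x * x) * x = g x / c x" using xp by simp
        also have "\<dots> \<le> g x" using cx nonneg[of x] by (simp add: divide_le_eq mult_le_cancel_left1)
        finally show ?thesis using xp by (intro divide_nonpos_pos) auto
      qed
      ultimately show "\<exists>y. ((\<lambda>v. g v / v) has_real_derivative y) (at x) \<and> y \<le> 0" by blast
    qed (use elim in auto)
    then show ?case using elim by (simp add: field_simps)
  qed
qed

text \<open>The slope on this range is \<open>o (g a / a)\<close>. A displacement of order
  \<open>sqrt a\<close>, kept up over a time of order \<open>a\<close>, thus changes the integral by
  \<open>o (g a * sqrt a)\<close>. The left end \<open>\<delta> * a\<close> keeps away from small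
  \<open>v\<close>, where the slope need not be this small.\<close>

lemma small_variation:
  assumes \<delta>: "0 < \<delta>" and \<eta>: "0 < \<eta>"
  shows "\<forall>\<^sub>F a in at_top. \<forall>v\<in>{\<delta> * a..2 * a}. \<forall>w\<in>{\<delta> * a..2 * a}. \<bar>g v - g w\<bar> \<le> \<eta> * g a / a * \<bar>v - w\<bar>"
proof -
  \<comment> \<open>Solves \<open>2 / (K * \<delta>) = \<eta>\<close>, where the 2 comes from
    \<open>doubling\<close>.\<close>
  define K where "K = 2 / (\<delta> * \<eta>)"
  have K: "0 < K" using assms by (simp add: K_def)
  have "\<forall>\<^sub>F v in at_top. (g has_real_derivative g v / (c v * v)) (at v) \<and> K \<le> c v"
    using deriv c_at_top by (auto simp: filterlim_at_top intro: eventually_conj)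
  then obtain v0 where v0: "\<And>v. v \<ge> v0 \<Longrightarrow> (g has_real_derivative g v / (c v * v)) (at v) \<and> K \<le> c v"
    by (auto simp: eventually_at_top_linorder)
  have "\<forall>\<^sub>F a in at_top. max (v0 / \<delta>) 1 \<le> a" by (rule eventually_ge_at_top)
  with doubling show ?thesis
  proof eventually_elim
    case (elim a)
    have a: "0 < a" "v0 \<le> \<delta> * a" using elim(2) \<delta> by (auto simp: pos_divide_le_eq mult.commute)
    have "norm (g v - g w) \<le> \<eta> * g a / a * norm (v - w)" if "v \<in> {\<delta> * a..2 * a}" "w \<in> {\<delta> * a..2 * a}" for v w
    proof (rule field_differentiable_bound[of "{\<delta> * a..2 * a}" g "\<lambda>x. g x / (c x * x)"])
      fix x assume x: "x \<in> {\<delta> * a..2 * a}"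
      show "(g has_real_derivative g x / (c x * x)) (at x within {\<delta> * a..2 * a})"
        using v0[of x] x a by (auto intro: has_field_derivative_at_within)
      have x0: "0 < \<delta> * a" "\<delta> * a \<le> x" using x a \<delta> by auto
      have "K * (\<delta> * a) \<le> c x * x" using v0[of x] x0 x a K by (intro mult_mono) auto
      moreover have "g x \<le> 2 * g a" using monoD[OF mono, of x "2 * a"] x elim(1) by auto
      ultimately have "g x / (c x * x) \<le> 2 * g a / (K * (\<delta> * a))"
        using nonneg[of x] nonneg[of a] K x0 by (intro frac_le) auto
      also have "\<dots> = \<eta> * g a / a" using \<delta> \<eta> a by (simp add: K_def)
      finally show "norm (g x / (c x * x)) \<le> \<eta> * g a / a"
        using nonneg[of x] v0[of x] x0 x a K by (simp add: abs_of_nonneg)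
    qed (use that in auto)
    then show ?case by simp
  qed
qed

definition \<Gamma> :: "real \<Rightarrow> real" where
  "\<Gamma> x = (LBINT v=ereal 0..ereal x. g v)"

lemma DERIV_\<Gamma>: "(\<Gamma> has_real_derivative g x) (at x)"
proof -
  let ?a = "min 0 x - 1" and ?b = "max 0 x + 1"
  have "((\<lambda>u. LBINT v=ereal 0..ereal u. g v) has_vector_derivative g x) (at x within {?a..?b})"
    by (rule interval_integral_FTC2) (auto intro: continuous_on_subset[OF cont])
  moreover have "at x within {?a..?b} = at x" by (rule at_within_interior) (auto simp: interior_atLeastAtMost_real)
  ultimately show ?thesis
    by (simp add: \<Gamma>_def[abs_def] has_real_derivative_iff_has_vector_derivative zero_ereal_def)
qed

lemma interval_integral_\<Gamma>: "(LBINT v=ereal p..ereal q. g v) = \<Gamma> q - \<Gamma> p"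
  by (rule interval_integral_FTC_finite)
    (auto intro: continuous_on_subset[OF cont] has_vector_derivative_at_within
      DERIV_\<Gamma>[unfolded has_real_derivative_iff_has_vector_derivative])

lemma continuous_\<Gamma>: "continuous_on UNIV \<Gamma>"
  using DERIV_\<Gamma> by (meson DERIV_isCont continuous_at_imp_continuous_on)

lemma \<Gamma>_mvt: "\<exists>v. min p q \<le> v \<and> v \<le> max p q \<and> \<Gamma> q - \<Gamma> p = (q - p) * g v"
proof (cases p q rule: linorder_cases)
  case less
  then obtain z where "p < z" "z < q" "\<Gamma> q - \<Gamma> p = (q - p) * g z"
    using MVT2[OF less, of \<Gamma> g] DERIV_\<Gamma> by blast
  then show ?thesis by (intro exI[of _ z]) auto
next
  case greater
  then obtain z where "q < z" "z < p" "\<Gamma> p - \<Gamma> q = (p - q) * g z"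
    using MVT2[OF greater, of \<Gamma> g] DERIV_\<Gamma> by blast
  then show ?thesis by (intro exI[of _ z]) (auto simp: algebra_simps)
qed auto

lemma \<Gamma>_mono: "p \<le> q \<Longrightarrow> \<Gamma> p \<le> \<Gamma> q"
  using \<Gamma>_mvt[of p q] nonneg by (metis diff_ge_0_iff_ge mult_nonneg_nonneg)

lemma \<Gamma>_lipschitz: "p \<le> b \<Longrightarrow> q \<le> b \<Longrightarrow> \<bar>\<Gamma> q - \<Gamma> p\<bar> \<le> \<bar>q - p\<bar> * g b"
proof -
  assume pq: "p \<le> b" "q \<le> b"
  obtain v where v: "v \<le> max p q" "\<Gamma> q - \<Gamma> p = (q - p) * g v" using \<Gamma>_mvt[of p q] by blast
  have "g v \<le> g b" using v pq by (intro monoD[OF mono]) auto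
  then show ?thesis unfolding v(2) abs_mult using nonneg[of v] by (intro mult_left_mono) auto
qed

text \<open>By \<open>exp_bound\<close> the integral of \<open>g\<close> over the negative half-line
  is at most \<open>B\<close>, so the clipping at 0 in \<open>G\<close> costs a constant only.
  Unclipped, the integral along a shifted line is an exact difference of values of
  \<open>\<Gamma>\<close>.\<close>

lemma \<Gamma>_pos_part: "\<Gamma> w \<le> \<Gamma> (max w 0)" "\<Gamma> (max w 0) \<le> \<Gamma> w + B"
proof -
  show "\<Gamma> w \<le> \<Gamma> (max w 0)" by (rule \<Gamma>_mono) simp
  show "\<Gamma> (max w 0) \<le> \<Gamma> w + B"
  proof (cases "0 \<le> w")
    case False
    have "(B * exp w - \<Gamma> w) \<le> (B * exp 0 - \<Gamma> 0)"
    proof (rule DERIV_nonneg_imp_nondecreasing[of w 0 "\<lambda>w. B * exp w - \<Gamma> w"])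
      fix x
      have "((\<lambda>w. B * exp w - \<Gamma> w) has_real_derivative B * exp x - g x) (at x)"
        by (intro DERIV_diff DERIV_cmult DERIV_exp DERIV_\<Gamma>)
      then show "\<exists>y. ((\<lambda>w. B * exp w - \<Gamma> w) has_real_derivative y) (at x) \<and> 0 \<le> y"
        using exp_bound[of x] by (intro exI[of _ "B * exp x - g x"]) auto
    qed (use False in simp)
    moreover have "0 \<le> B * exp w" using B_nonneg by simp
    ultimately show ?thesis using False by (simp add: max_def)
  qed (use B_nonneg in \<open>simp add: max_def\<close>)
qed

lemma integral_shift: "0 \<le> t \<Longrightarrow> ((\<lambda>u. g (b - u)) has_integral \<Gamma> b - \<Gamma> (b - t)) {0..t}"
proof -
  assume t: "0 \<le> t"
  have "((\<lambda>u. g (b - u)) has_integral (- \<Gamma> (b - t)) - (- \<Gamma> (b - 0))) {0..t}"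
  proof (rule fundamental_theorem_of_calculus[OF t])
    fix u
    have "((\<lambda>u. - \<Gamma> (b - u)) has_real_derivative g (b - u)) (at u within {0..t})"
      by (auto intro!: derivative_eq_intros DERIV_chain2[OF DERIV_\<Gamma>])
    then show "((\<lambda>u. - \<Gamma> (b - u)) has_vector_derivative g (b - u)) (at u within {0..t})"
      by (simp add: has_real_derivative_iff_has_vector_derivative)
  qed
  then show ?thesis by simp
qed

text \<open>Time is split at distance \<open>\<delta> * a\<close> from \<open>a\<close>. Before, the
  slope bound applies; after, both integrands are exponentially small. In between neither argument
  works, but there the path follows the shifted line up to \<open>\<epsilon> * sqrt a\<close>, and
  monotonicity of \<open>g\<close> sandwiches the integrand. The sandwich takes 4 of the
  \<open>5 * \<epsilon>\<close>.\<close>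

lemma path_integral_approx:
  assumes R: "0 < R" and \<delta>: "0 < \<delta>" and \<epsilon>: "0 < \<epsilon>"
  shows "\<forall>\<^sub>F a in at_top. \<forall>s y. mono_on {0..} s \<longrightarrow> (\<forall>u\<in>{0..2 * a}. \<bar>s u - u\<bar> \<le> R * sqrt a) \<longrightarrow>
    \<bar>y\<bar> \<le> R * sqrt a \<longrightarrow> (\<forall>u\<in>{0..2 * a}. \<bar>u - a\<bar> \<le> \<delta> * a \<longrightarrow> \<bar>s u - u + y\<bar> \<le> \<epsilon> * sqrt a) \<longrightarrow>
    (\<forall>t\<in>{0..2 * a}. \<bar>integral {0..t} (\<lambda>u. g (a - s u)) - (\<Gamma> a + y * g a - \<Gamma> (max (a - t + y) 0))\<bar>
      \<le> 5 * \<epsilon> * (g a * sqrt a))"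
proof -
  \<comment> \<open>Makes the early times cost exactly \<open>\<epsilon> / 4\<close> on the scale
    \<open>g a * sqrt a\<close>, see \<open>P1\<close>.\<close>
  define \<eta> where "\<eta> = \<epsilon> / (16 * R)"
  have \<eta>: "0 < \<eta>" using R \<epsilon> by (simp add: \<eta>_def)
  \<comment> \<open>\<open>\<kappa> * a\<close> has to lie below
    \<open>\<delta> * a - R * sqrt a\<close>, a lower bound for the arguments of \<open>g\<close>
    before time \<open>a - \<delta> * a\<close>, and below all points within
    \<open>R * sqrt a\<close> of \<open>a\<close>.\<close>
  define \<kappa> where "\<kappa> = min (\<delta> / 2) (1 / 4)"
  have \<kappa>: "0 < \<kappa>" "\<kappa> \<le> \<delta> / 2" "\<kappa> \<le> 1 / 4" using \<delta> by (auto simp: \<kappa>_def)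
  have e3: "\<forall>\<^sub>F a in at_top. R * sqrt a \<le> \<kappa> * a" "\<forall>\<^sub>F a in at_top. \<epsilon> * sqrt a \<le> a / 4"
    "\<forall>\<^sub>F a in at_top. 2 * a * (B * exp (- (\<delta> / 2 * a))) + B \<le> \<epsilon> / 4 * sqrt a"
    "\<forall>\<^sub>F a in at_top. \<eta> * R\<^sup>2 \<le> \<epsilon> / 4 * sqrt a"
    using R \<kappa> \<delta> \<epsilon> \<eta> by real_asymp+
  have e4: "\<forall>\<^sub>F a in at_top. 1 \<le> g a" using g_at_top by (simp add: filterlim_at_top)
  have e5: "\<forall>\<^sub>F a in at_top. (1::real) \<le> a" by (rule eventually_ge_at_top)
  show ?thesis using small_variation[OF \<kappa>(1) \<eta>] doubling e3 e4 e5
  proof eventually_elim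
    case (elim a)
    note var = elim(1)[rule_format] and dbl = elim(2) and Ra = elim(3) and \<epsilon>a = elim(4)
      and small1 = elim(5) and small2 = elim(6) and g1 = elim(7) and a1 = elim(8)
    have a: "0 < a" "0 < sqrt a" "sqrt a * sqrt a = a" using a1 by auto
    have Ra4: "R * sqrt a \<le> a / 4" "R * sqrt a \<le> \<delta> / 2 * a"
      using Ra a mult_right_mono[OF \<kappa>(2), of a] mult_right_mono[OF \<kappa>(3), of a] by linarith+
    show ?case
    proof (intro allI impI ballI)
      fix s y t
      assume s: "mono_on {0..} s" and s1: "\<forall>u\<in>{0..2 * a}. \<bar>s u - u\<bar> \<le> R * sqrt a"
        and y: "\<bar>y\<bar> \<le> R * sqrt a" and s2: "\<forall>u\<in>{0..2 * a}. \<bar>u - a\<bar> \<le> \<delta> * a \<longrightarrow> \<bar>s u - u + y\<bar> \<le> \<epsilon> * sqrt a"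
        and t: "t \<in> {0..2 * a}"
      define r where "r = \<epsilon> * sqrt a"
      have r: "0 < r" using \<epsilon> a by (simp add: r_def)
      define b where "b = a + y"
      define E1 where "E1 = \<eta> * g a / a * (2 * (R * sqrt a))"
      define E3 where "E3 = B * exp (- (\<delta> / 2 * a))"
      \<comment> \<open>Added at all times although it serves only near time \<open>a\<close>: it is
        nonnegative and has an explicit integral.\<close>
      define E2 where "E2 u = g (b + r - u) - g (b - r - u)" for u
      have E1: "0 \<le> E1" using \<eta> nonneg[of a] a R by (simp add: E1_def)
      have E3: "0 \<le> E3" using B_nonneg by (simp add: E3_def)
      have E2: "0 \<le> E2 u" for u using r monoD[OF mono, of "b - r - u" "b + r - u"] by (simp add: E2_def)
      have pw: "norm (g (a - s u) - g (b - u)) \<le> (E1 + E3) + E2 u" if u: "u \<in> {0..t}" for u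
      proof -
        have u2: "u \<in> {0..2 * a}" using u t by auto
        have su: "\<bar>s u - u\<bar> \<le> R * sqrt a" using s1 u2 by blast
        consider "u \<le> a - \<delta> * a" | "\<bar>u - a\<bar> \<le> \<delta> * a" | "a + \<delta> * a \<le> u" by linarith
        then show ?thesis
        proof cases
          case 1
          have 11: "\<kappa> * a \<le> a - s u" "\<kappa> * a \<le> b - u"
            using 1 su y Ra4 \<kappa> mult_right_mono[OF \<kappa>(2), of a] a unfolding b_def by linarith+
          have 12: "a - s u \<le> 2 * a" "b - u \<le> 2 * a" using su y Ra4 u2 unfolding b_def by auto
          have "\<bar>g (a - s u) - g (b - u)\<bar> \<le> \<eta> * g a / a * \<bar>(a - s u) - (b - u)\<bar>"
            using 11 12 by (intro var) auto
          also have "\<dots> \<le> E1" unfolding E1_def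
            using su y \<eta> nonneg[of a] a by (intro mult_left_mono) (auto simp: b_def)
          finally show ?thesis using E2[of u] E3 by simp
        next
          case 2
          then have "\<bar>s u - u + y\<bar> \<le> r" using s2 u2 by (simp add: r_def)
          then have "g (b - r - u) \<le> g (a - s u)" "g (a - s u) \<le> g (b + r - u)"
            unfolding b_def by (auto intro!: monoD[OF mono])
          moreover have "g (b - r - u) \<le> g (b - u)" "g (b - u) \<le> g (b + r - u)"
            using r by (auto intro!: monoD[OF mono])
          ultimately show ?thesis using E1 E3 unfolding E2_def by auto
        next
          case 3
          have "a - s u \<le> - (\<delta> / 2 * a)" "b - u \<le> - (\<delta> / 2 * a)"
            using 3 su y Ra4 unfolding b_def by (auto simp: field_simps)
          then have "B * exp (a - s u) \<le> E3" "B * exp (b - u) \<le> E3"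
            unfolding E3_def using B_nonneg by (auto intro!: mult_left_mono)
          then have "g (a - s u) \<le> E3" "g (b - u) \<le> E3"
            using exp_bound[of "a - s u"] exp_bound[of "b - u"] by linarith+
          then show ?thesis using nonneg[of "a - s u"] nonneg[of "b - u"] E1 E2[of u] by auto
        qed
      qed
      have t0: "0 \<le> t" using t by simp
      have int1: "(\<lambda>u. g (a - s u)) integrable_on {0..t}"
      proof -
        have "(\<lambda>u. - g (a - s u)) integrable_on {0..t}"
          by (rule integrable_on_mono_on) (use s in \<open>auto simp: monotone_on_def intro!: monoD[OF mono]\<close>)
        then have "(\<lambda>u. - (- g (a - s u))) integrable_on {0..t}" by (rule integrable_neg)
        then show ?thesis by simp
      qed
      have hI: "((\<lambda>u. g (b - u)) has_integral \<Gamma> b - \<Gamma> (b - t)) {0..t}" by (rule integral_shift[OF t0])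
      have hE2: "(E2 has_integral (\<Gamma> (b + r) - \<Gamma> (b + r - t)) - (\<Gamma> (b - r) - \<Gamma> (b - r - t))) {0..t}"
        unfolding E2_def by (intro has_integral_diff integral_shift t0)
      have hE: "((\<lambda>u. (E1 + E3) + E2 u) has_integral t * (E1 + E3) + ((\<Gamma> (b + r) - \<Gamma> (b + r - t)) - (\<Gamma> (b - r) - \<Gamma> (b - r - t)))) {0..t}"
        using has_integral_const_real[of "E1 + E3" 0 t] t0 by (intro has_integral_add hE2) auto
      have "norm (integral {0..t} (\<lambda>u. g (a - s u) - g (b - u))) \<le> integral {0..t} (\<lambda>u. (E1 + E3) + E2 u)"
        using pw by (intro integral_norm_bound_integral integrable_diff int1 has_integral_integrable[OF hI] has_integral_integrable[OF hE]) auto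
      also have "integral {0..t} (\<lambda>u. (E1 + E3) + E2 u) = t * (E1 + E3) + ((\<Gamma> (b + r) - \<Gamma> (b + r - t)) - (\<Gamma> (b - r) - \<Gamma> (b - r - t)))"
        using hE by (rule integral_unique)
      \<comment> \<open>The sandwich integrates to the difference of two windows of width
        \<open>2 * r\<close>, and the subtracted one may be dropped. So it costs only
        \<open>2 * r\<close> times the size of \<open>g\<close>, however fast \<open>g\<close>
        varies there.\<close>
      also have "\<dots> \<le> 2 * a * (E1 + E3) + (\<Gamma> (b + r) - \<Gamma> (b - r))"
      proof -
        have "\<Gamma> (b - r - t) \<le> \<Gamma> (b + r - t)" using r by (intro \<Gamma>_mono) auto
        moreover have "t * (E1 + E3) \<le> 2 * a * (E1 + E3)" using t E1 E3 by (intro mult_right_mono) auto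
        ultimately show ?thesis by linarith
      qed
      also have "\<Gamma> (b + r) - \<Gamma> (b - r) \<le> 2 * r * (2 * g a)"
      proof -
        have "b + r \<le> 2 * a" using y Ra4 \<epsilon>a a unfolding b_def r_def by linarith
        then have "\<bar>\<Gamma> (b + r) - \<Gamma> (b - r)\<bar> \<le> \<bar>(b + r) - (b - r)\<bar> * g (2 * a)" using r by (intro \<Gamma>_lipschitz) auto
        also have "\<dots> \<le> (2 * r) * (2 * g a)" using r dbl nonneg by (intro mult_mono) auto
        finally show ?thesis by simp
      qed
      finally have AI: "\<bar>integral {0..t} (\<lambda>u. g (a - s u)) - (\<Gamma> b - \<Gamma> (b - t))\<bar> \<le> 2 * a * (E1 + E3) + 2 * r * (2 * g a)"
        using integral_diff[OF int1 has_integral_integrable[OF hI]] integral_unique[OF hI] by simp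
      \<comment> \<open>Linearisation of \<open>\<Gamma>\<close> at \<open>a\<close>: the mean value
        \<open>g v\<close> is taken within \<open>R * sqrt a\<close> of \<open>a\<close> and hardly
        differs from \<open>g a\<close>. After normalisation the linear term \<open>y * g a\<close>
        is the summand \<open>\<sigma> * u\<close> of \<open>G\<close>.\<close>
      have main: "\<bar>\<Gamma> b - (\<Gamma> a + y * g a)\<bar> \<le> \<eta> * R\<^sup>2 * g a"
      proof -
        obtain v where v: "min a b \<le> v" "v \<le> max a b" "\<Gamma> b - \<Gamma> a = (b - a) * g v" using \<Gamma>_mvt[of a b] by blast
        have k4: "\<kappa> * a \<le> a / 4" using mult_right_mono[OF \<kappa>(3), of a] a by simp
        have va: "\<bar>v - a\<bar> \<le> \<bar>y\<bar>" using v by (auto simp: b_def)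
        have "v \<in> {\<kappa> * a..2 * a}" "a \<in> {\<kappa> * a..2 * a}"
          unfolding atLeastAtMost_iff using va y Ra4 k4 a by linarith+
        then have "\<bar>g v - g a\<bar> \<le> \<eta> * g a / a * \<bar>v - a\<bar>" by (rule var)
        also have "\<dots> \<le> \<eta> * g a / a * (R * sqrt a)" using va y \<eta> nonneg[of a] a by (intro mult_left_mono) auto
        finally have gv: "\<bar>g v - g a\<bar> \<le> \<eta> * g a / a * (R * sqrt a)" .
        have "\<Gamma> b - (\<Gamma> a + y * g a) = y * (g v - g a)" using v(3) by (simp add: b_def algebra_simps)
        then have "\<bar>\<Gamma> b - (\<Gamma> a + y * g a)\<bar> = \<bar>y\<bar> * \<bar>g v - g a\<bar>" by (simp add: abs_mult)
        also have "\<dots> \<le> (R * sqrt a) * (\<eta> * g a / a * (R * sqrt a))" using y gv by (intro mult_mono) auto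
        also have "\<dots> = \<eta> * R\<^sup>2 * g a * (sqrt a * sqrt a) / a" by (simp add: power2_eq_square)
        also have "\<dots> = \<eta> * R\<^sup>2 * g a" using a by simp
        finally show ?thesis .
      qed
      have pos: "\<Gamma> (b - t) \<le> \<Gamma> (max (a - t + y) 0)" "\<Gamma> (max (a - t + y) 0) \<le> \<Gamma> (b - t) + B"
        using \<Gamma>_pos_part[of "b - t"] by (simp_all add: b_def algebra_simps)
      have P1: "2 * a * E1 = \<epsilon> / 4 * (g a * sqrt a)" using a R by (simp add: E1_def \<eta>_def)
      have P2: "2 * r * (2 * g a) = 4 * \<epsilon> * (g a * sqrt a)" by (simp add: r_def)
      have P3: "2 * a * E3 + B \<le> \<epsilon> / 4 * (g a * sqrt a)"
      proof -
        have "2 * a * E3 + B \<le> \<epsilon> / 4 * (1 * sqrt a)" using small1 by (simp add: E3_def)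
        also have "\<dots> \<le> \<epsilon> / 4 * (g a * sqrt a)" using g1 \<epsilon> a by (intro mult_left_mono mult_right_mono) auto
        finally show ?thesis .
      qed
      have P4: "\<eta> * R\<^sup>2 * g a \<le> \<epsilon> / 4 * (g a * sqrt a)"
        using mult_right_mono[OF small2 nonneg[of a]] by (simp add: mult_ac)
      have P5: "0 \<le> \<epsilon> * (g a * sqrt a)" using \<epsilon> nonneg[of a] a by simp
      have P6: "2 * a * (E1 + E3) = 2 * a * E1 + 2 * a * E3" by (simp add: algebra_simps)
      show "\<bar>integral {0..t} (\<lambda>u. g (a - s u)) - (\<Gamma> a + y * g a - \<Gamma> (max (a - t + y) 0))\<bar> \<le> 5 * \<epsilon> * (g a * sqrt a)"
        using AI main pos P1 P2 P3 P4 P5 P6 by linarith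
    qed
  qed
qed

end

section \<open>Moments and the central limit theorem\<close>

locale normalised_subordinator = zero_drift_subordinator M S \<nu>
  for M :: "'a measure" and S :: "real \<Rightarrow> 'a \<Rightarrow> real" and \<nu> :: "real measure" +
  fixes \<sigma> :: real
  assumes S_sq: "\<And>t. 0 \<le> t \<Longrightarrow> integrable M (\<lambda>\<omega>. (S t \<omega>)\<^sup>2)"
    and S_mean: "\<And>t. 0 \<le> t \<Longrightarrow> expectation (S t) = t"
    and \<sigma>_nonneg: "0 \<le> \<sigma>"
    and S_var: "\<And>t. 0 \<le> t \<Longrightarrow> variance (S t) = \<sigma>\<^sup>2 * t"
begin

lemma integrable_S: "0 \<le> t \<Longrightarrow> integrable M (S t)"
  by (rule square_integrable_imp_integrable[OF S_measurable S_sq])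

lemma integrable_increment: "0 \<le> t \<Longrightarrow> integrable M (\<lambda>\<omega>. S (t + 1) \<omega> - S t \<omega>)"
  by (intro Bochner_Integration.integrable_diff integrable_S) auto

lemma expectation_increment: "0 \<le> t \<Longrightarrow> expectation (\<lambda>\<omega>. S (t + 1) \<omega> - S t \<omega>) = 1"
  using integrable_S[of t] integrable_S[of "t + 1"] by (simp add: S_mean)

lemma square_increment:
  assumes "0 \<le> t"
  shows "integrable M (\<lambda>\<omega>. (S (t + 1) \<omega> - S t \<omega> - 1)\<^sup>2)"
    and "expectation (\<lambda>\<omega>. (S (t + 1) \<omega> - S t \<omega> - 1)\<^sup>2) = \<sigma>\<^sup>2"
proof -
  have [measurable]: "S t \<in> borel_measurable M" "S (t + 1) \<in> borel_measurable M" "S 1 \<in> borel_measurable M"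
    using assms by auto
  have d: "distr M borel (\<lambda>\<omega>. S (t + 1) \<omega> - S t \<omega>) = distr M borel (S 1)"
    using increment_distr[OF assms, of 1] by simp
  have i1: "integrable M (\<lambda>\<omega>. (S 1 \<omega> - 1)\<^sup>2)"
    unfolding power2_diff using S_sq[of 1] integrable_S[of 1] by simp
  have "integrable (distr M borel (S 1)) (\<lambda>x. (x - 1)\<^sup>2)" using i1 by (subst integrable_distr_eq) auto
  then have "integrable (distr M borel (\<lambda>\<omega>. S (t + 1) \<omega> - S t \<omega>)) (\<lambda>x. (x - 1)\<^sup>2)" by (simp only: d)
  then show "integrable M (\<lambda>\<omega>. (S (t + 1) \<omega> - S t \<omega> - 1)\<^sup>2)" by (subst (asm) integrable_distr_eq) auto
  have "expectation (\<lambda>\<omega>. (S (t + 1) \<omega> - S t \<omega> - 1)\<^sup>2) = expectation (\<lambda>\<omega>. (S 1 \<omega> - 1)\<^sup>2)"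
    by (rule expectation_cong_distr[OF d, where f = "\<lambda>x. (x - 1)\<^sup>2"]) measurable
  also have "\<dots> = \<sigma>\<^sup>2" using S_var[of 1] S_mean[of 1] by simp
  finally show "expectation (\<lambda>\<omega>. (S (t + 1) \<omega> - S t \<omega> - 1)\<^sup>2) = \<sigma>\<^sup>2" .
qed

text \<open>Integer times suffice since the path is monotone: \<open>S_interpolate\<close> fills the
  gaps at the cost of 1, negligible against \<open>sqrt (ln n)\<close>.\<close>

lemma S_maximal:
  assumes t: "0 \<le> t" and \<rho>: "0 < \<rho>"
  shows "prob {\<omega>\<in>space M. \<exists>k\<le>N. \<rho> \<le> \<bar>S (t + real k) \<omega> - S t \<omega> - real k\<bar>} \<le> real N * \<sigma>\<^sup>2 / \<rho>\<^sup>2"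
proof -
  define Z where "Z j \<omega> = S (t + real (Suc j)) \<omega> - S (t + real j) \<omega>" for j \<omega>
  have eq: "t + real (Suc j) = (t + real j) + 1" for j by simp
  have t': "0 \<le> t + real j" for j using t by simp
  have indZ: "indep_vars (\<lambda>_. borel) Z {..<N}"
    unfolding Z_def by (rule increments_indep[of "\<lambda>j. t + real j"]) (use t in auto)
  have sumZ: "(\<Sum>j<k. Z j \<omega> - 1) = S (t + real k) \<omega> - S t \<omega> - real k" for k \<omega>
    using sum_lessThan_telescope[of "\<lambda>j. S (t + real j) \<omega>" k] by (simp add: Z_def sum_subtractf)
  have "prob {\<omega>\<in>space M. \<exists>k\<le>N. \<rho> \<le> \<bar>\<Sum>j<k. Z j \<omega> - 1\<bar>} \<le> (\<Sum>j<N. expectation (\<lambda>\<omega>. (Z j \<omega> - 1)\<^sup>2)) / \<rho>\<^sup>2"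
  proof (rule maximal_inequality_innovations[OF indZ, where \<phi> = "\<lambda>j z x. x - 1"])
    fix j
    show "(\<lambda>(z :: nat \<Rightarrow> real, x :: real). x - 1) \<in> borel_measurable ((\<Pi>\<^sub>M i\<in>{..<j}. borel) \<Otimes>\<^sub>M borel)" by measurable
    show "integrable M (\<lambda>\<omega>. (Z j \<omega> - 1)\<^sup>2)" unfolding Z_def eq by (rule square_increment(1)[OF t'])
    have "integrable M (Z j)" unfolding Z_def eq by (rule integrable_increment[OF t'])
    moreover have "expectation (Z j) = 1" unfolding Z_def eq by (rule expectation_increment[OF t'])
    ultimately show "expectation (\<lambda>\<omega>. Z j \<omega> - 1) = 0" by (simp add: prob_space)
  qed (use \<rho> in auto)
  also have "(\<Sum>j<N. expectation (\<lambda>\<omega>. (Z j \<omega> - 1)\<^sup>2)) = real N * \<sigma>\<^sup>2"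
    unfolding Z_def eq by (simp add: square_increment(2)[OF t'])
  finally show ?thesis unfolding sumZ .
qed

lemma S_maximal_event:
  assumes t: "0 \<le> t"
  shows "{\<omega>\<in>space M. \<exists>k\<le>N. \<rho> \<le> \<bar>S (t + real k) \<omega> - S t \<omega> - real k\<bar>} \<in> events"
proof -
  have [measurable]: "S t \<in> borel_measurable M" "S (t + real k) \<in> borel_measurable M" for k using t by auto
  show ?thesis by measurable
qed

text \<open>If the variance vanished, \<open>S 1\<close> would be constant, and \<open>psi\<close>
  would be 1 at 1 and 2 at 2. But \<open>2 * (1 - exp (- x)) - (1 - exp (- 2 * x))\<close> is the
  square of \<open>1 - exp (- x)\<close>, so its integral being 0 would force \<open>psi\<close> to
  vanish at 1.\<close>

lemma \<sigma>_pos: "0 < \<sigma>"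
proof (rule ccontr)
  assume "\<not> 0 < \<sigma>"
  then have "\<sigma> = 0" using \<sigma>_nonneg by simp
  then have "expectation (\<lambda>\<omega>. (S (0 + 1) \<omega> - S 0 \<omega> - 1)\<^sup>2) = 0" using square_increment(2)[of 0] by simp
  then have "AE \<omega> in M. (S (0 + 1) \<omega> - S 0 \<omega> - 1)\<^sup>2 = 0"
    using integral_nonneg_eq_0_iff_AE[OF square_increment(1)[of 0]] by simp
  with AE_space have AE1: "AE \<omega> in M. S 1 \<omega> = 1"
    by eventually_elim (use S_zero in auto)
  have L: "exp (- r) = exp (- psi \<nu> r)" if "0 \<le> r" for r
  proof -
    have "expectation (\<lambda>\<omega>. exp (- r * S 1 \<omega>)) = expectation (\<lambda>\<omega>. exp (- r))"
      using AE1 by (intro integral_cong_AE) (auto intro!: borel_measurable_exp borel_measurable_times S_measurable)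
    then show ?thesis using laplace[of 1 r] that by (simp add: prob_space)
  qed
  have p1: "psi \<nu> 1 = 1" and p2: "psi \<nu> 2 = 2" using L[of 1] L[of 2] by auto
  have i1: "set_integrable \<nu> {0<..} (\<lambda>x. 2 * (1 - exp (- 1 * x)))" and i2: "set_integrable \<nu> {0<..} (\<lambda>x. 1 - exp (- 2 * x))"
    by (intro set_integrable_mult_right integrable_psi; simp)+
  have sq: "2 * (1 - exp (- 1 * x)) - (1 - exp (- 2 * x)) = (1 - exp (- x))\<^sup>2" for x :: real
    using exp_of_nat_mult[of 2 "- x"] by (simp add: power2_diff)
  have "(LINT x:{0<..}|\<nu>. 2 * (1 - exp (- 1 * x)) - (1 - exp (- 2 * x))) = 0"
  proof -
    have "(LINT x:{0<..}|\<nu>. 2 * (1 - exp (- 1 * x))) = 2 * psi \<nu> 1"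
      unfolding psi_def by (rule set_integral_mult_right)
    moreover have "(LINT x:{0<..}|\<nu>. 1 - exp (- 2 * x)) = psi \<nu> 2" by (simp add: psi_def)
    ultimately show ?thesis using set_integral_diff(2)[OF i1 i2] p1 p2 by linarith
  qed
  moreover have "integrable \<nu> (\<lambda>x. indicat_real {0<..} x *\<^sub>R (1 - exp (- x))\<^sup>2)"
    using set_integral_diff(1)[OF i1 i2] unfolding sq set_integrable_def .
  ultimately have "AE x in \<nu>. indicat_real {0<..} x *\<^sub>R (1 - exp (- x))\<^sup>2 = 0"
    unfolding sq set_lebesgue_integral_def by (subst (asm) integral_nonneg_eq_0_iff_AE) auto
  then have "AE x in \<nu>. indicat_real {0<..} x *\<^sub>R (1 - exp (- 1 * x)) = 0"
    by eventually_elim auto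
  then have "psi \<nu> 1 = 0" unfolding psi_def set_lebesgue_integral_def by (rule integral_eq_zero_AE)
  then show False using p1 by simp
qed

text \<open>The sign is opposite to the usual centring: a path that lags behind its mean keeps the
  integrand of the compensator large for longer, which corresponds to a positive \<open>u\<close> in
  \<open>G\<close>.\<close>

definition V :: "nat \<Rightarrow> 'a \<Rightarrow> real" where
  "V k \<omega> = (real k - S (real k) \<omega>) / (\<sigma> * sqrt (real k))"

lemma V_measurable [measurable]: "V k \<in> borel_measurable M"
  unfolding V_def[abs_def] by measurable

lemma V_central_limit: "weak_conv_m (\<lambda>k. distr M borel (V k)) std_normal_distribution"
proof -
  define X where "X i \<omega> = 1 - (S (real (Suc i)) \<omega> - S (real i) \<omega>)" for i \<omega>
  have eq: "real (Suc i) = real i + 1" for i by simp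
  have XM [measurable]: "X i \<in> borel_measurable M" for i
    unfolding X_def[abs_def] by measurable
  have X1: "(X i \<omega>)\<^sup>2 = (S (real i + 1) \<omega> - S (real i) \<omega> - 1)\<^sup>2" for i \<omega>
    unfolding X_def eq by (simp add: power2_commute)
  have X_int: "integrable M (\<lambda>\<omega>. S (real (Suc i)) \<omega> - S (real i) \<omega>)" for i
    unfolding eq by (rule integrable_increment) simp
  have mean: "expectation (X i) = 0" for i
    using X_int[of i] expectation_increment[of "real i"] unfolding X_def eq by (simp add: prob_space)
  have fin: "indep_vars (\<lambda>_. borel) X {..<k}" for k
  proof -
    have "indep_vars (\<lambda>_. borel) (\<lambda>i \<omega>. S (real (Suc i)) \<omega> - S (real i) \<omega>) {..<k}"
      by (rule increments_indep) auto
    then show ?thesis unfolding X_def by (rule indep_vars_compose2) auto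
  qed
  \<comment> \<open>Independence of a sequence concerns finite subfamilies, and each of them lies in
    some initial segment.\<close>
  have indep: "indep_vars (\<lambda>_. borel) X UNIV"
    unfolding indep_vars_def2
  proof (intro conjI ballI XM)
    show "indep_sets (\<lambda>i. {X i -` A \<inter> space M |A. A \<in> sets borel}) UNIV"
    proof (subst indep_sets_finite_index_sets, intro allI impI)
      fix J :: "nat set" assume J: "finite J"
      then obtain k where "J \<subseteq> {..<k}" using finite_nat_iff_bounded by blast
      moreover have "indep_sets (\<lambda>i. {X i -` A \<inter> space M |A. A \<in> sets borel}) {..<k}"
        using fin[of k] by (simp add: indep_vars_def2)
      ultimately show "indep_sets (\<lambda>i. {X i -` A \<inter> space M |A. A \<in> sets borel}) J"
        by (rule indep_sets_mono_index)
    qed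
  qed
  have "weak_conv_m (\<lambda>k. distr M borel (\<lambda>\<omega>. (\<Sum>i<k. X i \<omega>) / sqrt (real k * \<sigma>\<^sup>2))) std_normal_distribution"
  proof (rule central_limit_theorem_zero_mean[OF indep mean \<sigma>_pos])
    fix i
    show "integrable M (\<lambda>\<omega>. (X i \<omega>)\<^sup>2)" unfolding X1 by (rule square_increment) simp
    show "variance (X i) = \<sigma>\<^sup>2" using square_increment(2)[of "real i"] by (simp add: mean X1)
    have "distr M borel (X i) = distr (distr M borel (\<lambda>\<omega>. S (real i + 1) \<omega> - S (real i) \<omega>)) borel (\<lambda>x. 1 - x)"
      unfolding X_def eq by (subst distr_distr) (auto simp: comp_def)
    also have "\<dots> = distr (distr M borel (S 1)) borel (\<lambda>x. 1 - x)"
      using increment_distr[of "real i" 1] by simp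
    finally show "distr M borel (X i) = distr (distr M borel (S 1)) borel (\<lambda>x. 1 - x)" .
  qed
  moreover have "distr M borel (\<lambda>\<omega>. (\<Sum>i<k. X i \<omega>) / sqrt (real k * \<sigma>\<^sup>2)) = distr M borel (V k)" for k
  proof (rule distr_cong[OF refl refl])
    fix \<omega> assume "\<omega> \<in> space M"
    then have "(\<Sum>i<k. X i \<omega>) = real k - S (real k) \<omega>"
      using sum_lessThan_telescope[of "\<lambda>j. S (real j) \<omega>" k] S_zero by (simp add: X_def sum_subtractf)
    then show "(\<Sum>i<k. X i \<omega>) / sqrt (real k * \<sigma>\<^sup>2) = V k \<omega>"
      using \<sigma>_pos by (simp add: V_def real_sqrt_mult mult.commute)
  qed
  ultimately show ?thesis by simp
qed

end

section \<open>Paths and laws\<close>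

text \<open>\<open>cadlag\<close> looks at the values on the half-line only, which allows passing to
  the restricted functions that \<open>D0\<close> consists of.\<close>

lemma cadlag_cong:
  assumes "cadlag x" "\<And>t. 0 \<le> t \<Longrightarrow> y t = x t" shows "cadlag y"
  unfolding cadlag_def
proof (intro conjI allI impI)
  fix t :: real assume t: "0 \<le> t"
  have "\<forall>\<^sub>F v in at_right t. x v = y v"
    using eventually_at_right_less[of t] by eventually_elim (use t assms in auto)
  moreover have "(x \<longlongrightarrow> y t) (at_right t)" using assms t by (simp add: cadlag_def)
  ultimately show "(y \<longlongrightarrow> y t) (at_right t)" by (rule Lim_transform_eventually[rotated])
next
  fix t :: real assume t: "0 < t"
  then obtain l where l: "(x \<longlongrightarrow> l) (at_left t)" using assms(1) by (auto simp: cadlag_def)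
  have "\<forall>\<^sub>F v in at_left t. v \<in> {0<..<t}" using t by (intro eventually_at_left_real) auto
  then have "\<forall>\<^sub>F v in at_left t. x v = y v" by eventually_elim (use assms in auto)
  with l have "(y \<longlongrightarrow> l) (at_left t)" by (rule Lim_transform_eventually)
  then show "\<exists>l. (y \<longlongrightarrow> l) (at_left t)" by blast
qed

lemma restrict_in_D0:
  assumes "cadlag x" "(x \<longlongrightarrow> l) at_top" shows "(\<lambda>t\<in>{0..}. x t) \<in> D0"
proof -
  have "\<forall>\<^sub>F t in at_top. x t = (\<lambda>t\<in>{0..}. x t) t"
    using eventually_ge_at_top[of 0] by eventually_elim simp
  then have "((\<lambda>t\<in>{0..}. x t) \<longlongrightarrow> l) at_top" using assms(2) by (rule Lim_transform_eventually[rotated])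
  moreover have "cadlag (\<lambda>t\<in>{0..}. x t)" by (rule cadlag_cong[OF assms(1)]) simp
  ultimately show ?thesis by (auto simp: D0_def)
qed

lemma continuous_imp_cadlag: "continuous_on UNIV x \<Longrightarrow> cadlag x"
  unfolding cadlag_def
  by (auto simp: continuous_on_eq_continuous_within isCont_def intro: tendsto_within_subset)

lemma cadlag_diff: assumes "cadlag x" "cadlag y" shows "cadlag (\<lambda>t. x t - y t)"
  unfolding cadlag_def
proof (intro conjI allI impI)
  fix t :: real assume t: "0 \<le> t"
  then show "((\<lambda>t. x t - y t) \<longlongrightarrow> x t - y t) (at_right t)"
    using assms by (intro tendsto_diff) (auto simp: cadlag_def)
next
  fix t :: real assume t: "0 < t"
  have "\<exists>l. (x \<longlongrightarrow> l) (at_left t)" "\<exists>l. (y \<longlongrightarrow> l) (at_left t)" using assms t by (auto simp: cadlag_def)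
  then show "\<exists>l. ((\<lambda>t. x t - y t) \<longlongrightarrow> l) (at_left t)" by (blast intro: tendsto_diff)
qed

lemma cadlag_cmult: assumes "cadlag x" shows "cadlag (\<lambda>t. c * x t)"
  unfolding cadlag_def
proof (intro conjI allI impI)
  fix t :: real assume t: "0 \<le> t"
  then show "((\<lambda>t. c * x t) \<longlongrightarrow> c * x t) (at_right t)"
    using assms by (intro tendsto_mult) (auto simp: cadlag_def)
next
  fix t :: real assume t: "0 < t"
  then obtain l where "(x \<longlongrightarrow> l) (at_left t)" using assms by (auto simp: cadlag_def)
  then have "((\<lambda>t. c * x t) \<longlongrightarrow> c * l) (at_left t)" by (intro tendsto_mult tendsto_const)
  then show "\<exists>l. ((\<lambda>t. c * x t) \<longlongrightarrow> l) (at_left t)" by blast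
qed

lemma counting_path:
  fixes U :: "real set"
  assumes "finite U"
  shows "cadlag (\<lambda>t. real (card {u\<in>U. u \<le> t}))" and "((\<lambda>t. real (card {u\<in>U. u \<le> t})) \<longlongrightarrow> real (card U)) at_top"
proof -
  show "cadlag (\<lambda>t. real (card {u\<in>U. u \<le> t}))"
    unfolding cadlag_def
  proof (intro conjI allI impI)
    fix t :: real
    have "\<forall>\<^sub>F v in at_right t. \<forall>u\<in>U. t < u \<longrightarrow> v < u"
    proof (intro eventually_ball_finite[OF assms] ballI)
      fix u show "\<forall>\<^sub>F v in at_right t. t < u \<longrightarrow> v < u"
      proof (cases "t < u")
        case True
        then have "\<forall>\<^sub>F v in at_right t. v \<in> {t<..<u}" by (rule eventually_at_right_real)
        then show ?thesis by eventually_elim simp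
      qed simp
    qed
    with eventually_at_right_less[of t] have "\<forall>\<^sub>F v in at_right t. real (card {u\<in>U. u \<le> v}) = real (card {u\<in>U. u \<le> t})"
    proof eventually_elim
      case (elim v)
      then have "{u\<in>U. u \<le> v} = {u\<in>U. u \<le> t}" by force
      then show ?case by simp
    qed
    then show "((\<lambda>t. real (card {u\<in>U. u \<le> t})) \<longlongrightarrow> real (card {u\<in>U. u \<le> t})) (at_right t)"
      by (rule tendsto_eventually)
  next
    fix t :: real
    have "\<forall>\<^sub>F v in at_left t. \<forall>u\<in>U. u < t \<longrightarrow> u < v"
    proof (intro eventually_ball_finite[OF assms] ballI)
      fix u show "\<forall>\<^sub>F v in at_left t. u < t \<longrightarrow> u < v"
      proof (cases "u < t")
        case True
        then have "\<forall>\<^sub>F v in at_left t. v \<in> {u<..<t}" by (rule eventually_at_left_real)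
        then show ?thesis by eventually_elim simp
      qed simp
    qed
    moreover have "\<forall>\<^sub>F v in at_left t. v \<in> {t - 1<..<t}" by (rule eventually_at_left_real) simp
    ultimately have "\<forall>\<^sub>F v in at_left t. real (card {u\<in>U. u \<le> v}) = real (card {u\<in>U. u < t})"
    proof eventually_elim
      case (elim v)
      then have "{u\<in>U. u \<le> v} = {u\<in>U. u < t}" by force
      then show ?case by simp
    qed
    then show "\<exists>l. ((\<lambda>t. real (card {u\<in>U. u \<le> t})) \<longlongrightarrow> l) (at_left t)"
      by (intro exI tendsto_eventually)
  qed
  have "\<forall>\<^sub>F t in at_top. \<forall>u\<in>U. u \<le> t" by (intro eventually_ball_finite[OF assms] ballI eventually_ge_at_top)
  then have "\<forall>\<^sub>F t in at_top. real (card {u\<in>U. u \<le> t}) = real (card U)"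
  proof eventually_elim
    case (elim t)
    then have "{u\<in>U. u \<le> t} = U" by auto
    then show ?case by simp
  qed
  then show "((\<lambda>t. real (card {u\<in>U. u \<le> t})) \<longlongrightarrow> real (card U)) at_top" by (rule tendsto_eventually)
qed

lemma space_D0_space [simp]: "space D0_space = D0"
proof -
  have "D0 \<subseteq> extensional {0..}" by (auto simp: D0_def)
  then show ?thesis by (auto simp: D0_space_def space_restrict_space space_PiM PiE_def)
qed

lemma measurable_D0_space:
  assumes "\<And>\<omega>. \<omega> \<in> space M \<Longrightarrow> (\<lambda>t\<in>{0..}. X t \<omega>) \<in> D0"
    and "\<And>t. 0 \<le> t \<Longrightarrow> X t \<in> borel_measurable M"
  shows "(\<lambda>\<omega>. \<lambda>t\<in>{0..}. X t \<omega>) \<in> measurable M D0_space"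
  unfolding D0_space_def
  by (rule measurable_restrict_space2) (use assms in \<open>auto intro!: measurable_restrict\<close>)

text \<open>A supremum of reals is meaningful for nonempty sets that are bounded above. The zero
  function, admissible because \<open>\<rho>\<close> is nonnegative, provides an element and the
  lower bound 0; \<open>bound\<close> provides the upper bound.\<close>

lemma bw_dist_bounds:
  assumes "prob_space Q" "prob_space Q'" "space Q' = space Q"
    and \<rho>: "\<And>x y. x \<in> space Q \<Longrightarrow> y \<in> space Q \<Longrightarrow> 0 \<le> \<rho> x y"
    and bound: "\<And>f. f \<in> borel_measurable Q \<Longrightarrow> f \<in> borel_measurable Q' \<Longrightarrow> (\<And>x. x \<in> space Q \<Longrightarrow> \<bar>f x\<bar> \<le> 1) \<Longrightarrow>
      (\<And>x x'. x \<in> space Q \<Longrightarrow> x' \<in> space Q \<Longrightarrow> \<bar>f x - f x'\<bar> \<le> \<rho> x x') \<Longrightarrow> \<bar>(\<integral>x. f x \<partial>Q) - (\<integral>x. f x \<partial>Q')\<bar> \<le> e"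
  shows "0 \<le> bw_dist \<rho> Q Q' \<and> bw_dist \<rho> Q Q' \<le> e"
proof (intro conjI)
  let ?A = "{\<bar>(\<integral>x. f x \<partial>Q) - (\<integral>x. f x \<partial>Q')\<bar> | f.
            f \<in> borel_measurable Q \<and> f \<in> borel_measurable Q' \<and>
            (\<forall>x \<in> space Q. \<bar>f x\<bar> \<le> 1) \<and>
            (\<forall>x \<in> space Q. \<forall>x' \<in> space Q. \<bar>f x - f x'\<bar> \<le> \<rho> x x')}"
  have le: "z \<le> e" if "z \<in> ?A" for z using that bound by auto
  have "0 \<in> ?A" using \<rho> by (intro CollectI exI[of _ "\<lambda>_. 0"]) auto
  moreover have "bdd_above ?A" using le by (rule bdd_aboveI)
  ultimately show "0 \<le> bw_dist \<rho> Q Q'" unfolding bw_dist_def by (rule cSup_upper)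
  from \<open>0 \<in> ?A\<close> show "bw_dist \<rho> Q Q' \<le> e" unfolding bw_dist_def using le by (intro cSup_least) blast+
qed

text \<open>The limit at infinity bounds a tail, and one-sided limits bound the path near each point
  of the remaining compact interval; bisection makes this global. Boundedness ensures that
  \<open>rho0\<close> is a genuine supremum.\<close>

lemma D0_bounded: assumes "x \<in> D0" shows "bounded (x ` {0..})"
proof -
  have cad: "cadlag x" and "\<exists>l. (x \<longlongrightarrow> l) at_top" using assms by (auto simp: D0_def)
  then obtain l where "(x \<longlongrightarrow> l) at_top" by blast
  then have "\<forall>\<^sub>F t in at_top. dist (x t) l < 1" by (rule tendstoD) simp
  then obtain T0 where T0: "\<And>t. T0 \<le> t \<Longrightarrow> dist (x t) l < 1" by (auto simp: eventually_at_top_linorder)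
  define T where "T = max T0 0"
  have "bounded (x ` ({0..T} \<inter> {0..}))"
  proof (rule Bolzano[of 0 T "\<lambda>u v. bounded (x ` ({u..v} \<inter> {0..}))"])
    fix a b c :: real
    assume *: "bounded (x ` ({a..b} \<inter> {0..}))" "bounded (x ` ({b..c} \<inter> {0..}))" "a \<le> b" "b \<le> c"
    have "x ` ({a..c} \<inter> {0..}) \<subseteq> x ` ({a..b} \<inter> {0..}) \<union> x ` ({b..c} \<inter> {0..})" by force
    then show "bounded (x ` ({a..c} \<inter> {0..}))" using bounded_subset[OF iffD2[OF bounded_Un conjI[OF *(1) *(2)]]] by blast
  next
    fix t assume t: "0 \<le> t" "t \<le> T"
    have "(x \<longlongrightarrow> x t) (at_right t)" using cad t by (simp add: cadlag_def)
    then have "\<forall>\<^sub>F v in at_right t. dist (x v) (x t) < 1" by (rule tendstoD) simp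
    then obtain b where b: "t < b" "\<And>v. t < v \<Longrightarrow> v < b \<Longrightarrow> dist (x v) (x t) < 1"
      by (auto simp: eventually_at_right_field)
    \<comment> \<open>At \<open>t = 0\<close> the half-line contains no left neighbourhood, so any
      negative \<open>c\<close> will do.\<close>
    obtain c l' where c: "c < t" "\<And>v. 0 \<le> v \<Longrightarrow> c < v \<Longrightarrow> v < t \<Longrightarrow> dist (x v) l' < 1"
    proof (cases "t = 0")
      case True
      then show thesis by (intro that[of "-1"]) auto
    next
      case False
      then have "0 < t" using t by simp
      then obtain l' where "(x \<longlongrightarrow> l') (at_left t)" using cad by (auto simp: cadlag_def)
      then have "\<forall>\<^sub>F v in at_left t. dist (x v) l' < 1" by (rule tendstoD) simp
      then obtain c where "c < t" "\<And>v. c < v \<Longrightarrow> v < t \<Longrightarrow> dist (x v) l' < 1"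
        by (auto simp: eventually_at_left_field)
      then show thesis by (intro that) auto
    qed
    show "\<exists>d>0. \<forall>a b. a \<le> t \<and> t \<le> b \<and> b - a < d \<longrightarrow> bounded (x ` ({a..b} \<inter> {0..}))"
    proof (intro exI[of _ "min (b - t) (t - c)"] conjI allI impI)
      show "0 < min (b - t) (t - c)" using b c by simp
      fix a' b' assume ab: "a' \<le> t \<and> t \<le> b' \<and> b' - a' < min (b - t) (t - c)"
      have "x ` ({a'..b'} \<inter> {0..}) \<subseteq> ball (x t) 1 \<union> ball l' 1"
      proof (intro image_subsetI)
        fix v assume v: "v \<in> {a'..b'} \<inter> {0..}"
        show "x v \<in> ball (x t) 1 \<union> ball l' 1"
        proof (rule linorder_cases[of v t])
          assume "v < t"
          then have "dist (x v) l' < 1" using v ab by (intro c(2)) auto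
          then show ?thesis by (simp add: dist_commute)
        next
          assume "t < v"
          then have "dist (x v) (x t) < 1" using v ab by (intro b(2)) auto
          then show ?thesis by (simp add: dist_commute)
        qed simp
      qed
      then show "bounded (x ` ({a'..b'} \<inter> {0..}))"
        by (rule bounded_subset[rotated]) (simp add: bounded_Un)
    qed
  qed (simp add: T_def)
  moreover have "x ` {0..} \<subseteq> x ` ({0..T} \<inter> {0..}) \<union> ball l 1"
  proof (intro image_subsetI)
    fix t :: real assume "t \<in> {0..}"
    then show "x t \<in> x ` ({0..T} \<inter> {0..}) \<union> ball l 1"
      using T0[of t] by (cases "t \<le> T") (auto simp: T_def dist_commute)
  qed
  ultimately show ?thesis by (meson bounded_Un bounded_ball bounded_subset)
qed

lemma rho0_nonneg: assumes "x \<in> D0" "y \<in> D0" shows "0 \<le> rho0 x y"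
proof -
  obtain b where b: "\<And>t. 0 \<le> t \<Longrightarrow> \<bar>x t\<bar> \<le> b" using D0_bounded[OF assms(1)] by (auto simp: bounded_iff)
  obtain b' where b': "\<And>t. 0 \<le> t \<Longrightarrow> \<bar>y t\<bar> \<le> b'" using D0_bounded[OF assms(2)] by (auto simp: bounded_iff)
  have "bdd_above ((\<lambda>t. \<bar>x t - y t\<bar>) ` {0..})"
  proof (rule bdd_aboveI)
    fix z assume "z \<in> (\<lambda>t. \<bar>x t - y t\<bar>) ` {0..}"
    then obtain t where "0 \<le> t" "z = \<bar>x t - y t\<bar>" by auto
    then show "z \<le> b + b'" using b[of t] b'[of t] by linarith
  qed
  then have "\<bar>x 0 - y 0\<bar> \<le> rho0 x y" unfolding rho0_def by (intro cSUP_upper) auto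
  then show ?thesis by linarith
qed

lemma rho0_le: "(\<And>t. 0 \<le> t \<Longrightarrow> \<bar>x t - y t\<bar> \<le> e) \<Longrightarrow> rho0 x y \<le> e"
  unfolding rho0_def by (rule cSUP_least) auto

context sieved_subordinator begin

lemma K_count_path:
  assumes \<omega>: "\<omega> \<in> space M"
  shows "cadlag (\<lambda>t. real (K_count S \<xi> t \<omega>))" and "\<exists>l. ((\<lambda>t. real (K_count S \<xi> t \<omega>)) \<longlongrightarrow> l) at_top"
proof -
  define U where "U = {t. 0 \<le> t \<and> hit_at (\<lambda>t. S t \<omega>) (\<xi> \<omega>) t}"
  have U: "finite U" unfolding U_def by (rule increasing_path.finite_hits[OF path[OF \<omega>] \<xi>_finite[OF \<omega>]])
  have eq: "real (K_count S \<xi> t \<omega>) = real (card {u\<in>U. u \<le> t})" for t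
    unfolding K_count_eq U_def by (rule arg_cong[where f = "\<lambda>A. real (card A)"]) auto
  show "cadlag (\<lambda>t. real (K_count S \<xi> t \<omega>))" "\<exists>l. ((\<lambda>t. real (K_count S \<xi> t \<omega>)) \<longlongrightarrow> l) at_top"
    unfolding eq using counting_path[OF U] by auto
qed

end

section \<open>Coupling\<close>

context sieved_subordinator begin

lemma K_count_eq_of_no_tail:
  assumes \<omega>: "\<omega> \<in> space M" and T: "0 \<le> T" "T \<le> t" and no: "\<xi> \<omega> \<inter> {S T \<omega><..} = {}"
  shows "K_count S \<xi> t \<omega> = K_count S \<xi> T \<omega>"
proof -
  have "u \<le> T" if "0 \<le> u" "hit_at (\<lambda>t. S t \<omega>) (\<xi> \<omega>) u" for u
  proof (rule ccontr)
    assume "\<not> u \<le> T"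
    then have "S T \<omega> \<le> left_lim (\<lambda>t. S t \<omega>) u" using increasing_path.le_left_lim[OF path[OF \<omega>] T(1)] by simp
    then show False using that(2) no by (force simp: hit_at_def)
  qed
  then have "{u \<in> {0..t}. hit_at (\<lambda>t. S t \<omega>) (\<xi> \<omega>) u} = {u \<in> {0..T}. hit_at (\<lambda>t. S t \<omega>) (\<xi> \<omega>) u}"
    using T order_trans by auto
  then show ?thesis by (simp only: K_count_eq)
qed

end

lemma (in zero_drift_subordinator) S_interpolate:
  assumes \<omega>: "\<omega> \<in> space M" and u: "real j \<le> u" "u \<le> real (Suc j)"
    and "\<bar>S (real j) \<omega> - real j - x\<bar> < \<rho>" "\<bar>S (real (Suc j)) \<omega> - real (Suc j) - x\<bar> < \<rho>"
  shows "\<bar>S u \<omega> - u - x\<bar> \<le> \<rho> + 1"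
proof -
  have "S (real j) \<omega> \<le> S u \<omega>" using u by (intro S_mono[OF \<omega>]) auto
  moreover have "S u \<omega> \<le> S (real (Suc j)) \<omega>" using u by (intro S_mono[OF \<omega>]) auto
  ultimately show ?thesis using assms by (simp add: abs_le_iff abs_less_iff)
qed

locale slow_variation_sieve = normalised_subordinator M S \<nu> \<sigma>
  for M :: "'a measure" and S :: "real \<Rightarrow> 'a \<Rightarrow> real" and \<nu> :: "real measure" and \<sigma> :: real +
  fixes \<xi> :: "real \<Rightarrow> 'a \<Rightarrow> real set" and c2 :: "real \<Rightarrow> real"
  assumes sieved: "\<And>n. 0 < n \<Longrightarrow> sieved_subordinator M S \<nu> (\<xi> n) n"
    and unbounded: "\<not> bdd_above ((\<lambda>y. N0 \<nu> (1 / y)) ` {0<..})"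
    and L_eq: "\<And>m. m > 1 \<Longrightarrow> L_fun \<nu> m = c2 m * ln m"
    and c2_at_top: "filterlim c2 at_top at_top"
begin

abbreviation g :: "real \<Rightarrow> real" where "g v \<equiv> Phi \<nu> (exp v)"

sublocale sg: slowly_growing g "\<lambda>v. c2 (exp v)" "psi \<nu> 1"
proof
  show "mono g" by (intro monoI Phi_mono) auto
  show "0 \<le> g v" for v by (rule Phi_nonneg) simp
  show "g v \<le> psi \<nu> 1 * exp v" for v using Phi_le[of "exp v"] by (simp add: mult.commute)
  have D: "(g has_real_derivative deriv (Phi \<nu>) (exp v) * exp v) (at v)" for v
  proof -
    have "(Phi \<nu> has_real_derivative deriv (Phi \<nu>) (exp v)) (at (exp v))"
      using Phi_differentiable[of "exp v"] DERIV_imp_deriv[OF Phi_differentiable[of "exp v"]] by simp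
    then show ?thesis by (rule DERIV_chain2) (rule DERIV_exp)
  qed
  show "continuous_on UNIV g" using D by (meson DERIV_isCont continuous_at_imp_continuous_on)
  show c: "filterlim (\<lambda>v. c2 (exp v)) at_top at_top" by (rule filterlim_compose[OF c2_at_top exp_at_top])
  show "filterlim g at_top at_top"
    by (rule filterlim_compose[OF Phi_tendsto_at_top[OF unbounded] exp_at_top])
  have "\<forall>\<^sub>F v in at_top. 1 \<le> c2 (exp v)" using c by (simp add: filterlim_at_top)
  then show "\<forall>\<^sub>F v in at_top. (g has_real_derivative g v / (c2 (exp v) * v)) (at v)"
    using eventually_gt_at_top[of 0]
  proof eventually_elim
    case (elim v)
    \<comment> \<open>In the logarithmic variable, \<open>L_fun\<close> is \<open>g\<close> divided
      by its derivative.\<close>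
    have "g v / (exp v * deriv (Phi \<nu>) (exp v)) = c2 (exp v) * v"
      using L_eq[of "exp v"] elim by (simp add: L_fun_def)
    moreover have "c2 (exp v) * v \<noteq> 0" using elim by simp
    \<comment> \<open>Division by 0 yields 0, so a vanishing derivative would make the left side of
      the equation 0; the right side is not 0.\<close>
    ultimately have "deriv (Phi \<nu>) (exp v) * exp v = g v / (c2 (exp v) * v)"
      by (cases "exp v * deriv (Phi \<nu>) (exp v) = 0") (auto simp: field_simps)
    then show ?case using D[of v] by simp
  qed
qed

lemma K3_eq:
  assumes "1 < n"
  shows "K3 \<nu> S (\<xi> n) n t \<omega> = 1 / (g (ln n) * sqrt (ln n)) *
    (real (K_count S (\<xi> n) t \<omega>) - (sg.\<Gamma> (ln n) - sg.\<Gamma> (max (ln n - t) 0)))"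
  unfolding K3_def sg.interval_integral_\<Gamma> pos_part_def using assms by simp

lemma G_eq:
  assumes "1 < n"
  shows "G \<nu> \<sigma> n u t = \<sigma> * u - 1 / (g (ln n) * sqrt (ln n)) *
    (sg.\<Gamma> (max (ln n - t + \<sigma> * u * sqrt (ln n)) 0) - sg.\<Gamma> (max (ln n - t) 0))"
  unfolding G_def sg.interval_integral_\<Gamma> pos_part_def using assms by simp

text \<open>Four events can spoil the comparison: \<open>F1\<close>, the path strays from its mean;
  \<open>F2\<close>, it oscillates around time \<open>ln n\<close>; \<open>F3\<close>, a point lies
  beyond \<open>3 / 2 * ln n\<close>; and outside \<open>C0\<close> the count may leave its
  compensator. The first three are allotted \<open>\<epsilon> / 5\<close> each and the last one
  \<open>3 / 10 * \<epsilon>\<close>.\<close>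

lemma coupling:
  assumes \<epsilon>: "0 < \<epsilon>"
  shows "\<forall>\<^sub>F n in at_top. \<exists>C\<in>events. 1 - \<epsilon> \<le> prob C \<and>
    (\<forall>\<omega>\<in>C. \<forall>t\<ge>0. \<bar>K3 \<nu> S (\<xi> n) n t \<omega> - G \<nu> \<sigma> n (V (nat \<lfloor>ln n\<rfloor>) \<omega>) t\<bar> \<le> \<epsilon>)"
proof -
  \<comment> \<open>The final error is \<open>8 * e\<close>: 5 from
    \<open>path_integral_approx\<close> and 3 from the count against its compensator.\<close>
  define e where "e = \<epsilon> / 10"
  have e: "0 < e" using \<epsilon> by (simp add: e_def)
  \<comment> \<open>The maximal inequality bounds the probability of \<open>F1\<close> by
    \<open>64 * \<sigma>\<^sup>2 / R\<^sup>2\<close>, which this choice turns into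
    \<open>4 / 25 * \<epsilon>\<close>.\<close>
  define R where "R = 20 * \<sigma> / sqrt \<epsilon>"
  have R: "0 < R" using \<sigma>_pos \<epsilon> by (simp add: R_def)
  have R2: "R\<^sup>2 = 400 * \<sigma>\<^sup>2 / \<epsilon>" using \<epsilon> by (simp add: R_def power_divide power_mult_distrib)
  \<comment> \<open>Solves \<open>192 * \<delta> * \<sigma>\<^sup>2 / e\<^sup>2 = \<epsilon> /
    5\<close>, the bound for \<open>F2\<close>; the cap at 1 keeps the window around time
    \<open>a\<close> in the half-line.\<close>
  define \<delta> where "\<delta> = min 1 (e\<^sup>2 * \<epsilon> / (960 * \<sigma>\<^sup>2))"
  have \<delta>: "0 < \<delta>" "\<delta> \<le> 1" using e \<epsilon> \<sigma>_pos by (auto simp: \<delta>_def)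
  have \<delta>2: "192 * \<delta> * \<sigma>\<^sup>2 / e\<^sup>2 \<le> \<epsilon> / 5"
  proof -
    have "\<delta> \<le> e\<^sup>2 * \<epsilon> / (960 * \<sigma>\<^sup>2)" by (simp add: \<delta>_def)
    then show ?thesis using e \<epsilon> \<sigma>_pos by (simp add: field_simps)
  qed
  have ev: "\<forall>\<^sub>F a in at_top. R * sqrt a / 4 + 1 \<le> R * sqrt a / 2" "\<forall>\<^sub>F a in at_top. e * sqrt a / 4 + 1 \<le> e * sqrt a / 2"
    "\<forall>\<^sub>F a in at_top. 3 \<le> \<delta> * a" "\<forall>\<^sub>F a::real in at_top. sqrt a / sqrt (a - 1) \<le> 2"
    "\<forall>\<^sub>F a in at_top. R * (sqrt a / sqrt (a - 1) - 1) \<le> e" "\<forall>\<^sub>F a in at_top. R * sqrt a \<le> a / 2"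
    "\<forall>\<^sub>F a in at_top. exp (- (a / 2)) \<le> \<epsilon> / 5"
    using R e \<delta> \<epsilon> by real_asymp+
  have ev2: "\<forall>\<^sub>F a in at_top. max 1 (30 / (e\<^sup>2 * \<epsilon>)) \<le> g a"
    using sg.g_at_top unfolding filterlim_at_top by blast
  have "\<forall>\<^sub>F a in at_top. (2::real) \<le> a" by (rule eventually_ge_at_top)
  \<comment> \<open>All estimates are in terms of \<open>a = ln n\<close>. Quantifying over the
    \<open>n\<close> with \<open>ln n = a\<close> allows returning to \<open>n\<close> at the
    end.\<close>
  with sg.path_integral_approx[OF R \<delta>(1) e] ev ev2
  have "\<forall>\<^sub>F a in at_top. \<forall>n. 0 < n \<longrightarrow> ln n = a \<longrightarrow> (\<exists>C\<in>events. 1 - \<epsilon> \<le> prob C \<and>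
    (\<forall>\<omega>\<in>C. \<forall>t\<ge>0. \<bar>K3 \<nu> S (\<xi> n) n t \<omega> - G \<nu> \<sigma> n (V (nat \<lfloor>ln n\<rfloor>) \<omega>) t\<bar> \<le> \<epsilon>))"
  proof eventually_elim
    case (elim a)
    note approx = elim(1)[rule_format] and ev1 = elim(2) and ev2 = elim(3) and ev3 = elim(4) and ev4 = elim(5)
      and ev5 = elim(6) and ev6 = elim(7) and ev7 = elim(8) and ev8 = elim(9) and a2 = elim(10)
    have a: "0 < a" "0 < sqrt a" "sqrt a * sqrt a = a" "1 \<le> sqrt a" using a2 by auto
    have ga: "1 \<le> g a" "0 < g a" "30 / (e\<^sup>2 * \<epsilon>) \<le> g a" using ev8 by auto
    define W where "W = g a * sqrt a"
    have "1 * 1 \<le> g a * sqrt a" using ga a by (intro mult_mono) auto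
    then have W: "1 \<le> W" by (simp add: W_def)
    show ?case
    proof (intro allI impI)
      fix n :: real assume n0: "0 < n" and na: "ln n = a"
      have n_eq: "n = exp a" using n0 na by auto
      have n1: "1 < n" using a by (simp add: n_eq)
      interpret sv: sieved_subordinator M S \<nu> "\<xi> n" n by (rule sieved[OF n0])
      define k where "k = nat \<lfloor>a\<rfloor>"
      have k: "a - 1 < real k" "real k \<le> a" "0 < real k" using a2 unfolding k_def by linarith+
      \<comment> \<open>\<open>V\<close> is normalised by \<open>sqrt (real k)\<close> but
        \<open>G\<close> by \<open>sqrt a\<close>; this is the correction factor, close to
        1.\<close>
      define q where "q = sqrt a / sqrt (real k)"
      have q: "1 \<le> q" "q \<le> 2" "R * (q - 1) \<le> e"
      proof -
        show "1 \<le> q" using k a by (simp add: q_def)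
        have le: "q \<le> sqrt a / sqrt (a - 1)" unfolding q_def using k a2 by (intro divide_left_mono) auto
        then show "q \<le> 2" using ev4 by simp
        have "R * (q - 1) \<le> R * (sqrt a / sqrt (a - 1) - 1)" using le R by (intro mult_left_mono) auto
        then show "R * (q - 1) \<le> e" using ev5 by simp
      qed
      define \<rho>1 where "\<rho>1 = R * sqrt a / 4"
      define \<rho>2 where "\<rho>2 = e * sqrt a / 8"
      have \<rho>: "0 < \<rho>1" "0 < \<rho>2" using R e a by (auto simp: \<rho>1_def \<rho>2_def)
      \<comment> \<open>Large enough that the unit cell containing the time \<open>2 * a\<close> has
        both ends covered.\<close>
      define N1 where "N1 = nat \<lceil>2 * a\<rceil> + 1"
      define N2 where "N2 = nat \<lceil>2 * \<delta> * a\<rceil> + 2"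
      \<comment> \<open>The anchor at the left edge of the window around \<open>a\<close>: the
        deviations of the path at a time \<open>u\<close> in the window and at \<open>k\<close> are
        both compared with the one at \<open>j1\<close>.\<close>
      define j1 where "j1 = nat \<lfloor>(1 - \<delta>) * a\<rfloor>"
      have da: "0 \<le> (1 - \<delta>) * a" using \<delta> a by simp
      have j1: "(1 - \<delta>) * a - 1 < real j1" "real j1 \<le> (1 - \<delta>) * a"
        using da unfolding j1_def by linarith+
      have da2: "0 \<le> 2 * \<delta> * a" using \<delta> a by simp
      have N1: "2 * a + 1 \<le> real N1" "real N1 \<le> 4 * a" using a2 unfolding N1_def by linarith+
      have N2: "2 * \<delta> * a + 2 \<le> real N2" "real N2 \<le> 3 * \<delta> * a" using da2 ev3 unfolding N2_def by linarith+
      define F1 where "F1 = {\<omega>\<in>space M. \<exists>k\<le>N1. \<rho>1 \<le> \<bar>S (0 + real k) \<omega> - S 0 \<omega> - real k\<bar>}"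
      define F2 where "F2 = {\<omega>\<in>space M. \<exists>k\<le>N2. \<rho>2 \<le> \<bar>S (real j1 + real k) \<omega> - S (real j1) \<omega> - real k\<bar>}"
      \<comment> \<open>Outside this event no point exceeds \<open>3 / 2 * a\<close>, a level that
        \<open>S\<close> has passed by time \<open>2 * a\<close> outside \<open>F1\<close>.\<close>
      define F3 where "F3 = {\<omega>\<in>space M. \<xi> n \<omega> \<inter> {3 / 2 * a<..} \<noteq> {}}"
      have F1: "F1 \<in> events" "prob F1 \<le> \<epsilon> / 5"
      proof -
        show "F1 \<in> events" unfolding F1_def by (rule S_maximal_event) simp
        have "prob F1 \<le> real N1 * \<sigma>\<^sup>2 / \<rho>1\<^sup>2" unfolding F1_def using \<rho> by (intro S_maximal) auto
        also have "\<dots> \<le> 4 * a * \<sigma>\<^sup>2 / \<rho>1\<^sup>2" using N1 by (intro divide_right_mono mult_right_mono) auto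
        also have "\<rho>1\<^sup>2 = 25 * \<sigma>\<^sup>2 / \<epsilon> * a" using a R2 by (simp add: \<rho>1_def power_divide power_mult_distrib)
        also have "4 * a * \<sigma>\<^sup>2 / (25 * \<sigma>\<^sup>2 / \<epsilon> * a) = 4 / 25 * \<epsilon>" using a \<sigma>_pos \<epsilon> by (simp add: field_simps)
        finally show "prob F1 \<le> \<epsilon> / 5" using \<epsilon> by simp
      qed
      have F2: "F2 \<in> events" "prob F2 \<le> \<epsilon> / 5"
      proof -
        show "F2 \<in> events" unfolding F2_def by (rule S_maximal_event) simp
        have "prob F2 \<le> real N2 * \<sigma>\<^sup>2 / \<rho>2\<^sup>2" unfolding F2_def using \<rho> by (intro S_maximal) auto
        also have "\<dots> \<le> 3 * \<delta> * a * \<sigma>\<^sup>2 / \<rho>2\<^sup>2" using N2 by (intro divide_right_mono mult_right_mono) auto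
        also have "\<rho>2\<^sup>2 = e\<^sup>2 * a / 64" using a by (simp add: \<rho>2_def power_divide power_mult_distrib)
        also have "3 * \<delta> * a * \<sigma>\<^sup>2 / (e\<^sup>2 * a / 64) = 192 * \<delta> * \<sigma>\<^sup>2 / e\<^sup>2" using a e by (simp add: field_simps)
        finally show "prob F2 \<le> \<epsilon> / 5" using \<delta>2 by simp
      qed
      have F3: "F3 \<in> events" "prob F3 \<le> \<epsilon> / 5"
      proof -
        show "F3 \<in> events" unfolding F3_def by (rule sv.tail_event)
        have "prob F3 \<le> n * exp (- (3 / 2 * a))" unfolding F3_def using a by (intro sv.prob_tail_le) simp
        also have "\<dots> = exp (- (a / 2))" by (simp add: n_eq exp_add[symmetric] field_simps)
        finally show "prob F3 \<le> \<epsilon> / 5" using ev7 by simp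
      qed
      \<comment> \<open>The error is \<open>e\<close> on the scale \<open>W\<close> of the
        normalisation. Its failure probability is of order \<open>a * g a / W\<^sup>2\<close>, that
        is \<open>1 / g a\<close>, which vanishes because \<open>Phi\<close> is unbounded.\<close>
      define \<eta> where "\<eta> = e * W"
      have \<eta>: "0 < \<eta>" using e W by (simp add: \<eta>_def)
      have Phi_n: "Phi \<nu> n = g a" by (simp add: n_eq)
      obtain C0 where C0: "C0 \<in> events" "1 - (3 * (2 * a) * Phi \<nu> n / \<eta>\<^sup>2 + e) \<le> prob C0"
        and C0K: "\<And>\<omega> t. \<omega> \<in> C0 \<Longrightarrow> t \<in> {0..2 * a} \<Longrightarrow> \<bar>real (K_count S (\<xi> n) t \<omega>) - sv.compensator t \<omega>\<bar> \<le> 2 * \<eta> + e"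
        using sv.K_count_near_compensator[of "2 * a" \<eta> e] a \<eta> e by auto
      have PC0: "1 - (\<epsilon> / 5 + \<epsilon> / 10) \<le> prob C0"
      proof -
        have "3 * (2 * a) * Phi \<nu> n / \<eta>\<^sup>2 = 6 / (e\<^sup>2 * g a)"
          using a ga e by (simp add: Phi_n \<eta>_def W_def power_mult_distrib power2_eq_square field_simps)
        also have "\<dots> \<le> \<epsilon> / 5" using ga e \<epsilon> by (simp add: field_simps)
        finally show ?thesis using C0(2) by (simp add: e_def)
      qed
      define C where "C = C0 - (F1 \<union> (F2 \<union> F3))"
      have C: "C \<in> events" unfolding C_def using C0 F1 F2 F3 by auto
      have "prob C0 \<le> prob (C \<union> (F1 \<union> (F2 \<union> F3)))"
        by (intro finite_measure_mono sets.Un C F1 F2 F3) (auto simp: C_def)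
      also have "\<dots> \<le> prob C + prob (F1 \<union> (F2 \<union> F3))" by (intro measure_Un_le sets.Un C F1 F2 F3)
      also have "\<dots> \<le> prob C + (prob F1 + prob (F2 \<union> F3))" by (intro add_left_mono measure_Un_le sets.Un F1 F2 F3)
      also have "\<dots> \<le> prob C + (prob F1 + (prob F2 + prob F3))" by (intro add_left_mono measure_Un_le F1 F2 F3)
      finally have PC: "1 - \<epsilon> \<le> prob C" using PC0 F1(2) F2(2) F3(2) \<epsilon> by linarith
      have "\<bar>K3 \<nu> S (\<xi> n) n t \<omega> - G \<nu> \<sigma> n (V (nat \<lfloor>ln n\<rfloor>) \<omega>) t\<bar> \<le> \<epsilon>" if \<omega>C: "\<omega> \<in> C" and t: "0 \<le> t" for \<omega> t
      proof -
        have \<omega>0: "\<omega> \<in> C0" "\<omega> \<notin> F1" "\<omega> \<notin> F2" "\<omega> \<notin> F3" using \<omega>C by (auto simp: C_def)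
        have \<omega>: "\<omega> \<in> space M" using sets.sets_into_space[OF C0(1)] \<omega>0 by blast
        have f1: "\<bar>S (real i) \<omega> - real i - 0\<bar> < \<rho>1" if "i \<le> N1" for i
        proof -
          have "\<not> (\<exists>k\<le>N1. \<rho>1 \<le> \<bar>S (0 + real k) \<omega> - S 0 \<omega> - real k\<bar>)" using \<omega>0(2) \<omega> by (simp add: F1_def)
          then have "\<not> \<rho>1 \<le> \<bar>S (0 + real i) \<omega> - S 0 \<omega> - real i\<bar>" using that by blast
          then show ?thesis using S_zero[OF \<omega>] by simp
        qed
        have f2: "\<bar>S (real i) \<omega> - real i - (S (real j1) \<omega> - real j1)\<bar> < \<rho>2" if "j1 \<le> i" "i \<le> j1 + N2" for i
        proof -
          have "\<not> (\<exists>k\<le>N2. \<rho>2 \<le> \<bar>S (real j1 + real k) \<omega> - S (real j1) \<omega> - real k\<bar>)" using \<omega>0(3) \<omega> by (simp add: F2_def)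
          moreover have "i - j1 \<le> N2" using that by simp
          ultimately have "\<not> \<rho>2 \<le> \<bar>S (real j1 + real (i - j1)) \<omega> - S (real j1) \<omega> - real (i - j1)\<bar>" by blast
          then show ?thesis using that by (simp add: of_nat_diff algebra_simps)
        qed
        have s1: "\<bar>S u \<omega> - u\<bar> \<le> R * sqrt a / 2" if u: "u \<in> {0..2 * a}" for u
        proof -
          define i where "i = nat \<lfloor>u\<rfloor>"
          have i: "real i \<le> u" "u < real i + 1" using u unfolding i_def atLeastAtMost_iff by linarith+
          have "real (Suc i) \<le> real N1" using i u N1 by simp
          then have "Suc i \<le> N1" by simp
          then have "\<bar>S u \<omega> - u - 0\<bar> \<le> \<rho>1 + 1" using i by (intro S_interpolate[OF \<omega>, of i] f1) auto
          then show ?thesis using ev1 by (simp add: \<rho>1_def)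
        qed
        have kj: "j1 \<le> k" "k \<le> j1 + N2"
        proof -
          have "(1 - \<delta>) * a \<le> a" using \<delta> a by simp
          then show "j1 \<le> k" unfolding j1_def k_def by (intro nat_mono floor_mono)
          have "0 \<le> \<delta> * a" using \<delta> a by simp
          then have "real k \<le> real (j1 + N2)" using k j1 N2 by (simp add: algebra_simps)
          then show "k \<le> j1 + N2" by simp
        qed
        have s2: "\<bar>S u \<omega> - u - (S (real k) \<omega> - real k)\<bar> \<le> e * sqrt a / 2" if u: "u \<in> {0..2 * a}" "\<bar>u - a\<bar> \<le> \<delta> * a" for u
        proof -
          define i where "i = nat \<lfloor>u\<rfloor>"
          have i: "real i \<le> u" "u < real i + 1" using u unfolding i_def atLeastAtMost_iff by linarith+
          have "(1 - \<delta>) * a \<le> u" using u by (simp add: algebra_simps)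
          then have ji: "j1 \<le> i" unfolding j1_def i_def by (intro nat_mono floor_mono)
          have "real (Suc i) \<le> real (j1 + N2)" using i u j1 N2 by (simp add: algebra_simps)
          then have "Suc i \<le> j1 + N2" by (simp only: of_nat_le_iff)
          then have "\<bar>S u \<omega> - u - (S (real j1) \<omega> - real j1)\<bar> \<le> \<rho>2 + 1"
            using i ji by (intro S_interpolate[OF \<omega>, of i] f2) auto
          moreover have "\<bar>S (real k) \<omega> - real k - (S (real j1) \<omega> - real j1)\<bar> < \<rho>2" using kj by (intro f2)
          moreover have "2 * \<rho>2 + 1 \<le> e * sqrt a / 2" using ev2 by (simp add: \<rho>2_def)
          ultimately show ?thesis by linarith
        qed
        \<comment> \<open>The shift inside \<open>G\<close> at \<open>V k\<close>. Up to the factor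
          \<open>q\<close> it is minus the deviation of \<open>S\<close> at time \<open>k\<close>,
          as \<open>path_integral_approx\<close> requires of the path near time
          \<open>a\<close>.\<close>
        define y where "y = \<sigma> * V k \<omega> * sqrt a"
        have y_eq: "y = (real k - S (real k) \<omega>) * q" using \<sigma>_pos by (simp add: y_def V_def q_def)
        have ka: "real k \<in> {0..2 * a}" using k a by auto
        have Sk: "\<bar>real k - S (real k) \<omega>\<bar> \<le> R * sqrt a / 2" using s1[OF ka] by (simp add: abs_minus_commute)
        have y1: "\<bar>y\<bar> \<le> R * sqrt a"
        proof -
          have "\<bar>y\<bar> \<le> (R * sqrt a / 2) * 2" unfolding y_eq abs_mult using Sk q R a by (intro mult_mono) auto
          then show ?thesis by simp
        qed
        have y2: "\<bar>y + (S (real k) \<omega> - real k)\<bar> \<le> e * sqrt a / 2"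
        proof -
          have "y + (S (real k) \<omega> - real k) = (real k - S (real k) \<omega>) * (q - 1)" by (simp add: y_eq algebra_simps)
          then have "\<bar>y + (S (real k) \<omega> - real k)\<bar> = \<bar>real k - S (real k) \<omega>\<bar> * (q - 1)" using q by (simp add: abs_mult)
          also have "\<dots> \<le> R * sqrt a / 2 * (q - 1)" using Sk q by (intro mult_right_mono) auto
          also have "\<dots> = (R * (q - 1)) * (sqrt a / 2)" by simp
          also have "\<dots> \<le> e * (sqrt a / 2)" using q a by (intro mult_right_mono) auto
          finally show ?thesis by simp
        qed
        have mono_S: "mono_on {0..} (\<lambda>u. S u \<omega>)" using S_mono[OF \<omega>] by (auto simp: mono_on_def)
        have ap: "\<bar>integral {0..t'} (\<lambda>u. g (a - S u \<omega>)) - (sg.\<Gamma> a + y * g a - sg.\<Gamma> (max (a - t' + y) 0))\<bar> \<le> 5 * e * W"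
          if t': "t' \<in> {0..2 * a}" for t'
          unfolding W_def
        proof (rule approx[OF mono_S _ y1 _ t'])
          show "\<bar>S u \<omega> - u\<bar> \<le> R * sqrt a" if "u \<in> {0..2 * a}" for u using s1[OF that] mult_nonneg_nonneg[of R "sqrt a"] R a by linarith
          show "\<bar>S u \<omega> - u + y\<bar> \<le> e * sqrt a" if "u \<in> {0..2 * a}" "\<bar>u - a\<bar> \<le> \<delta> * a" for u
            using s2[OF that] y2 by linarith
        qed
        have comp: "sv.compensator t' \<omega> = integral {0..t'} (\<lambda>u. g (a - S u \<omega>))" for t'
          unfolding sv.compensator_def
          by (intro Henstock_Kurzweil_Integration.integral_cong) (simp add: n_eq exp_diff exp_minus divide_inverse)
        have main: "\<bar>real (K_count S (\<xi> n) t' \<omega>) - (sg.\<Gamma> a + y * g a - sg.\<Gamma> (max (a - t' + y) 0))\<bar> \<le> 8 * e * W"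
          if t': "t' \<in> {0..2 * a}" for t'
        proof -
          have "e \<le> e * W" using e W by simp
          then show ?thesis using ap[OF t'] C0K[OF \<omega>0(1) t'] unfolding comp \<eta>_def by linarith
        qed
        have all: "\<bar>real (K_count S (\<xi> n) t \<omega>) - (sg.\<Gamma> a + y * g a - sg.\<Gamma> (max (a - t + y) 0))\<bar> \<le> 8 * e * W"
        proof (cases "t \<le> 2 * a")
          case True
          then show ?thesis using main t by simp
        next
          case False
          \<comment> \<open>After time \<open>2 * a\<close> nothing moves: no points remain above
            \<open>S (2 * a)\<close>, and the clipped argument of \<open>\<Gamma>\<close> is
            0.\<close>
          have "\<bar>S (2 * a) \<omega> - 2 * a\<bar> \<le> R * sqrt a / 2" using a by (intro s1) simp
          then have "3 / 2 * a \<le> S (2 * a) \<omega>" using ev6 a by linarith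
          then have "\<xi> n \<omega> \<inter> {S (2 * a) \<omega><..} = {}" using \<omega>0(4) \<omega> by (fastforce simp: F3_def)
          then have "K_count S (\<xi> n) t \<omega> = K_count S (\<xi> n) (2 * a) \<omega>"
            using False a by (intro sv.K_count_eq_of_no_tail[OF \<omega>]) auto
          moreover have "max (a - t + y) 0 = 0" "max (a - 2 * a + y) 0 = 0" using False y1 ev6 a by auto
          ultimately show ?thesis using main[of "2 * a"] a by simp
        qed
        have "K3 \<nu> S (\<xi> n) n t \<omega> - G \<nu> \<sigma> n (V (nat \<lfloor>ln n\<rfloor>) \<omega>) t
          = (real (K_count S (\<xi> n) t \<omega>) - (sg.\<Gamma> a + y * g a - sg.\<Gamma> (max (a - t + y) 0))) / W"
        proof -
          have "\<sigma> * V k \<omega> = y * g a / W" using ga a by (simp add: W_def y_def)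
          then show ?thesis
            unfolding K3_eq[OF n1] G_eq[OF n1] na k_def[symmetric] y_def[symmetric] W_def[symmetric]
            by (simp add: diff_divide_distrib add_divide_distrib)
        qed
        also have "\<bar>\<dots>\<bar> \<le> 8 * e" using all W by (simp add: abs_divide pos_divide_le_eq)
        also have "\<dots> \<le> \<epsilon>" using \<epsilon> by (simp add: e_def)
        finally show ?thesis .
      qed
      then show "\<exists>C\<in>events. 1 - \<epsilon> \<le> prob C \<and>
        (\<forall>\<omega>\<in>C. \<forall>t\<ge>0. \<bar>K3 \<nu> S (\<xi> n) n t \<omega> - G \<nu> \<sigma> n (V (nat \<lfloor>ln n\<rfloor>) \<omega>) t\<bar> \<le> \<epsilon>)"
        using C PC by blast
    qed
  qed
  then have "\<forall>\<^sub>F n in at_top. \<forall>n'. 0 < n' \<longrightarrow> ln n' = ln n \<longrightarrow> (\<exists>C\<in>events. 1 - \<epsilon> \<le> prob C \<and>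
    (\<forall>\<omega>\<in>C. \<forall>t\<ge>0. \<bar>K3 \<nu> S (\<xi> n') n' t \<omega> - G \<nu> \<sigma> n' (V (nat \<lfloor>ln n'\<rfloor>) \<omega>) t\<bar> \<le> \<epsilon>))"
    using ln_at_top by (rule eventually_compose_filterlim)
  then show ?thesis using eventually_gt_at_top[of 0] by eventually_elim blast
qed

end

section \<open>Convergence of the laws\<close>

text \<open>By Skorohod's theorem the weakly convergent laws can be realised by pointwise convergent random variables.\<close>

lemma weak_conv_uniform_lipschitz:
  fixes \<mu> :: "nat \<Rightarrow> real measure" and m :: "real measure"
  assumes \<mu>: "\<And>k. real_distribution (\<mu> k)" and m: "real_distribution m" and conv: "weak_conv_m \<mu> m"
    and c: "0 \<le> c" and \<epsilon>: "0 < \<epsilon>"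
  shows "\<exists>r. \<forall>\<^sub>F k in sequentially. \<forall>h\<in>borel_measurable borel. (\<forall>u. \<bar>h u\<bar> \<le> 1) \<longrightarrow>
    (\<forall>u u'. \<bar>u\<bar> \<le> r \<longrightarrow> \<bar>u'\<bar> \<le> r \<longrightarrow> \<bar>h u - h u'\<bar> \<le> c * \<bar>u - u'\<bar>) \<longrightarrow>
    \<bar>(\<integral>u. h u \<partial>\<mu> k) - (\<integral>u. h u \<partial>m)\<bar> \<le> \<epsilon>"
proof -
  obtain \<Omega> :: "real measure" and Ys Y where \<Omega>: "prob_space \<Omega>"
    and Ys [measurable]: "\<And>k. Ys k \<in> borel_measurable \<Omega>" and dYs: "\<And>k. distr \<Omega> borel (Ys k) = \<mu> k"
    and Y [measurable]: "Y \<in> borel_measurable \<Omega>" and dY: "distr \<Omega> borel Y = m"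
    and lim: "\<And>x. x \<in> space \<Omega> \<Longrightarrow> (\<lambda>k. Ys k x) \<longlonglongrightarrow> Y x"
    using Skorohod[OF \<mu> m conv] by force
  interpret prob_space \<Omega> by (rule \<Omega>)
  \<comment> \<open>Tightness of the limit variable: outside an event of probability below
    \<open>\<epsilon> / 8\<close> it is bounded by \<open>i\<close>, so a Lipschitz condition on a
    bounded set suffices.\<close>
  have "(\<lambda>i. expectation (indicat_real {x\<in>space \<Omega>. real i < \<bar>Y x\<bar>})) \<longlonglongrightarrow> expectation (\<lambda>_. 0)"
  proof (rule integral_dominated_convergence[where w = "\<lambda>_. 1"])
    show "AE x in \<Omega>. (\<lambda>i. indicat_real {x\<in>space \<Omega>. real i < \<bar>Y x\<bar>} x) \<longlonglongrightarrow> 0"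
    proof (intro AE_I2 tendsto_eventually)
      fix x
      obtain N :: nat where N: "\<bar>Y x\<bar> \<le> real N" using real_arch_simple by blast
      show "\<forall>\<^sub>F i in sequentially. indicat_real {x\<in>space \<Omega>. real i < \<bar>Y x\<bar>} x = 0"
        using eventually_ge_at_top[of N]
      proof eventually_elim
        case (elim i)
        then have "real N \<le> real i" by simp
        then show ?case using N by (auto simp: indicator_def)
      qed
    qed
  qed (auto simp: indicator_def)
  then have "(\<lambda>i. prob {x\<in>space \<Omega>. real i < \<bar>Y x\<bar>}) \<longlonglongrightarrow> 0" by (simp add: Int_absorb2)
  then have "\<forall>\<^sub>F i in sequentially. prob {x\<in>space \<Omega>. real i < \<bar>Y x\<bar>} < \<epsilon> / 8"
    using \<epsilon> by (intro order_tendstoD) auto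
  then obtain i :: nat where i: "prob {x\<in>space \<Omega>. real i < \<bar>Y x\<bar>} < \<epsilon> / 8" by (auto dest: eventually_happens)
  \<comment> \<open>The bound by 1 keeps the approximating variable within
    \<open>real i + 1\<close>, whence the witness for \<open>r\<close>. The \<open>c + 1\<close>
    avoids dividing by 0.\<close>
  define \<kappa> where "\<kappa> = min 1 (\<epsilon> / (4 * (c + 1)))"
  have \<kappa>: "0 < \<kappa>" "\<kappa> \<le> 1" "c * \<kappa> \<le> \<epsilon> / 4"
  proof -
    show "0 < \<kappa>" "\<kappa> \<le> 1" using c \<epsilon> by (auto simp: \<kappa>_def)
    have "c * \<kappa> \<le> c * (\<epsilon> / (4 * (c + 1)))" using c by (intro mult_left_mono) (auto simp: \<kappa>_def)
    also have "\<dots> \<le> \<epsilon> / 4" using c \<epsilon> by (simp add: field_simps)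
    finally show "c * \<kappa> \<le> \<epsilon> / 4" .
  qed
  have "(\<lambda>k. expectation (indicat_real {x\<in>space \<Omega>. \<kappa> < \<bar>Ys k x - Y x\<bar>})) \<longlonglongrightarrow> expectation (\<lambda>_. 0)"
  proof (rule integral_dominated_convergence[where w = "\<lambda>_. 1"])
    show "AE x in \<Omega>. (\<lambda>k. indicat_real {x\<in>space \<Omega>. \<kappa> < \<bar>Ys k x - Y x\<bar>} x) \<longlonglongrightarrow> 0"
    proof (intro AE_I2 tendsto_eventually)
      fix x assume "x \<in> space \<Omega>"
      from tendstoD[OF lim[OF this] \<kappa>(1)] show "\<forall>\<^sub>F k in sequentially. indicat_real {x\<in>space \<Omega>. \<kappa> < \<bar>Ys k x - Y x\<bar>} x = 0"
        by eventually_elim (auto simp: indicator_def dist_real_def)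
    qed
  qed (auto simp: indicator_def)
  then have "(\<lambda>k. prob {x\<in>space \<Omega>. \<kappa> < \<bar>Ys k x - Y x\<bar>}) \<longlonglongrightarrow> 0" by (simp add: Int_absorb2)
  then have "\<forall>\<^sub>F k in sequentially. prob {x\<in>space \<Omega>. \<kappa> < \<bar>Ys k x - Y x\<bar>} < \<epsilon> / 8"
    using \<epsilon> by (intro order_tendstoD) auto
  \<comment> \<open>\<open>i\<close>, \<open>\<kappa>\<close> and the range of indices are fixed
    before \<open>h\<close>, so the estimate is uniform over the test functions. The function
    \<open>h\<close> of the application changes with \<open>n\<close>.\<close>
  then show ?thesis
  proof (intro exI[of _ "real i + 1"], eventually_elim, intro ballI impI)
    fix k and h :: "real \<Rightarrow> real"
    assume k: "prob {x\<in>space \<Omega>. \<kappa> < \<bar>Ys k x - Y x\<bar>} < \<epsilon> / 8"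
      and h [measurable]: "h \<in> borel_measurable borel" and h1: "\<forall>u. \<bar>h u\<bar> \<le> 1"
      and hl: "\<forall>u u'. \<bar>u\<bar> \<le> real i + 1 \<longrightarrow> \<bar>u'\<bar> \<le> real i + 1 \<longrightarrow> \<bar>h u - h u'\<bar> \<le> c * \<bar>u - u'\<bar>"
    define A where "A = {x\<in>space \<Omega>. real i < \<bar>Y x\<bar>}"
    define B where "B = {x\<in>space \<Omega>. \<kappa> < \<bar>Ys k x - Y x\<bar>}"
    have [measurable]: "A \<in> events" "B \<in> events" unfolding A_def B_def by measurable
    have int: "integrable \<Omega> (\<lambda>x. h (Ys k x))" "integrable \<Omega> (\<lambda>x. h (Y x))"
      by (rule integrable_const_bound[where B = 1]; use h1 in auto)+
    have iAB: "integrable \<Omega> (indicat_real A)" "integrable \<Omega> (indicat_real B)"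
      by (intro integrable_real_indicator; simp add: emeasure_eq_measure)+
    have pw: "\<bar>h (Ys k x) - h (Y x)\<bar> \<le> \<epsilon> / 4 + 2 * indicat_real A x + 2 * indicat_real B x" if x: "x \<in> space \<Omega>" for x
    proof (cases "x \<in> A \<or> x \<in> B")
      case True
      have "\<bar>h (Ys k x) - h (Y x)\<bar> \<le> 2" using h1[rule_format, of "Ys k x"] h1[rule_format, of "Y x"] by linarith
      also have "\<dots> \<le> \<epsilon> / 4 + 2 * indicat_real A x + 2 * indicat_real B x" using True \<epsilon> by (auto simp: indicator_def)
      finally show ?thesis .
    next
      case False
      then have *: "\<bar>Y x\<bar> \<le> real i" "\<bar>Ys k x - Y x\<bar> \<le> \<kappa>" using x by (auto simp: A_def B_def)
      then have "\<bar>Ys k x\<bar> \<le> real i + 1" "\<bar>Y x\<bar> \<le> real i + 1" using \<kappa> by linarith+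
      then have "\<bar>h (Ys k x) - h (Y x)\<bar> \<le> c * \<bar>Ys k x - Y x\<bar>" using hl by blast
      also have "\<dots> \<le> c * \<kappa>" using * c by (intro mult_left_mono)
      also have "\<dots> \<le> \<epsilon> / 4" by (rule \<kappa>)
      finally show ?thesis using False by simp
    qed
    have "(\<integral>u. h u \<partial>\<mu> k) - (\<integral>u. h u \<partial>m) = expectation (\<lambda>x. h (Ys k x) - h (Y x))"
      unfolding dYs[symmetric] dY[symmetric] using int by (simp add: integral_distr)
    also have "\<bar>\<dots>\<bar> \<le> expectation (\<lambda>x. \<bar>h (Ys k x) - h (Y x)\<bar>)" by (rule integral_abs_bound)
    also have "\<dots> \<le> expectation (\<lambda>x. \<epsilon> / 4 + 2 * indicat_real A x + 2 * indicat_real B x)"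
      using int iAB pw by (intro integral_mono) auto
    also have "\<dots> = \<epsilon> / 4 + 2 * prob A + 2 * prob B"
      using iAB by (simp add: prob_space Int_absorb2 sets.sets_into_space)
    also have "\<dots> \<le> \<epsilon>" using i k \<epsilon> unfolding A_def B_def by linarith
    finally show "\<bar>(\<integral>u. h u \<partial>\<mu> k) - (\<integral>u. h u \<partial>m)\<bar> \<le> \<epsilon>" .
  qed
qed

context slow_variation_sieve begin

lemma G_path:
  assumes n: "1 < n" shows "(\<lambda>t\<in>{0..}. G \<nu> \<sigma> n u t) \<in> D0"
proof -
  let ?a = "ln n"
  have c: "continuous_on UNIV (\<lambda>t. sg.\<Gamma> (max (?a - t + b) 0))" for b
    by (rule continuous_on_compose2[OF sg.continuous_\<Gamma>]) (auto intro!: continuous_intros)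
  have "continuous_on UNIV (\<lambda>t. G \<nu> \<sigma> n u t)"
    unfolding G_eq[OF n] using c[of 0] by (intro continuous_intros c) simp
  moreover have "((\<lambda>t. G \<nu> \<sigma> n u t) \<longlongrightarrow> \<sigma> * u) at_top"
  proof (rule tendsto_eventually)
    show "\<forall>\<^sub>F t in at_top. G \<nu> \<sigma> n u t = \<sigma> * u"
      using eventually_ge_at_top[of "?a + \<bar>\<sigma> * u * sqrt ?a\<bar>"]
    proof eventually_elim
      case (elim t)
      then have "max (?a - t + \<sigma> * u * sqrt ?a) 0 = 0" "max (?a - t) 0 = 0" by linarith+
      then show ?case unfolding G_eq[OF n] by simp
    qed
  qed
  ultimately show ?thesis by (intro restrict_in_D0 continuous_imp_cadlag)
qed

lemma G_law_measurable:
  assumes n: "1 < n" and U [measurable]: "U \<in> borel_measurable N"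
  shows "(\<lambda>\<omega>. \<lambda>t\<in>{0..}. G \<nu> \<sigma> n (U \<omega>) t) \<in> measurable N D0_space"
proof (rule measurable_D0_space[OF G_path[OF n]])
  fix t
  have [measurable]: "sg.\<Gamma> \<in> borel_measurable borel" by (rule borel_measurable_continuous_onI[OF sg.continuous_\<Gamma>])
  show "(\<lambda>\<omega>. G \<nu> \<sigma> n (U \<omega>) t) \<in> borel_measurable N" unfolding G_eq[OF n] by measurable
qed

lemma K3_law_measurable:
  assumes n: "1 < n" shows "(\<lambda>\<omega>. \<lambda>t\<in>{0..}. K3 \<nu> S (\<xi> n) n t \<omega>) \<in> measurable M D0_space"
proof -
  interpret sv: sieved_subordinator M S \<nu> "\<xi> n" n using n by (intro sieved) simp
  let ?a = "ln n"
  show ?thesis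
  proof (rule measurable_D0_space)
    fix \<omega> assume \<omega>: "\<omega> \<in> space M"
    have c: "continuous_on UNIV (\<lambda>t. sg.\<Gamma> ?a - sg.\<Gamma> (max (?a - t) 0))"
      by (intro continuous_intros continuous_on_compose2[OF sg.continuous_\<Gamma>]) auto
    have "\<forall>\<^sub>F t in at_top. sg.\<Gamma> ?a - sg.\<Gamma> (max (?a - t) 0) = sg.\<Gamma> ?a - sg.\<Gamma> 0"
      using eventually_ge_at_top[of ?a] by eventually_elim (simp add: max_def)
    then have l: "((\<lambda>t. sg.\<Gamma> ?a - sg.\<Gamma> (max (?a - t) 0)) \<longlongrightarrow> sg.\<Gamma> ?a - sg.\<Gamma> 0) at_top" by (rule tendsto_eventually)
    obtain l' where l': "((\<lambda>t. real (K_count S (\<xi> n) t \<omega>)) \<longlongrightarrow> l') at_top" using sv.K_count_path(2)[OF \<omega>] by blast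
    have "cadlag (\<lambda>t. K3 \<nu> S (\<xi> n) n t \<omega>)"
      unfolding K3_eq[OF n] by (intro cadlag_cmult cadlag_diff sv.K_count_path(1)[OF \<omega>] continuous_imp_cadlag[OF c])
    moreover have "((\<lambda>t. K3 \<nu> S (\<xi> n) n t \<omega>) \<longlongrightarrow> 1 / (g ?a * sqrt ?a) * (l' - (sg.\<Gamma> ?a - sg.\<Gamma> 0))) at_top"
      unfolding K3_eq[OF n] by (rule tendsto_mult[OF tendsto_const tendsto_diff[OF l' l]])
    ultimately show "(\<lambda>t\<in>{0..}. K3 \<nu> S (\<xi> n) n t \<omega>) \<in> D0" by (rule restrict_in_D0)
  next
    fix t :: real assume t: "0 \<le> t"
    note [measurable] = sv.K_count_measurable[OF t]
    show "(\<lambda>\<omega>. K3 \<nu> S (\<xi> n) n t \<omega>) \<in> borel_measurable M" unfolding K3_eq[OF n] by measurable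
  qed
qed

text \<open>Bounded \<open>u\<close> keep the limits of integration below \<open>2 * ln n\<close>
  for large \<open>n\<close>, where \<open>doubling\<close> bounds the integrand by
  \<open>2 * Phi \<nu> n\<close>. The constant consists of \<open>\<sigma>\<close> from the linear
  term and \<open>2 * \<sigma>\<close> from the integral.\<close>

lemma G_lipschitz:
  "\<forall>\<^sub>F n in at_top. \<forall>u u' t. \<bar>u\<bar> \<le> r \<longrightarrow> \<bar>u'\<bar> \<le> r \<longrightarrow> 0 \<le> t \<longrightarrow>
    \<bar>G \<nu> \<sigma> n u t - G \<nu> \<sigma> n u' t\<bar> \<le> 3 * \<sigma> * \<bar>u - u'\<bar>"
proof -
  have ev: "\<forall>\<^sub>F a in at_top. \<sigma> * r * sqrt a \<le> a" using \<sigma>_pos by real_asymp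
  have ev2: "\<forall>\<^sub>F a in at_top. 1 \<le> g a" using sg.g_at_top by (simp add: filterlim_at_top)
  have "\<forall>\<^sub>F a in at_top. g (2 * a) \<le> 2 * g a \<and> \<sigma> * r * sqrt a \<le> a \<and> 1 \<le> g a"
    using sg.doubling ev ev2 by eventually_elim auto
  then have "\<forall>\<^sub>F n in at_top. g (2 * ln n) \<le> 2 * g (ln n) \<and> \<sigma> * r * sqrt (ln n) \<le> ln n \<and> 1 \<le> g (ln n)"
    using ln_at_top by (rule eventually_compose_filterlim)
  then show ?thesis using eventually_gt_at_top[of 1]
  proof eventually_elim
    case (elim n)
    define a where "a = ln n"
    have a: "0 < a" "0 < sqrt a" using elim by (auto simp: a_def)
    have ga: "g (2 * a) \<le> 2 * g a" "\<sigma> * r * sqrt a \<le> a" "1 \<le> g a" using elim by (auto simp: a_def)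
    show ?case
    proof (intro allI impI)
      fix u u' t :: real assume u: "\<bar>u\<bar> \<le> r" "\<bar>u'\<bar> \<le> r" and t: "0 \<le> t"
      define W where "W = g a * sqrt a"
      have W: "0 < W" using a ga by (simp add: W_def)
      define p where "p v = max (a - t + \<sigma> * v * sqrt a) 0" for v
      have p2: "p v \<le> 2 * a" if "\<bar>v\<bar> \<le> r" for v
      proof -
        have "\<sigma> * v * sqrt a \<le> \<sigma> * r * sqrt a" using that \<sigma>_pos a by (intro mult_right_mono mult_left_mono) auto
        then show ?thesis using ga t a by (simp add: p_def)
      qed
      have "\<bar>sg.\<Gamma> (p u) - sg.\<Gamma> (p u')\<bar> \<le> \<bar>p u - p u'\<bar> * g (2 * a)" using p2 u by (intro sg.\<Gamma>_lipschitz) auto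
      also have "\<dots> \<le> (\<sigma> * \<bar>u - u'\<bar> * sqrt a) * (2 * g a)"
      proof (intro mult_mono ga)
        have "\<bar>p u - p u'\<bar> \<le> \<bar>\<sigma> * u * sqrt a - \<sigma> * u' * sqrt a\<bar>" by (auto simp: p_def)
        also have "\<dots> = \<sigma> * \<bar>u - u'\<bar> * sqrt a"
          using \<sigma>_pos a by (simp add: left_diff_distrib[symmetric] right_diff_distrib[symmetric] abs_mult)
        finally show "\<bar>p u - p u'\<bar> \<le> \<sigma> * \<bar>u - u'\<bar> * sqrt a" .
      qed (use \<sigma>_pos a sg.nonneg in auto)
      also have "\<dots> = 2 * \<sigma> * \<bar>u - u'\<bar> * W" by (simp add: W_def)
      finally have "\<bar>sg.\<Gamma> (p u) - sg.\<Gamma> (p u')\<bar> / W \<le> 2 * \<sigma> * \<bar>u - u'\<bar>" using W by (simp add: pos_divide_le_eq)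
      moreover have "G \<nu> \<sigma> n u t - G \<nu> \<sigma> n u' t = \<sigma> * (u - u') - (sg.\<Gamma> (p u) - sg.\<Gamma> (p u')) / W"
        unfolding G_eq[OF elim(2)] a_def[symmetric] p_def[symmetric] W_def[symmetric]
        by (simp add: diff_divide_distrib algebra_simps)
      moreover have "\<bar>\<sigma> * (u - u') - (sg.\<Gamma> (p u) - sg.\<Gamma> (p u')) / W\<bar>
        \<le> \<bar>\<sigma> * (u - u')\<bar> + \<bar>(sg.\<Gamma> (p u) - sg.\<Gamma> (p u')) / W\<bar>" by (rule abs_triangle_ineq4)
      moreover have "\<bar>\<sigma> * (u - u')\<bar> = \<sigma> * \<bar>u - u'\<bar>" using \<sigma>_pos by (simp add: abs_mult)
      moreover have "\<bar>(sg.\<Gamma> (p u) - sg.\<Gamma> (p u')) / W\<bar> = \<bar>sg.\<Gamma> (p u) - sg.\<Gamma> (p u')\<bar> / W" using W by simp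
      ultimately show "\<bar>G \<nu> \<sigma> n u t - G \<nu> \<sigma> n u' t\<bar> \<le> 3 * \<sigma> * \<bar>u - u'\<bar>" by linarith
    qed
  qed
qed

text \<open>The intermediate process is \<open>G\<close> at \<open>V\<close>. The coupling lives on
  the space of \<open>S\<close>; it costs \<open>e\<close> on the good event and twice the
  probability of the bad one. The passage from \<open>V\<close> to \<open>U\<close> concerns laws on
  the line only, so \<open>U\<close> may live on a different space.\<close>

lemma bw_dist0_limit:
  assumes P: "prob_space P" and U: "distributed P lborel U std_normal_density"
  shows "((\<lambda>n. bw_dist0 (process_law M (K3 \<nu> S (\<xi> n) n)) (process_law P (\<lambda>t \<omega>. G \<nu> \<sigma> n (U \<omega>) t))) \<longlongrightarrow> 0) at_top"
proof (rule tendstoI)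
  fix \<epsilon> :: real assume "0 < \<epsilon>"
  \<comment> \<open>Three parts for the coupling, one for the central limit theorem, and one to
    spare for the strict inequality.\<close>
  define e where "e = \<epsilon> / 5"
  have e: "0 < e" using \<open>0 < \<epsilon>\<close> by (simp add: e_def)
  interpret P: prob_space P by (rule P)
  have UM [measurable]: "U \<in> borel_measurable P" using U by (simp add: distributed_def)
  have dU: "distr P borel U = std_normal_distribution"
  proof -
    have "distr P borel U = distr P lborel U" by (rule distr_cong) auto
    then show ?thesis using U by (simp add: distributed_def)
  qed
  obtain r where r: "\<forall>\<^sub>F k in sequentially. \<forall>h\<in>borel_measurable borel. (\<forall>u. \<bar>h u\<bar> \<le> 1) \<longrightarrow>
    (\<forall>u u'. \<bar>u\<bar> \<le> r \<longrightarrow> \<bar>u'\<bar> \<le> r \<longrightarrow> \<bar>h u - h u'\<bar> \<le> (3 * \<sigma>) * \<bar>u - u'\<bar>) \<longrightarrow>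
    \<bar>(\<integral>u. h u \<partial>distr M borel (V k)) - (\<integral>u. h u \<partial>std_normal_distribution)\<bar> \<le> e"
    using weak_conv_uniform_lipschitz[OF real_distribution_distr[OF V_measurable] real_dist_normal_dist V_central_limit, of "3 * \<sigma>" e]
      \<sigma>_pos e by auto
  have "filterlim (\<lambda>n. nat \<lfloor>ln n\<rfloor>) sequentially (at_top :: real filter)"
    by (intro filterlim_compose[OF filterlim_nat_sequentially] filterlim_compose[OF filterlim_floor_sequentially] ln_at_top)
  with r have r': "\<forall>\<^sub>F n :: real in at_top. \<forall>h\<in>borel_measurable borel. (\<forall>u. \<bar>h u\<bar> \<le> 1) \<longrightarrow>
    (\<forall>u u'. \<bar>u\<bar> \<le> r \<longrightarrow> \<bar>u'\<bar> \<le> r \<longrightarrow> \<bar>h u - h u'\<bar> \<le> (3 * \<sigma>) * \<bar>u - u'\<bar>) \<longrightarrow>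
    \<bar>(\<integral>u. h u \<partial>distr M borel (V (nat \<lfloor>ln n\<rfloor>))) - (\<integral>u. h u \<partial>std_normal_distribution)\<bar> \<le> e"
    by (rule eventually_compose_filterlim)
  show "\<forall>\<^sub>F n in at_top. dist (bw_dist0 (process_law M (K3 \<nu> S (\<xi> n) n)) (process_law P (\<lambda>t \<omega>. G \<nu> \<sigma> n (U \<omega>) t))) 0 < \<epsilon>"
    using coupling[OF e] G_lipschitz[of r] r' eventually_gt_at_top[of 1]
  proof eventually_elim
    case (elim n)
    note n = elim(4)
    define k where "k = nat \<lfloor>ln n\<rfloor>"
    obtain C where C: "C \<in> events" "1 - e \<le> prob C"
      and close: "\<And>\<omega> t. \<omega> \<in> C \<Longrightarrow> 0 \<le> t \<Longrightarrow> \<bar>K3 \<nu> S (\<xi> n) n t \<omega> - G \<nu> \<sigma> n (V k \<omega>) t\<bar> \<le> e"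
      using elim(1) unfolding k_def by blast
    define Kp where "Kp \<omega> = (\<lambda>t\<in>{0..}. K3 \<nu> S (\<xi> n) n t \<omega>)" for \<omega>
    define Gp where "Gp u = (\<lambda>t\<in>{0..}. G \<nu> \<sigma> n u t)" for u
    have Kp [measurable]: "Kp \<in> measurable M D0_space" unfolding Kp_def[abs_def] by (rule K3_law_measurable[OF n])
    have Gp [measurable]: "Gp \<in> measurable borel D0_space"
      unfolding Gp_def[abs_def] by (rule G_law_measurable[OF n]) simp
    have GU: "(\<lambda>\<omega>. Gp (U \<omega>)) \<in> measurable P D0_space" by measurable
    let ?Q = "process_law M (K3 \<nu> S (\<xi> n) n)" and ?Q' = "process_law P (\<lambda>t \<omega>. G \<nu> \<sigma> n (U \<omega>) t)"
    have Q: "?Q = distr M D0_space Kp" by (simp add: process_law_def Kp_def[abs_def])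
    have Q': "?Q' = distr P D0_space (\<lambda>\<omega>. Gp (U \<omega>))" by (simp add: process_law_def Gp_def)
    have spQ: "space ?Q = D0" "space ?Q' = D0" by (auto simp: process_law_def)
    have KD: "Kp \<omega> \<in> D0" if "\<omega> \<in> space M" for \<omega> using measurable_space[OF Kp that] by simp
    have GD: "Gp u \<in> D0" for u using measurable_space[OF Gp, of u] by simp
    have "0 \<le> bw_dist0 ?Q ?Q' \<and> bw_dist0 ?Q ?Q' \<le> 4 * e"
    proof (rule bw_dist_bounds)
      show "prob_space ?Q" unfolding Q by (rule prob_space_distr[OF Kp])
      show "prob_space ?Q'" unfolding Q' by (rule P.prob_space_distr[OF GU])
      show "space ?Q' = space ?Q" by (simp add: spQ)
      show "0 \<le> rho0 x y" if "x \<in> space ?Q" "y \<in> space ?Q" for x y using that by (auto simp: spQ intro: rho0_nonneg)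
      show "\<bar>(\<integral>x. f x \<partial>?Q) - (\<integral>x. f x \<partial>?Q')\<bar> \<le> 4 * e"
        if fQ: "f \<in> borel_measurable ?Q" and "f \<in> borel_measurable ?Q'"
        and f1: "\<And>x. x \<in> space ?Q \<Longrightarrow> \<bar>f x\<bar> \<le> 1"
        and fl: "\<And>x x'. x \<in> space ?Q \<Longrightarrow> x' \<in> space ?Q \<Longrightarrow> \<bar>f x - f x'\<bar> \<le> rho0 x x'" for f
      proof -
        have f [measurable]: "f \<in> borel_measurable D0_space" using fQ by (simp add: Q)
        \<comment> \<open>Composition with \<open>G\<close> turns the test function on paths into
          one on the line, Lipschitz for arguments within \<open>r\<close> by
          \<open>G_lipschitz\<close>.\<close>
        define h where "h u = f (Gp u)" for u
        have h [measurable]: "h \<in> borel_measurable borel" unfolding h_def[abs_def] by measurable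
        have h1: "\<bar>h u\<bar> \<le> 1" for u using f1 GD by (simp add: h_def spQ)
        have hl: "\<bar>h u - h u'\<bar> \<le> 3 * \<sigma> * \<bar>u - u'\<bar>" if "\<bar>u\<bar> \<le> r" "\<bar>u'\<bar> \<le> r" for u u'
        proof -
          have "\<bar>h u - h u'\<bar> \<le> rho0 (Gp u) (Gp u')" using fl GD by (simp add: h_def spQ)
          also have "\<dots> \<le> 3 * \<sigma> * \<bar>u - u'\<bar>"
            by (rule rho0_le) (use elim(2) that in \<open>simp add: Gp_def\<close>)
          finally show ?thesis .
        qed
        have i1: "(\<integral>x. f x \<partial>?Q) = expectation (\<lambda>\<omega>. f (Kp \<omega>))" unfolding Q by (rule integral_distr[OF Kp f])
        have "(\<integral>x. f x \<partial>?Q') = P.expectation (\<lambda>\<omega>. h (U \<omega>))"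
          unfolding Q' h_def by (rule integral_distr[OF GU f])
        also have "\<dots> = (\<integral>u. h u \<partial>std_normal_distribution)"
          unfolding dU[symmetric] by (rule integral_distr[symmetric]) auto
        finally have i2: "(\<integral>x. f x \<partial>?Q') = (\<integral>u. h u \<partial>std_normal_distribution)" .
        have i3: "expectation (\<lambda>\<omega>. h (V k \<omega>)) = (\<integral>u. h u \<partial>distr M borel (V k))"
          by (rule integral_distr[symmetric]) auto
        have ik: "\<bar>(\<integral>u. h u \<partial>distr M borel (V k)) - (\<integral>u. h u \<partial>std_normal_distribution)\<bar> \<le> e"
          using elim(3) h h1 hl unfolding k_def by blast
        have fK1: "\<bar>f (Kp \<omega>)\<bar> \<le> 1" if "\<omega> \<in> space M" for \<omega> using f1 KD[OF that] by (simp add: spQ)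
        have int: "integrable M (\<lambda>\<omega>. f (Kp \<omega>))" "integrable M (\<lambda>\<omega>. h (V k \<omega>))"
          by (rule integrable_const_bound[where B = 1]; use fK1 h1 in auto)+
        have pw: "\<bar>f (Kp \<omega>) - h (V k \<omega>)\<bar> \<le> e + 2 * indicat_real (space M - C) \<omega>" if \<omega>: "\<omega> \<in> space M" for \<omega>
        proof (cases "\<omega> \<in> C")
          case True
          have "\<bar>f (Kp \<omega>) - h (V k \<omega>)\<bar> \<le> rho0 (Kp \<omega>) (Gp (V k \<omega>))" using fl KD[OF \<omega>] GD by (simp add: h_def spQ)
          also have "\<dots> \<le> e" by (rule rho0_le) (use close[OF True] in \<open>simp add: Gp_def Kp_def\<close>)
          finally show ?thesis using True by simp
        next
          case False
          have "\<bar>f (Kp \<omega>) - h (V k \<omega>)\<bar> \<le> 2" using fK1[OF \<omega>] h1[of "V k \<omega>"] by linarith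
          then show ?thesis using False \<omega> e by simp
        qed
        have iC: "integrable M (indicat_real (space M - C))"
          using C by (intro integrable_real_indicator) (auto simp: emeasure_eq_measure)
        have "\<bar>expectation (\<lambda>\<omega>. f (Kp \<omega>)) - expectation (\<lambda>\<omega>. h (V k \<omega>))\<bar> = \<bar>expectation (\<lambda>\<omega>. f (Kp \<omega>) - h (V k \<omega>))\<bar>"
          using int by simp
        also have "\<dots> \<le> expectation (\<lambda>\<omega>. \<bar>f (Kp \<omega>) - h (V k \<omega>)\<bar>)" by (rule integral_abs_bound)
        also have "\<dots> \<le> expectation (\<lambda>\<omega>. e + 2 * indicat_real (space M - C) \<omega>)"
        proof (intro integral_mono pw)
          show "integrable M (\<lambda>\<omega>. \<bar>f (Kp \<omega>) - h (V k \<omega>)\<bar>)" using int by simp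
          show "integrable M (\<lambda>\<omega>. e + 2 * indicat_real (space M - C) \<omega>)" using iC by simp
        qed
        also have "\<dots> = e + 2 * prob (space M - C)" using iC by (simp add: prob_space Int_absorb2)
        also have "\<dots> \<le> 3 * e" using C prob_compl[OF C(1)] by simp
        finally show ?thesis using i1 i2 i3 ik by linarith
      qed
    qed
    then show ?case using e by (simp add: e_def)
  qed
qed

end

theorem theorem6p4:
  fixes M :: "'a measure" and S :: "real \<Rightarrow> 'a \<Rightarrow> real" and \<nu>0 :: "real measure"
    and \<sigma> :: real and \<xi> :: "real \<Rightarrow> 'a \<Rightarrow> real set" and c2 :: "real \<Rightarrow> real"
    and P :: "'b measure" and U :: "'b \<Rightarrow> real"
  assumes "subordinator M S"
    and "has_drift_levy_measure M S 0 \<nu>0"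
    and "\<And>t. t \<ge> 0 \<Longrightarrow> integrable M (\<lambda>\<omega>. (S t \<omega>)\<^sup>2)"
    and "\<And>t. t \<ge> 0 \<Longrightarrow> prob_space.expectation M (S t) = t"
    and "\<sigma> \<ge> 0"
    and "\<And>t. t \<ge> 0 \<Longrightarrow> prob_space.variance M (S t) = \<sigma>\<^sup>2 * t"
    and "\<And>n \<omega>. n > 0 \<Longrightarrow> \<omega> \<in> space M \<Longrightarrow> \<xi> n \<omega> \<subseteq> {0<..}"
    and "\<And>n. n > 0 \<Longrightarrow> poisson_point_process M (\<xi> n) (exp_intensity n)"
    and "\<And>n. n > 0 \<Longrightarrow> indep_of_process M (\<xi> n) S"
    and "assumption_A1 \<nu>0"
    and "assumption_A2 \<nu>0"
    and "\<And>m. m > 1 \<Longrightarrow> L_fun \<nu>0 m = c2 m * ln m"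
    and "filterlim c2 at_top at_top"
    and "prob_space P"
    and "distributed P lborel U std_normal_density"
  shows "((\<lambda>n. bw_dist0 (process_law M (K3 \<nu>0 S (\<xi> n) n))
                        (process_law P (\<lambda>t \<omega>. G \<nu>0 \<sigma> n (U \<omega>) t))) \<longlongrightarrow> 0) at_top"
proof -
  interpret prob_space M using assms(1) by (simp add: subordinator_def)
  interpret zero_drift_subordinator M S \<nu>0
    by unfold_locales (use assms(1,2) in \<open>auto simp: has_drift_levy_measure_def\<close>)
  have sv: "sieved_subordinator M S \<nu>0 (\<xi> n) n" if "0 < n" for n
    by unfold_locales (use assms(7-9) that in auto)
  interpret slow_variation_sieve M S \<nu>0 \<sigma> \<xi> c2
  proof (intro slow_variation_sieve.intro slow_variation_sieve_axioms.intro
      normalised_subordinator.intro normalised_subordinator_axioms.intro)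
    show "zero_drift_subordinator M S \<nu>0" by unfold_locales
    show "\<not> bdd_above ((\<lambda>y. N0 \<nu>0 (1 / y)) ` {0<..})" using assms(10) by (simp add: assumption_A1_def)
  qed (use assms sv in auto)
  show ?thesis by (rule bw_dist0_limit[OF assms(14,15)])
qed

end
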